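(* Let $K$ be a field and let $G$ be a finite group such that $|G|\in K^\times$, acting linearly on a polynomial ring $R$ over $K$. Suppose that $G$ contains no non-identity elements that fix (pointwise) a hyperplane in the space of one-forms $[R]_1$. Then $\mathrm{s}^{\mathrm{diff}}_K(R^G)=1/|G|$.
   Context: $R$ is a standard graded polynomial ring in finitely many variables, $G$ acts by degree-preserving $K$-algebra automorphisms, and $R^G$ is the graded ring of invariants. For an $\mathbb N$-graded finitely generated $K$-algebra $T$ with $T_0=K$, homogeneous maximal ideal $\mathfrak m$ and $d=\dim T$: $D^0_{T|K}=\operatorname{Hom}_T(T,T)$ and $D^n_{T|K}=\{\delta\in\operatorname{Hom}_K(T,T) : [\delta,t]\in D^{n-1}_{T|K}\ \forall t\in T\}$; the differential powers are $\mathfrak m^{\langle n\rangle_K}=\{f\in T : \delta(f)\in\mathfrak m \text{ for all }\delta\in D^{n-1}_{T|K}\}$; and the differential signature is $\mathrm{s}^{\mathrm{diff}}_K(T)=\limsup_{n\to\infty}\dfrac{\lambda_T(T/\mathfrak m^{\langle n\rangle_K})}{n^d/d!}$, where $\lambda_T$ is length. *)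

theory Defs
  imports
    "HOL-Algebra.Algebra"
    "HOL-Algebra.Algebraic_Closure_Type"
    "HOL-Library.Poly_Mapping"
    "HOL-Library.Extended_Real"
begin

section \<open>Dimension and length\<close>

definition krull_dim :: "('a, 'm) ring_scheme \<Rightarrow> enat" where
  "krull_dim T = Sup {enat n | n. \<exists>P :: nat \<Rightarrow> 'a set.
     (\<forall>i\<le>n. primeideal (P i) T) \<and> (\<forall>i<n. P i \<subset> P (Suc i))}"

definition module_length :: "('r, 's) ring_scheme \<Rightarrow> ('r, 'a, 'm) module_scheme \<Rightarrow> enat" where
  "module_length T M = Sup {enat n | n. \<exists>N :: nat \<Rightarrow> 'a set.
     (\<forall>i\<le>n. submodule (N i) T M) \<and> (\<forall>i<n. N i \<subset> N (Suc i))}"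

text \<open>A ring \<open>T\<close> and its quotient \<open>T / I\<close>, regarded as \<open>T\<close>-modules.\<close>

definition regular_module :: "('a, 'm) ring_scheme \<Rightarrow> ('a, 'a) module" where
  "regular_module T = \<lparr>carrier = carrier T, monoid.mult = monoid.mult T, one = one T,
     ring.zero = ring.zero T, ring.add = ring.add T, module.smult = monoid.mult T\<rparr>"

definition quotient_module :: "('a, 'm) ring_scheme \<Rightarrow> 'a set \<Rightarrow> ('a, 'a set) module" where
  "quotient_module T I = \<lparr>carrier = carrier (T Quot I), monoid.mult = monoid.mult (T Quot I),
     one = one (T Quot I), ring.zero = ring.zero (T Quot I), ring.add = ring.add (T Quot I),
     module.smult = (\<lambda>t C. (I +>\<^bsub>T\<^esub> t) \<otimes>\<^bsub>T Quot I\<^esub> C)\<rparr>"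


section \<open>Differential operators, differential powers, differential signature\<close>

text \<open>
  As in HOL-Algebra, maps between structures are total functions of which only the values on the
  carrier matter.
\<close>

definition linear_endos ::
    "('r, 's) ring_scheme \<Rightarrow> ('r, 'a, 'm) module_scheme \<Rightarrow> ('a \<Rightarrow> 'a) set" where
  "linear_endos A M = {\<delta> \<in> carrier M \<rightarrow> carrier M.
     (\<forall>x\<in>carrier M. \<forall>y\<in>carrier M. \<delta> (x \<oplus>\<^bsub>M\<^esub> y) = \<delta> x \<oplus>\<^bsub>M\<^esub> \<delta> y) \<and>
     (\<forall>a\<in>carrier A. \<forall>x\<in>carrier M. \<delta> (a \<odot>\<^bsub>M\<^esub> x) = a \<odot>\<^bsub>M\<^esub> \<delta> x)}"

definition commutator :: "('a, 'm) ring_scheme \<Rightarrow> ('a \<Rightarrow> 'a) \<Rightarrow> 'a \<Rightarrow> 'a \<Rightarrow> 'a" where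
  "commutator T \<delta> t = (\<lambda>x. \<delta> (t \<otimes>\<^bsub>T\<^esub> x) \<ominus>\<^bsub>T\<^esub> t \<otimes>\<^bsub>T\<^esub> \<delta> x)"

primrec diff_ops ::
    "('k, 's) ring_scheme \<Rightarrow> ('k, 'a, 'm) module_scheme \<Rightarrow> nat \<Rightarrow> ('a \<Rightarrow> 'a) set" where
  "diff_ops K T 0 = linear_endos T (regular_module T)"
| "diff_ops K T (Suc n) =
     {\<delta> \<in> linear_endos K T. \<forall>t\<in>carrier T. commutator T \<delta> t \<in> diff_ops K T n}"

text \<open>
  A grading is given by its family \<open>gr\<close> of homogeneous components; when \<open>gr 0\<close> is the base field,
  the following ideal is the homogeneous maximal ideal.
\<close>

definition homogeneous_maximal_ideal :: "('a, 'm) ring_scheme \<Rightarrow> (nat \<Rightarrow> 'a set) \<Rightarrow> 'a set" where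
  "homogeneous_maximal_ideal T gr = Idl\<^bsub>T\<^esub> (\<Union>n\<in>{0<..}. gr n)"

text \<open>
  Differential powers are meant for \<open>n \<ge> 1\<close>. Since \<open>0 - 1 = 0\<close> on \<open>nat\<close>, the value at \<open>n = 0\<close>
  is junk; it is irrelevant for the limit superior below.
\<close>

definition diff_power ::
    "('k, 's) ring_scheme \<Rightarrow> ('k, 'a, 'm) module_scheme \<Rightarrow> 'a set \<Rightarrow> nat \<Rightarrow> 'a set" where
  "diff_power K T I n = {f \<in> carrier T. \<forall>\<delta>\<in>diff_ops K T (n - 1). \<delta> f \<in> I}"

text \<open>
  Only meaningful if the Krull dimension of \<open>T\<close> is finite (\<open>the_enat \<infinity>\<close> is unspecified), as it is
  for finitely generated algebras over a field.
\<close>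

definition diff_signature ::
    "('k, 's) ring_scheme \<Rightarrow> ('k, 'a, 'm) module_scheme \<Rightarrow> (nat \<Rightarrow> 'a set) \<Rightarrow> ereal" where
  "diff_signature K T gr =
     (let d = the_enat (krull_dim T); I = homogeneous_maximal_ideal T gr
      in limsup (\<lambda>n. ereal_of_enat (module_length T (quotient_module T (diff_power K T I n)))
                     / ereal (real n ^ d / fact d)))"


section \<open>Polynomial rings, linear actions and invariants\<close>

text \<open>
  Polynomials over \<open>'k\<close> in the variables \<open>'x\<close>: finitely supported functions from exponent vectors
  to coefficients, with the convolution product of \<^theory>\<open>HOL-Library.Poly_Mapping\<close>.
\<close>

type_synonym ('x, 'k) mpoly = "('x \<Rightarrow>\<^sub>0 nat) \<Rightarrow>\<^sub>0 'k"

definition mpoly_scale :: "'k::field \<Rightarrow> ('x, 'k) mpoly \<Rightarrow> ('x, 'k) mpoly" where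
  "mpoly_scale c f = Poly_Mapping.single 0 c * f"

definition mpoly_algebra :: "('k::field, ('x, 'k) mpoly) module" where
  "mpoly_algebra = \<lparr>carrier = UNIV, monoid.mult = (*), one = 1,
     ring.zero = 0, ring.add = (+), module.smult = mpoly_scale\<rparr>"

definition forms :: "nat \<Rightarrow> ('x::finite, 'k::field) mpoly set" where
  "forms d = {f. \<forall>m\<in>Poly_Mapping.keys f. (\<Sum>x\<in>UNIV. Poly_Mapping.lookup m x) = d}"

definition hyperplane_of_linear_forms :: "('x::finite, 'k::field) mpoly set \<Rightarrow> bool" where
  "hyperplane_of_linear_forms H \<longleftrightarrow>
     H \<subseteq> forms 1 \<and> module.subspace mpoly_scale H \<and>
     vector_space.dim mpoly_scale H + 1
       = vector_space.dim mpoly_scale (forms 1 :: ('x, 'k) mpoly set)"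

text \<open>Bijectivity of each \<open>\<phi> g\<close> is part of \<^locale>\<open>group_action\<close>.\<close>

definition linear_action ::
    "('g, 'b) monoid_scheme \<Rightarrow> ('g \<Rightarrow> ('x::finite, 'k::field) mpoly \<Rightarrow> ('x, 'k) mpoly) \<Rightarrow> bool" where
  "linear_action G \<phi> \<longleftrightarrow>
     group_action G UNIV \<phi> \<and>
     (\<forall>g\<in>carrier G.
        \<phi> g \<in> ring_hom mpoly_algebra mpoly_algebra \<and>
        \<phi> g \<in> linear_endos (ring_of_type_algebra :: 'k ring) mpoly_algebra \<and>
        (\<forall>d. \<phi> g ` forms d \<subseteq> forms d))"

definition invariant_ring ::
    "('g, 'b) monoid_scheme \<Rightarrow> ('g \<Rightarrow> ('x, 'k) mpoly \<Rightarrow> ('x, 'k) mpoly)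
       \<Rightarrow> ('k::field, ('x, 'k) mpoly) module" where
  "invariant_ring G \<phi> = mpoly_algebra\<lparr>carrier := {f. \<forall>g\<in>carrier G. \<phi> g f = f}\<rparr>"

definition invariant_forms ::
    "('g, 'b) monoid_scheme \<Rightarrow> ('g \<Rightarrow> ('x::finite, 'k::field) mpoly \<Rightarrow> ('x, 'k) mpoly)
       \<Rightarrow> nat \<Rightarrow> ('x, 'k) mpoly set" where
  "invariant_forms G \<phi> d = carrier (invariant_ring G \<phi>) \<inter> forms d"

end

theory Submission
  imports Defs
begin

text \<open>
  Let \<open>R\<close> be the polynomial ring in \<open>d\<close> variables, \<open>T = R\<^sup>G\<close>, and \<open>\<nn>\<close> the ideal of \<open>R\<close> generated by the
  variables. The differential powers of the maximal ideal of \<open>T\<close> are \<open>T \<inter> \<nn>\<^sup>n\<close>. If \<open>f \<in> T\<close> has a term of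
  degree below \<open>n\<close>, a Hasse derivative followed by the Reynolds operator maps it outside the maximal
  ideal. Conversely, without pseudoreflections a differential operator \<open>\<delta>\<close> of order \<open>k\<close> on \<open>T\<close> extends to
  \<open>R\<close>, so it cannot lower the order of vanishing at the origin by more than \<open>k\<close>. Explicitly, \<open>\<delta>\<close> gives an
  \<open>R\<close>-linear map \<open>R \<otimes> T \<rightarrow> R\<close> that kills \<open>R \<otimes> T \<inter> J\<^sup>k\<^sup>+\<^sup>1\<close>, where \<open>J \<subseteq> R \<otimes> R\<close> is the kernel of multiplication.
  Modulo \<open>J\<^sup>k\<^sup>+\<^sup>1\<close> every element of \<open>R \<otimes> R\<close> becomes an element of \<open>R \<otimes> T\<close> after multiplication by a
  product over \<open>g \<noteq> 1\<close> of powers of linear forms \<open>g v - v\<close>; since for each \<open>g\<close> there are two independent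
  such forms, no denominator survives in the extension.

  The length of \<open>T / (T \<inter> \<nn>\<^sup>n)\<close> is therefore \<open>h n\<close>, the dimension of the space of invariants of degree below
  \<open>n\<close>. For \<open>f\<close> with distinct conjugates, the powers \<open>f\<^sup>j\<close> with \<open>j < |G|\<close> are independent over \<open>T\<close>, and
  \<open>r\<close> is determined by the traces of the \<open>f\<^sup>j r\<close>; hence \<open>|G| h n\<close> lies between the numbers of monomials of
  degree below \<open>n - c\<close> and below \<open>n + c\<close> for a constant \<open>c\<close>.
\<close>

section \<open>Polynomials as a ring: evaluation, degrees, absence of zero divisors\<close>

text \<open>What is clear at once is that the map attached to \<delta> kills the (k+1)-st power of
  the ideal generated by all \<open>1 \<otimes> t - t \<otimes> 1\<close> with \<open>t\<close>
  invariant. The intersection of R \<otimes> T with \<open>J^(k+1)\<close> can be larger, and this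
  gap is the main obstacle. It is supported where R ramifies over T, that is, at points fixed by
  some \<open>g \<noteq> 1\<close>. A tensor that vanishes on the graph of every
  \<open>g \<noteq> 1\<close> but not on the diagonal yields dual bases for the trace, up to an
  invariant factor; these close the gap up to a nonzero polynomial factor, which cancels because the
  target R is a domain. The remaining denominators are treated like those of functions defined
  outside codimension two: no hyperplane is fixed, and the extension reduces to the coprimality of
  two linear forms. Thus explicit polynomials replace etaleness, reflexive modules and localisation,
  and Vandermonde arguments replace ranks over fraction fields.\<close>

locale type_ring_hom =
  fixes h :: "'a::comm_ring_1 \<Rightarrow> 'b::comm_ring_1"
  assumes hom_one [simp]: "h 1 = 1"
    and hom_add: "h (a + b) = h a + h b"
    and hom_mult: "h (a * b) = h a * h b"
begin

lemma hom_zero [simp]: "h 0 = 0"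
  using hom_add[of 0 0] by simp

lemma hom_uminus: "h (- a) = - h a"
  using hom_add[of a "- a"] by (simp add: eq_neg_iff_add_eq_0 add.commute)

lemma hom_diff: "h (a - b) = h a - h b"
  using hom_add[of a "- b"] by (simp add: hom_uminus)

lemma hom_sum: "h (\<Sum>i\<in>A. f i) = (\<Sum>i\<in>A. h (f i))"
  by (induction A rule: infinite_finite_induct) (auto simp: hom_add)

lemma hom_prod: "h (\<Prod>i\<in>A. f i) = (\<Prod>i\<in>A. h (f i))"
  by (induction A rule: infinite_finite_induct) (auto simp: hom_mult)

lemma hom_power: "h (a ^ n) = h a ^ n"
  by (induction n) (auto simp: hom_mult)

end

lemma type_ring_hom_id: "type_ring_hom (\<lambda>x. x)"
  by unfold_locales auto

lemma type_ring_hom_comp: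
  "type_ring_hom f \<Longrightarrow> type_ring_hom g \<Longrightarrow> type_ring_hom (\<lambda>x. g (f x))"
  by (simp add: type_ring_hom_def)

lemma sum_single_keys: "f = (\<Sum>m\<in>Poly_Mapping.keys f. Poly_Mapping.single m (Poly_Mapping.lookup f m))"
  by (rule poly_mapping_eqI)
    (simp add: lookup_sum lookup_single when_def in_keys_iff)

lemma poly_mapping_induct [case_names single add]:
  assumes "\<And>m c. P (Poly_Mapping.single m c)" and "\<And>f g. P f \<Longrightarrow> P g \<Longrightarrow> P (f + g)"
  shows "P (f :: 'a \<Rightarrow>\<^sub>0 'b::comm_monoid_add)"
proof -
  have "finite A \<Longrightarrow> P (\<Sum>m\<in>A. Poly_Mapping.single m (Poly_Mapping.lookup f m))" for A
  proof (induction A rule: finite_induct)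
    case empty
    show ?case using assms(1)[of undefined 0] by simp
  next
    case (insert m A)
    then show ?case using assms by simp
  qed
  then show ?thesis using sum_single_keys[of f] by (metis finite_keys)
qed

text \<open>Coefficients range over any commutative ring, because the same embedding serves for K in
  R and for R in R[y].\<close>

definition mconst :: "'c::comm_ring_1 \<Rightarrow> ('x \<Rightarrow>\<^sub>0 nat) \<Rightarrow>\<^sub>0 'c" where
  "mconst c = Poly_Mapping.single 0 c"

definition mvar :: "'x \<Rightarrow> ('x \<Rightarrow>\<^sub>0 nat) \<Rightarrow>\<^sub>0 'c::comm_ring_1" where
  "mvar x = Poly_Mapping.single (Poly_Mapping.single x 1) 1"

lemma type_ring_hom_mconst: "type_ring_hom mconst"
  by unfold_locales (auto simp: mconst_def single_add mult_single)

interpretation mconst: type_ring_hom mconst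
  by (rule type_ring_hom_mconst)

lemma mpoly_scale_eq: "mpoly_scale c f = mconst c * f"
  by (simp add: mpoly_scale_def mconst_def)

lemma mvar_power: "mvar x ^ n = Poly_Mapping.single (Poly_Mapping.single x n) 1"
  by (induction n) (auto simp: mvar_def mult_single simp flip: single_add)

lemma prod_single_one:
  "(\<Prod>i\<in>A. Poly_Mapping.single (f i :: 'a::comm_monoid_add) (1 :: 'b::comm_semiring_1))
     = Poly_Mapping.single (\<Sum>i\<in>A. f i) 1"
  by (induction A rule: infinite_finite_induct) (auto simp: mult_single)

lemma sum_single_lookup:
  "(\<Sum>x\<in>UNIV. Poly_Mapping.single x (Poly_Mapping.lookup m x)) = (m :: 'x::finite \<Rightarrow>\<^sub>0 'a::comm_monoid_add)"
  by (rule poly_mapping_eqI) (simp add: lookup_sum lookup_single when_def)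

lemma prod_mvar_power:
  "(\<Prod>x\<in>UNIV. mvar x ^ Poly_Mapping.lookup m x) = Poly_Mapping.single (m :: 'x::finite \<Rightarrow>\<^sub>0 nat) 1"
  by (simp add: mvar_power prod_single_one sum_single_lookup)

lemma single_eq_mconst_mult:
  "Poly_Mapping.single (m :: 'x::finite \<Rightarrow>\<^sub>0 nat) c
     = mconst c * (\<Prod>x\<in>UNIV. mvar x ^ Poly_Mapping.lookup m x)"
  by (simp add: prod_mvar_power mconst_def mult_single)

lemma mpoly_induct [case_names const var add mult]:
  fixes f :: "('x::finite \<Rightarrow>\<^sub>0 nat) \<Rightarrow>\<^sub>0 'c::comm_ring_1"
  assumes c: "\<And>c. P (mconst c)" and v: "\<And>x. P (mvar x)"
    and a: "\<And>f g. P f \<Longrightarrow> P g \<Longrightarrow> P (f + g)" and m: "\<And>f g. P f \<Longrightarrow> P g \<Longrightarrow> P (f * g)"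
  shows "P f"
proof (induction f rule: poly_mapping_induct)
  case (single k d)
  have one: "P 1" using c[of 1] by (simp add: mconst.hom_one)
  have "P (mvar x ^ n)" for x n
    by (induction n) (auto intro: v m one)
  then have "P (\<Prod>x\<in>A. mvar x ^ Poly_Mapping.lookup k x)" for A
    by (induction A rule: infinite_finite_induct) (auto intro: m one)
  then show ?case by (auto simp: single_eq_mconst_mult intro: c m)
qed (rule a)

lemma type_ring_hom_ext:
  fixes h h' :: "(('x::finite \<Rightarrow>\<^sub>0 nat) \<Rightarrow>\<^sub>0 'c::comm_ring_1) \<Rightarrow> 's::comm_ring_1"
  assumes "type_ring_hom h" "type_ring_hom h'"
    and "\<And>c. h (mconst c) = h' (mconst c)" and "\<And>x. h (mvar x) = h' (mvar x)"
  shows "h f = h' f"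
  using assms by (induction f rule: mpoly_induct) (auto simp: type_ring_hom_def)

definition eval_mpoly ::
    "('c::comm_ring_1 \<Rightarrow> 's::comm_ring_1) \<Rightarrow> ('x::finite \<Rightarrow> 's) \<Rightarrow> (('x \<Rightarrow>\<^sub>0 nat) \<Rightarrow>\<^sub>0 'c) \<Rightarrow> 's" where
  "eval_mpoly h v f =
     (\<Sum>m\<in>Poly_Mapping.keys f. h (Poly_Mapping.lookup f m) * (\<Prod>x\<in>UNIV. v x ^ Poly_Mapping.lookup m x))"

lemma sum_keys_superset:
  assumes "finite A" "Poly_Mapping.keys f \<subseteq> A" and "\<And>m. g m 0 = 0"
  shows "(\<Sum>m\<in>Poly_Mapping.keys f. g m (Poly_Mapping.lookup f m)) = (\<Sum>m\<in>A. g m (Poly_Mapping.lookup f m))"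
  using assms by (intro sum.mono_neutral_left) (auto simp: in_keys_iff)

lemma sum_keys_add:
  fixes g :: "'a \<Rightarrow> 'b::comm_monoid_add \<Rightarrow> 'c::comm_monoid_add"
  assumes "\<And>m. g m 0 = 0" and "\<And>m a b. g m (a + b) = g m a + g m b"
  shows "(\<Sum>m\<in>Poly_Mapping.keys (f + f'). g m (Poly_Mapping.lookup (f + f') m))
       = (\<Sum>m\<in>Poly_Mapping.keys f. g m (Poly_Mapping.lookup f m))
         + (\<Sum>m\<in>Poly_Mapping.keys f'. g m (Poly_Mapping.lookup f' m))"
proof -
  let ?A = "Poly_Mapping.keys f \<union> Poly_Mapping.keys f'"
  have "Poly_Mapping.keys (f + f') \<subseteq> ?A" by (rule Poly_Mapping.keys_add)
  then show ?thesis
    by (subst (1 2 3) sum_keys_superset[of ?A]) (auto simp: assms lookup_add sum.distrib)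
qed

lemma eval_mpoly_add:
  "type_ring_hom h \<Longrightarrow> eval_mpoly h v (f + g) = eval_mpoly h v f + eval_mpoly h v g"
  unfolding eval_mpoly_def
  by (rule sum_keys_add[of "\<lambda>m c. h c * (\<Prod>x\<in>UNIV. v x ^ Poly_Mapping.lookup m x)"])
    (auto simp: type_ring_hom.hom_zero type_ring_hom.hom_add algebra_simps)

lemma eval_mpoly_single:
  "type_ring_hom h \<Longrightarrow>
     eval_mpoly h v (Poly_Mapping.single m c) = h c * (\<Prod>x\<in>UNIV. v x ^ Poly_Mapping.lookup m x)"
  by (cases "c = 0") (auto simp: eval_mpoly_def type_ring_hom.hom_zero)

lemma type_ring_hom_eval_mpoly:
  assumes "type_ring_hom h" shows "type_ring_hom (eval_mpoly h v)"
proof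
  interpret type_ring_hom h by fact
  have one: "1 = Poly_Mapping.single 0 1" by simp
  show "eval_mpoly h v 1 = 1"
    unfolding one by (subst eval_mpoly_single[OF assms]) simp
  show "eval_mpoly h v (f + g) = eval_mpoly h v f + eval_mpoly h v g" for f g
    by (rule eval_mpoly_add[OF assms])
  show "eval_mpoly h v (f * g) = eval_mpoly h v f * eval_mpoly h v g" for f g
  proof (induction f rule: poly_mapping_induct)
    case (single m c)
    show ?case
      by (induction g rule: poly_mapping_induct)
        (auto simp: mult_single eval_mpoly_single[OF assms] hom_mult lookup_add power_add
           prod.distrib mult_ac eval_mpoly_add[OF assms] distrib_left distrib_right)
  qed (auto simp: eval_mpoly_add[OF assms] distrib_right)
qed

lemma eval_mpoly_mconst [simp]: "type_ring_hom h \<Longrightarrow> eval_mpoly h v (mconst c) = h c"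
  by (simp add: mconst_def eval_mpoly_single)

lemma eval_mpoly_mvar [simp]: "type_ring_hom h \<Longrightarrow> eval_mpoly h v (mvar x) = v x"
proof -
  assume h: "type_ring_hom h"
  have "(\<Prod>y\<in>UNIV. v y ^ Poly_Mapping.lookup (Poly_Mapping.single x (1::nat)) y)
      = (\<Prod>y\<in>UNIV. if y = x then v y else 1)"
    by (rule prod.cong) (auto simp: lookup_single when_def)
  then show ?thesis by (simp add: mvar_def eval_mpoly_single[OF h] type_ring_hom.hom_one[OF h])
qed

text \<open>Renaming the variables by numbers makes the exponents linearly ordered, so that the library
  instance \<^class>\<open>idom\<close> becomes available.\<close>

definition nat_vars :: "('x::finite, 'k::field) mpoly \<Rightarrow> (nat, 'k) mpoly" where
  "nat_vars = eval_mpoly mconst (\<lambda>x. mvar (to_nat_on (UNIV :: 'x set) x))"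

lemma type_ring_hom_nat_vars: "type_ring_hom nat_vars"
  unfolding nat_vars_def by (rule type_ring_hom_eval_mpoly[OF type_ring_hom_mconst])

interpretation nat_vars: type_ring_hom nat_vars
  by (rule type_ring_hom_nat_vars)

lemma nat_vars_eq_0_iff [simp]:
  fixes f :: "('x::finite, 'k::field) mpoly"
  shows "nat_vars f = 0 \<longleftrightarrow> f = 0"
proof
  assume 0: "nat_vars f = 0"
  \<comment> \<open>\<open>e\<close> renames the variables inside an exponent vector. It is
    injective, so \<open>nat_vars\<close> merely moves each coefficient from \<open>m\<close> to
    \<open>e m\<close>.\<close>
  define e :: "('x \<Rightarrow>\<^sub>0 nat) \<Rightarrow> nat \<Rightarrow>\<^sub>0 nat"
    where "e m = (\<Sum>x\<in>UNIV. Poly_Mapping.single (to_nat_on UNIV x) (Poly_Mapping.lookup m x))" for m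
  have l: "Poly_Mapping.lookup (e m) (to_nat_on UNIV x) = Poly_Mapping.lookup m x" for m x
  proof -
    have "(to_nat_on UNIV y = to_nat_on UNIV x) = (y = x)" for y :: 'x
      using inj_on_to_nat_on[OF countable_finite[OF finite[of "UNIV :: 'x set"]]] by (auto dest: injD)
    then show ?thesis by (simp add: e_def lookup_sum lookup_single when_def)
  qed
  have e: "e m = e m' \<longleftrightarrow> m = m'" for m m'
    using l by (metis poly_mapping_eqI)
  have "nat_vars f = (\<Sum>m\<in>Poly_Mapping.keys f. Poly_Mapping.single (e m) (Poly_Mapping.lookup f m))"
    unfolding nat_vars_def eval_mpoly_def e_def
    by (simp add: mvar_power prod_single_one mconst_def mult_single)
  then have "Poly_Mapping.lookup (nat_vars f) (e m) = Poly_Mapping.lookup f m" for m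
    by (simp add: lookup_sum lookup_single when_def e in_keys_iff)
  then show "f = 0" using 0 by (metis lookup_zero poly_mapping_eqI)
qed simp

lemma nat_vars_eq_iff [simp]: "nat_vars f = nat_vars g \<longleftrightarrow> f = g"
  using nat_vars_eq_0_iff[of "f - g"] by (simp add: nat_vars.hom_diff)

lemma mpoly_mult_eq_0_iff [simp]:
  fixes f g :: "('x::finite, 'k::field) mpoly"
  shows "f * g = 0 \<longleftrightarrow> f = 0 \<or> g = 0"
proof -
  have "f * g = 0 \<longleftrightarrow> nat_vars f * nat_vars g = 0"
    by (simp flip: nat_vars.hom_mult del: mult_eq_0_iff)
  then show ?thesis by simp
qed

lemma mpoly_mult_left_cancel:
  fixes f g h :: "('x::finite, 'k::field) mpoly"
  shows "h \<noteq> 0 \<Longrightarrow> h * f = h * g \<longleftrightarrow> f = g"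
  using mpoly_mult_eq_0_iff[of h "f - g"] by (simp add: right_diff_distrib)

lemma mpoly_power_eq_0_iff [simp]:
  fixes f :: "('x::finite, 'k::field) mpoly"
  shows "f ^ n = 0 \<longleftrightarrow> f = 0 \<and> n > 0"
  by (induction n) auto

lemma mpoly_prod_eq_0_iff:
  fixes f :: "'i \<Rightarrow> ('x::finite, 'k::field) mpoly"
  shows "finite A \<Longrightarrow> (\<Prod>i\<in>A. f i) = 0 \<longleftrightarrow> (\<exists>i\<in>A. f i = 0)"
  by (induction A rule: finite_induct) auto

section \<open>Total degree, filtration by degree and homogeneous components\<close>

definition tdeg :: "('x::finite \<Rightarrow>\<^sub>0 nat) \<Rightarrow> nat" where
  "tdeg m = (\<Sum>x\<in>UNIV. Poly_Mapping.lookup m x)"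

lemma tdeg_add: "tdeg (m + m') = tdeg m + tdeg m'"
  by (simp add: tdeg_def lookup_add sum.distrib)

lemma tdeg_0 [simp]: "tdeg 0 = 0"
  by (simp add: tdeg_def)

lemma tdeg_eq_0_iff [simp]: "tdeg m = 0 \<longleftrightarrow> m = 0"
  by (auto simp: tdeg_def intro: poly_mapping_eqI)

lemma tdeg_single [simp]: "tdeg (Poly_Mapping.single x n) = n"
  by (simp add: tdeg_def lookup_single when_def)

lemma forms_iff: "f \<in> forms d \<longleftrightarrow> (\<forall>m\<in>Poly_Mapping.keys f. tdeg m = d)"
  by (simp add: forms_def tdeg_def)

text \<open>This is the \<open>n\<close>-th power of the ideal generated by the variables, described
  by exponents so that membership is a condition on single coefficients.\<close>

definition deg_ge :: "nat \<Rightarrow> (('x::finite \<Rightarrow>\<^sub>0 nat) \<Rightarrow>\<^sub>0 'c::zero) set" where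
  "deg_ge n = {f. \<forall>m\<in>Poly_Mapping.keys f. n \<le> tdeg m}"

definition deg_less :: "nat \<Rightarrow> (('x::finite \<Rightarrow>\<^sub>0 nat) \<Rightarrow>\<^sub>0 'c::zero) set" where
  "deg_less n = {f. \<forall>m\<in>Poly_Mapping.keys f. tdeg m < n}"

lemma deg_ge_0 [simp]: "f \<in> deg_ge 0"
  by (simp add: deg_ge_def)

lemma deg_ge_add: "f \<in> deg_ge n \<Longrightarrow> g \<in> deg_ge n \<Longrightarrow> f + g \<in> deg_ge n"
  unfolding deg_ge_def using Poly_Mapping.keys_add[of f g] by auto

lemma deg_ge_zero [simp]: "0 \<in> deg_ge n"
  by (simp add: deg_ge_def)

lemma deg_ge_sum: "(\<And>i. i \<in> A \<Longrightarrow> f i \<in> deg_ge n) \<Longrightarrow> (\<Sum>i\<in>A. f i) \<in> deg_ge n"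
  by (induction A rule: infinite_finite_induct) (auto intro: deg_ge_add)

lemma deg_ge_mult:
  "f \<in> deg_ge n \<Longrightarrow> g \<in> deg_ge n' \<Longrightarrow> (f * g :: ('x::finite \<Rightarrow>\<^sub>0 nat) \<Rightarrow>\<^sub>0 'c::comm_ring_1) \<in> deg_ge (n + n')"
  unfolding deg_ge_def mem_Collect_eq
proof
  fix m assume *: "\<forall>m\<in>Poly_Mapping.keys f. n \<le> tdeg m" "\<forall>m\<in>Poly_Mapping.keys g. n' \<le> tdeg m"
    and "m \<in> Poly_Mapping.keys (f * g)"
  then obtain a b where "m = a + b" "a \<in> Poly_Mapping.keys f" "b \<in> Poly_Mapping.keys g"
    using keys_mult[of f g] by blast
  then show "n + n' \<le> tdeg m" using * by (simp add: tdeg_add add_mono)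
qed

lemma deg_ge_1_iff: "f \<in> deg_ge (Suc 0) \<longleftrightarrow> Poly_Mapping.lookup f 0 = 0"
  unfolding deg_ge_def
  by (auto simp: Suc_le_eq) (metis in_keys_iff tdeg_0 less_irrefl,
      metis gr0I in_keys_iff tdeg_eq_0_iff)

lemma deg_less_add: "f \<in> deg_less n \<Longrightarrow> g \<in> deg_less n \<Longrightarrow> f + g \<in> deg_less n"
  unfolding deg_less_def using Poly_Mapping.keys_add[of f g] by auto

lemma deg_less_zero [simp]: "0 \<in> deg_less n"
  by (simp add: deg_less_def)

lemma deg_less_sum: "(\<And>i. i \<in> A \<Longrightarrow> f i \<in> deg_less n) \<Longrightarrow> (\<Sum>i\<in>A. f i) \<in> deg_less n"
  by (induction A rule: infinite_finite_induct) (auto intro: deg_less_add)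

lemma deg_less_mult:
  "f \<in> deg_less n \<Longrightarrow> g \<in> deg_less n' \<Longrightarrow>
     (f * g :: ('x::finite \<Rightarrow>\<^sub>0 nat) \<Rightarrow>\<^sub>0 'c::comm_ring_1) \<in> deg_less (n + n')"
  unfolding deg_less_def mem_Collect_eq
proof
  fix m assume *: "\<forall>m\<in>Poly_Mapping.keys f. tdeg m < n" "\<forall>m\<in>Poly_Mapping.keys g. tdeg m < n'"
    and "m \<in> Poly_Mapping.keys (f * g)"
  then obtain a b where "m = a + b" "a \<in> Poly_Mapping.keys f" "b \<in> Poly_Mapping.keys g"
    using keys_mult[of f g] by blast
  then show "tdeg m < n + n'" using * by (simp add: tdeg_add add_strict_mono)
qed

lemma deg_less_mono: "f \<in> deg_less n \<Longrightarrow> n \<le> n' \<Longrightarrow> f \<in> deg_less n'"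
  by (force simp: deg_less_def)

lemma ex_deg_less: "\<exists>n. f \<in> deg_less n"
proof
  show "f \<in> deg_less (Suc (\<Sum>m\<in>Poly_Mapping.keys f. tdeg m))"
    by (auto simp: deg_less_def less_Suc_eq_le intro: member_le_sum)
qed

lemma ex_deg_less_finite:
  assumes "finite A" shows "\<exists>n. \<forall>i\<in>A. f i \<in> deg_less n"
proof -
  have "\<forall>i. \<exists>n. f i \<in> deg_less n" using ex_deg_less by blast
  then obtain n where n: "\<And>i. f i \<in> deg_less (n i)" by metis
  have "f i \<in> deg_less (\<Sum>i\<in>A. n i)" if "i \<in> A" for i
    using n by (rule deg_less_mono) (use assms that in \<open>auto intro: member_le_sum\<close>)
  then show ?thesis by blast
qed

text \<open>One operation for two uses: homogeneous components (\<open>hcomp\<close>) and truncation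
  below a degree (\<open>truncate\<close>).\<close>

definition mrestrict :: "('x \<Rightarrow>\<^sub>0 nat) set \<Rightarrow> (('x \<Rightarrow>\<^sub>0 nat) \<Rightarrow>\<^sub>0 'c::zero) \<Rightarrow> ('x \<Rightarrow>\<^sub>0 nat) \<Rightarrow>\<^sub>0 'c" where
  "mrestrict S f = Poly_Mapping.mapp (\<lambda>m c. c when m \<in> S) f"

lemma lookup_mrestrict [simp]:
  "Poly_Mapping.lookup (mrestrict S f) m = (if m \<in> S then Poly_Mapping.lookup f m else 0)"
  by (auto simp: mrestrict_def lookup_mapp when_def in_keys_iff)

lemma keys_mrestrict: "Poly_Mapping.keys (mrestrict S f) = Poly_Mapping.keys f \<inter> S"
  by (auto simp: in_keys_iff split: if_splits)

lemma mrestrict_zero [simp]: "mrestrict S 0 = 0"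
  by (rule poly_mapping_eqI) simp

lemma mrestrict_add: "mrestrict S (f + g) = mrestrict S f + mrestrict S g"
  by (rule poly_mapping_eqI) (auto simp: lookup_add)

lemma mrestrict_sum:
  fixes f :: "'i \<Rightarrow> ('x \<Rightarrow>\<^sub>0 nat) \<Rightarrow>\<^sub>0 'c::comm_monoid_add"
  shows "mrestrict S (\<Sum>i\<in>A. f i) = (\<Sum>i\<in>A. mrestrict S (f i))"
  by (rule poly_mapping_eqI) (auto simp: lookup_sum)

lemma lookup_mconst_mult: "Poly_Mapping.lookup (mconst c * f) m = c * Poly_Mapping.lookup f m"
  unfolding mconst_def by (simp add: map.rep_eq when_def flip: mult_map_scale_conv_mult)

lemma mrestrict_mconst: "mrestrict S (mconst c * f) = mconst c * mrestrict S f"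
  by (rule poly_mapping_eqI) (auto simp: lookup_mconst_mult)

lemma keys_mconst_mult: "Poly_Mapping.keys (mconst c * f) \<subseteq> Poly_Mapping.keys f"
  by (auto simp: in_keys_iff lookup_mconst_mult)

abbreviation hcomp :: "nat \<Rightarrow> (('x::finite \<Rightarrow>\<^sub>0 nat) \<Rightarrow>\<^sub>0 'c::zero) \<Rightarrow> ('x \<Rightarrow>\<^sub>0 nat) \<Rightarrow>\<^sub>0 'c" where
  "hcomp d \<equiv> mrestrict {m. tdeg m = d}"

lemma hcomp_forms: "hcomp d f \<in> forms d"
  by (auto simp: forms_iff keys_mrestrict)

lemma sum_hcomp:
  fixes f :: "('x::finite \<Rightarrow>\<^sub>0 nat) \<Rightarrow>\<^sub>0 'c::comm_monoid_add"
  assumes "f \<in> deg_less n" shows "(\<Sum>d<n. hcomp d f) = f"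
proof (rule poly_mapping_eqI)
  fix m
  have "(\<Sum>d<n. if tdeg m = d then Poly_Mapping.lookup f m else 0) = (if tdeg m < n then Poly_Mapping.lookup f m else 0)"
    by simp
  then show "Poly_Mapping.lookup (\<Sum>d<n. hcomp d f) m = Poly_Mapping.lookup f m"
    using assms by (auto simp: lookup_sum deg_less_def in_keys_iff)
qed

lemma hcomp_of_form: "f \<in> forms d \<Longrightarrow> hcomp e f = (if e = d then f else 0)"
  by (rule poly_mapping_eqI) (auto simp: forms_iff in_keys_iff)

interpretation V: vector_space "mpoly_scale :: 'k::field \<Rightarrow> ('x, 'k) mpoly \<Rightarrow> _"
  by unfold_locales (auto simp: mpoly_scale_eq mconst.hom_add mconst.hom_mult algebra_simps)

section \<open>The tensor square of the polynomial ring\<close>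

text \<open>\<open>R \<otimes>\<^sub>K R\<close> is the polynomial ring \<open>R[y]\<close>; \<^const>\<open>mconst\<close> embeds the left factor and \<open>right_embed\<close> the
  right one.\<close>

type_synonym ('x, 'k) tensor_square = "('x, ('x, 'k) mpoly) mpoly"

definition right_embed :: "('x::finite, 'k::field) mpoly \<Rightarrow> ('x, 'k) tensor_square" where
  "right_embed = eval_mpoly (\<lambda>c. mconst (mconst c)) mvar"

lemma type_ring_hom_right_embed: "type_ring_hom right_embed"
  unfolding right_embed_def
  by (intro type_ring_hom_eval_mpoly type_ring_hom_comp[OF type_ring_hom_mconst type_ring_hom_mconst])

lemma of_nat_eq_mconst: "of_nat n = mconst (of_nat n)"
  by (induction n) (auto simp: mconst.hom_add)

interpretation right_embed: type_ring_hom right_embed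
  by (rule type_ring_hom_right_embed)

lemma right_embed_mconst: "right_embed (mconst c) = mconst (mconst c)"
  by (simp add: right_embed_def type_ring_hom_comp[OF type_ring_hom_mconst type_ring_hom_mconst])

lemma right_embed_mvar: "right_embed (mvar x) = mvar x"
  by (simp add: right_embed_def type_ring_hom_comp[OF type_ring_hom_mconst type_ring_hom_mconst])

lemma single_eq_mconst_right_embed:
  "Poly_Mapping.single m a = mconst a * right_embed (Poly_Mapping.single m 1)"
  by (simp add: single_eq_mconst_mult[of m a] right_embed.hom_prod right_embed.hom_power right_embed_mvar
      flip: prod_mvar_power)

lemma tensor_induct [case_names tensor add]:
  assumes "\<And>a b. P (mconst a * right_embed b)" and "\<And>F H. P F \<Longrightarrow> P H \<Longrightarrow> P (F + H)"
  shows "P F"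
  by (induction F rule: poly_mapping_induct) (auto simp: single_eq_mconst_right_embed intro: assms)

lemma tensor_hom_ext:
  assumes "type_ring_hom h" "type_ring_hom h'"
    and "\<And>a. h (mconst a) = h' (mconst a)" and "\<And>b. h (right_embed b) = h' (right_embed b)"
  shows "h F = h' F"
  using assms by (induction F rule: tensor_induct) (auto simp: type_ring_hom_def)

definition diagonal :: "('x::finite, 'k::field) tensor_square \<Rightarrow> ('x, 'k) mpoly" where
  "diagonal = eval_mpoly (\<lambda>a. a) mvar"

interpretation diagonal: type_ring_hom diagonal
  unfolding diagonal_def by (rule type_ring_hom_eval_mpoly[OF type_ring_hom_id])

lemma diagonal_mconst [simp]: "diagonal (mconst a) = a"
  by (simp add: diagonal_def type_ring_hom_id)

lemma diagonal_mvar: "diagonal (mvar x) = mvar x"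
  by (simp add: diagonal_def type_ring_hom_id)

lemma diagonal_right_embed [simp]: "diagonal (right_embed b) = b"
proof -
  have "type_ring_hom (\<lambda>b. diagonal (right_embed b))"
    by (rule type_ring_hom_comp[OF type_ring_hom_right_embed diagonal.type_ring_hom_axioms])
  then show ?thesis
    by (rule type_ring_hom_ext[OF _ type_ring_hom_id])
      (auto simp: right_embed_mconst right_embed_mvar diagonal_mvar)
qed

section \<open>Left linear maps on the tensor square and powers of the diagonal ideal\<close>

definition k_linear :: "(('x::finite, 'k::field) mpoly \<Rightarrow> ('x, 'k) mpoly) \<Rightarrow> bool" where
  "k_linear \<theta> \<longleftrightarrow> (\<forall>a b. \<theta> (a + b) = \<theta> a + \<theta> b) \<and> (\<forall>c a. \<theta> (mconst c * a) = mconst c * \<theta> a)"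

text \<open>The R-linear map sending \<open>a \<otimes> b\<close> to \<open>a * \<theta> b\<close>.
  Reading off \<theta> on monomials makes it additive for every \<theta>; the formula for all pure
  tensors is where K-linearity of \<theta> enters.\<close>

definition left_linear_ext ::
    "(('x::finite, 'k::field) mpoly \<Rightarrow> ('x, 'k) mpoly) \<Rightarrow> ('x, 'k) tensor_square \<Rightarrow> ('x, 'k) mpoly" where
  "left_linear_ext \<theta> F = (\<Sum>m\<in>Poly_Mapping.keys F. Poly_Mapping.lookup F m * \<theta> (Poly_Mapping.single m 1))"

lemma left_linear_ext_add: "left_linear_ext \<theta> (F + H) = left_linear_ext \<theta> F + left_linear_ext \<theta> H"
  unfolding left_linear_ext_def
  by (rule sum_keys_add[of "\<lambda>m a. a * \<theta> (Poly_Mapping.single m 1)"]) (auto simp: algebra_simps)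

lemma left_linear_ext_single:
  "left_linear_ext \<theta> (Poly_Mapping.single m a) = a * \<theta> (Poly_Mapping.single m 1)"
  by (cases "a = 0") (auto simp: left_linear_ext_def)

lemma left_linear_ext_tensor:
  assumes "k_linear \<theta>" shows "left_linear_ext \<theta> (mconst a * right_embed b) = a * \<theta> b"
proof (induction b rule: poly_mapping_induct)
  case (single m c)
  have c: "Poly_Mapping.single m c = mconst c * Poly_Mapping.single m 1"
    by (simp add: mconst_def mult_single)
  have "mconst a * right_embed (Poly_Mapping.single m c) = Poly_Mapping.single m (a * mconst c)"
    unfolding c by (subst single_eq_mconst_right_embed)
      (simp add: right_embed.hom_mult right_embed_mconst mconst.hom_mult mult.assoc)
  then have "left_linear_ext \<theta> (mconst a * right_embed (Poly_Mapping.single m c))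
      = a * mconst c * \<theta> (Poly_Mapping.single m 1)"
    by (simp add: left_linear_ext_single)
  also have "\<dots> = a * \<theta> (Poly_Mapping.single m c)"
    using assms unfolding c k_linear_def by (metis mult.assoc)
  finally show ?case .
next
  case (add f g)
  then show ?case using assms
    by (simp add: right_embed.hom_add distrib_left left_linear_ext_add k_linear_def)
qed

lemma left_linear_ext_mconst_mult: "left_linear_ext \<theta> (mconst a * F) = a * left_linear_ext \<theta> F"
proof (induction F rule: poly_mapping_induct)
  case (single m b)
  show ?case by (simp add: mconst_def mult_single left_linear_ext_single)
qed (simp add: distrib_left left_linear_ext_add)

lemma left_linear_ext_zero [simp]: "left_linear_ext \<theta> 0 = 0"
  using left_linear_ext_add[of \<theta> 0 0] by simp

lemma left_linear_ext_uminus: "left_linear_ext \<theta> (- F) = - left_linear_ext \<theta> F"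
  using left_linear_ext_add[of \<theta> F "- F"] by (simp add: eq_neg_iff_add_eq_0 add.commute)

lemma left_linear_ext_diff: "left_linear_ext \<theta> (F - H) = left_linear_ext \<theta> F - left_linear_ext \<theta> H"
  using left_linear_ext_add[of \<theta> F "- H"] by (simp add: left_linear_ext_uminus)

lemma left_linear_ext_sum: "left_linear_ext \<theta> (\<Sum>i\<in>A. F i) = (\<Sum>i\<in>A. left_linear_ext \<theta> (F i))"
  by (induction A rule: infinite_finite_induct) (auto simp: left_linear_ext_add)

text \<open>Membership in the \<open>n\<close>-th power of the kernel of \<^const>\<open>diagonal\<close>.\<close>

inductive diag_pow :: "nat \<Rightarrow> ('x::finite, 'k::field) tensor_square \<Rightarrow> bool" where
  base: "diag_pow 0 F"
| zero: "diag_pow n 0"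
| step: "diag_pow n F \<Longrightarrow> diag_pow (Suc n) ((right_embed w - mconst w) * F)"
| add: "diag_pow n F \<Longrightarrow> diag_pow n H \<Longrightarrow> diag_pow n (F + H)"

lemma diag_pow_mult: "diag_pow n F \<Longrightarrow> diag_pow n (H * F)"
proof (induction arbitrary: H rule: diag_pow.induct)
  case (step n F w)
  have "diag_pow (Suc n) ((right_embed w - mconst w) * (H * F))"
    by (rule diag_pow.step) (rule step.IH)
  then show ?case by (simp add: algebra_simps)
qed (auto simp: distrib_left intro: diag_pow.intros)

lemma diag_pow_uminus: "diag_pow n F \<Longrightarrow> diag_pow n (- F)"
  using diag_pow_mult[of n F "- 1"] by simp

lemma diag_pow_diff: "diag_pow n F \<Longrightarrow> diag_pow n H \<Longrightarrow> diag_pow n (F - H)"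
  using diag_pow.add[of n F "- H"] by (simp add: diag_pow_uminus)

lemma diag_pow_sum: "(\<And>i. i \<in> A \<Longrightarrow> diag_pow n (F i)) \<Longrightarrow> diag_pow n (\<Sum>i\<in>A. F i)"
  by (induction A rule: infinite_finite_induct) (auto intro: diag_pow.intros)

lemma diag_pow_mult_pow: "diag_pow n F \<Longrightarrow> diag_pow n' H \<Longrightarrow> diag_pow (n + n') (F * H)"
proof (induction rule: diag_pow.induct)
  case (step n F w)
  then show ?case using diag_pow.step[of "n + n'" "F * H" w] by (simp add: mult.assoc)
qed (auto simp: distrib_right intro: diag_pow.intros diag_pow_mult)

lemma diag_pow_Suc_D: "diag_pow n F \<Longrightarrow> diag_pow (n - 1) F"
proof (induction rule: diag_pow.induct)
  case (step n F w)
  then show ?case by (simp add: diag_pow_mult)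
qed (auto intro: diag_pow.intros)

lemma diag_pow_mono: "diag_pow n F \<Longrightarrow> n' \<le> n \<Longrightarrow> diag_pow n' F"
proof (induction n)
  case (Suc n)
  then show ?case using diag_pow_Suc_D[of "Suc n" F] by (cases "n' = Suc n") auto
qed simp

lemma diag_pow_gen: "diag_pow (Suc 0) (right_embed w - mconst w)"
  using diag_pow.step[OF diag_pow.base, of w 1] by simp

lemma diag_pow_power: "diag_pow (Suc 0) F \<Longrightarrow> diag_pow n (F ^ n)"
proof (induction n)
  case (Suc n)
  then show ?case using diag_pow_mult_pow[of "Suc 0" F n "F ^ n"] by simp
qed (rule diag_pow.base)

lemma diag_pow_prod:
  "finite A \<Longrightarrow> i \<in> A \<Longrightarrow> diag_pow n (F i) \<Longrightarrow> diag_pow n (\<Prod>i\<in>A. F i)"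
  by (subst prod.remove) (auto simp: mult.commute[of "F i"] intro: diag_pow_mult)

lemma diagonal_diag_pow: "diag_pow n F \<Longrightarrow> n > 0 \<Longrightarrow> diagonal F = 0"
  by (induction rule: diag_pow.induct) (auto simp: diagonal.hom_mult diagonal.hom_add diagonal.hom_diff)

section \<open>Linear group actions\<close>

text \<open>The action is described by homomorphisms between types, so that ordinary ring arithmetic
  applies; \<open>linear_group_actionI\<close> derives this form from
  \<open>linear_action\<close>.\<close>

locale linear_group_action = group G
  for G :: "('g, 'b) monoid_scheme" (structure) +
  fixes \<phi> :: "'g \<Rightarrow> ('x::finite, 'k::field) mpoly \<Rightarrow> ('x, 'k) mpoly"
  assumes fin: "finite (carrier G)"
    and card_nonzero: "of_nat (card (carrier G)) \<noteq> (0 :: 'k)"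
    and act_hom: "g \<in> carrier G \<Longrightarrow> type_ring_hom (\<phi> g)"
    and act_mconst: "g \<in> carrier G \<Longrightarrow> \<phi> g (mconst c) = mconst c"
    and act_forms: "g \<in> carrier G \<Longrightarrow> f \<in> forms d \<Longrightarrow> \<phi> g f \<in> forms d"
    and act_mult: "g \<in> carrier G \<Longrightarrow> h \<in> carrier G \<Longrightarrow> \<phi> (g \<otimes> h) f = \<phi> g (\<phi> h f)"
    and act_one: "\<phi> \<one> f = f"
begin

lemma sum_group_shift: "g \<in> carrier G \<Longrightarrow> (\<Sum>h\<in>carrier G. F (g \<otimes> h)) = (\<Sum>h\<in>carrier G. F h)"
  by (rule sum.reindex_bij_witness[of _ "\<lambda>h. inv g \<otimes> h" "\<lambda>h. g \<otimes> h"]) (auto simp: m_assoc[symmetric])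

lemma prod_group_shift: "g \<in> carrier G \<Longrightarrow> (\<Prod>h\<in>carrier G. F (g \<otimes> h)) = (\<Prod>h\<in>carrier G. F h)"
  by (rule prod.reindex_bij_witness[of _ "\<lambda>h. inv g \<otimes> h" "\<lambda>h. g \<otimes> h"]) (auto simp: m_assoc[symmetric])

definition invs :: "('x, 'k) mpoly set" where
  "invs = {f. \<forall>g\<in>carrier G. \<phi> g f = f}"

lemma act_inv: "g \<in> carrier G \<Longrightarrow> f \<in> invs \<Longrightarrow> \<phi> g f = f"
  by (simp add: invs_def)

lemma act_add: "g \<in> carrier G \<Longrightarrow> \<phi> g (a + b) = \<phi> g a + \<phi> g b"
  by (rule type_ring_hom.hom_add[OF act_hom])

lemma act_times: "g \<in> carrier G \<Longrightarrow> \<phi> g (a * b) = \<phi> g a * \<phi> g b"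
  by (rule type_ring_hom.hom_mult[OF act_hom])

lemma act_diff: "g \<in> carrier G \<Longrightarrow> \<phi> g (a - b) = \<phi> g a - \<phi> g b"
  by (rule type_ring_hom.hom_diff[OF act_hom])

lemma act_uminus: "g \<in> carrier G \<Longrightarrow> \<phi> g (- a) = - \<phi> g a"
  by (rule type_ring_hom.hom_uminus[OF act_hom])

lemma act_sum: "g \<in> carrier G \<Longrightarrow> \<phi> g (\<Sum>i\<in>A. f i) = (\<Sum>i\<in>A. \<phi> g (f i))"
  by (rule type_ring_hom.hom_sum[OF act_hom])

lemma act_prod: "g \<in> carrier G \<Longrightarrow> \<phi> g (\<Prod>i\<in>A. f i) = (\<Prod>i\<in>A. \<phi> g (f i))"
  by (rule type_ring_hom.hom_prod[OF act_hom])

lemma act_power: "g \<in> carrier G \<Longrightarrow> \<phi> g (f ^ n) = \<phi> g f ^ n"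
  by (rule type_ring_hom.hom_power[OF act_hom])

lemma act_zero: "g \<in> carrier G \<Longrightarrow> \<phi> g 0 = 0"
  by (rule type_ring_hom.hom_zero[OF act_hom])

lemma act_eq_0_iff: "g \<in> carrier G \<Longrightarrow> \<phi> g f = 0 \<longleftrightarrow> f = 0"
  by (metis act_mult act_one act_zero inv_closed l_inv)

lemma invs_add: "a \<in> invs \<Longrightarrow> b \<in> invs \<Longrightarrow> a + b \<in> invs"
  and invs_mult: "a \<in> invs \<Longrightarrow> b \<in> invs \<Longrightarrow> a * b \<in> invs"
  and invs_diff: "a \<in> invs \<Longrightarrow> b \<in> invs \<Longrightarrow> a - b \<in> invs"
  and invs_mconst: "mconst c \<in> invs"
  by (auto simp: invs_def act_add act_times act_diff act_mconst)

lemma invs_zero [simp]: "0 \<in> invs" and invs_one [simp]: "1 \<in> invs"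
  using invs_mconst[of 0] invs_mconst[of 1] by auto

lemma invs_uminus: "a \<in> invs \<Longrightarrow> - a \<in> invs"
  using invs_diff[of 0 a] by simp

lemma invs_sum: "(\<And>i. i \<in> A \<Longrightarrow> f i \<in> invs) \<Longrightarrow> (\<Sum>i\<in>A. f i) \<in> invs"
  by (auto simp: invs_def act_sum)

lemma invs_power: "a \<in> invs \<Longrightarrow> a ^ n \<in> invs"
  by (auto simp: invs_def act_power)

lemma trace_invs: "(\<Sum>g\<in>carrier G. \<phi> g f) \<in> invs"
  using sum_group_shift[of _ "\<lambda>h. \<phi> h f"] by (auto simp: invs_def act_sum simp flip: act_mult)

lemma norm_invs: "(\<Prod>g\<in>carrier G. \<phi> g f) \<in> invs"
  using prod_group_shift[of _ "\<lambda>h. \<phi> h f"] by (auto simp: invs_def act_prod simp flip: act_mult)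

definition reynolds :: "('x, 'k) mpoly \<Rightarrow> ('x, 'k) mpoly" where
  "reynolds f = mconst (inverse (of_nat (card (carrier G)))) * (\<Sum>g\<in>carrier G. \<phi> g f)"

lemma reynolds_invs: "reynolds f \<in> invs"
  unfolding reynolds_def by (intro invs_mult invs_mconst trace_invs)

lemma reynolds_add: "reynolds (a + b) = reynolds a + reynolds b"
  by (simp add: reynolds_def act_add sum.distrib distrib_left)

lemma reynolds_mult: "t \<in> invs \<Longrightarrow> reynolds (t * f) = t * reynolds f"
  by (simp add: reynolds_def act_times act_inv mult.left_commute flip: sum_distrib_left)

lemma reynolds_one [simp]: "reynolds 1 = 1"
  using card_nonzero by (simp add: reynolds_def act_inv of_nat_eq_mconst flip: mconst.hom_mult)

lemma reynolds_id: "t \<in> invs \<Longrightarrow> reynolds t = t"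
  using reynolds_mult[of t 1] by simp

text \<open>Each component of \<open>f\<close> is mapped to a form of the same degree, and the
  decomposition into forms is unique.\<close>

lemma hcomp_act:
  assumes g: "g \<in> carrier G" shows "hcomp d (\<phi> g f) = \<phi> g (hcomp d f)"
proof -
  obtain n0 where "f \<in> deg_less n0" using ex_deg_less by blast
  define n where "n = max n0 (Suc d)"
  have d: "d < n" and f: "f \<in> deg_less n"
    using deg_less_mono[OF \<open>f \<in> deg_less n0\<close>, of n] by (auto simp: n_def)
  have "\<phi> g f = (\<Sum>e<n. \<phi> g (hcomp e f))"
    using sum_hcomp[OF f] act_sum[OF g] by metis
  then have "hcomp d (\<phi> g f) = (\<Sum>e<n. hcomp d (\<phi> g (hcomp e f)))"
    by (simp only: mrestrict_sum)
  also have "\<dots> = (\<Sum>e<n. if e = d then \<phi> g (hcomp d f) else 0)"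
    by (rule sum.cong) (auto simp: hcomp_of_form[OF act_forms[OF g hcomp_forms]])
  finally show ?thesis using d by simp
qed

lemma lookup_act_0: "g \<in> carrier G \<Longrightarrow> Poly_Mapping.lookup (\<phi> g f) 0 = Poly_Mapping.lookup f 0"
proof -
  assume g: "g \<in> carrier G"
  have "hcomp 0 f = mconst (Poly_Mapping.lookup f 0)"
    by (rule poly_mapping_eqI) (auto simp: mconst_def lookup_single when_def)
  then have "hcomp 0 (\<phi> g f) = hcomp 0 f"
    using hcomp_act[OF g, of 0 f] act_mconst[OF g] by metis
  then have "Poly_Mapping.lookup (hcomp 0 (\<phi> g f)) 0 = Poly_Mapping.lookup (hcomp 0 f) 0"
    by (rule arg_cong)
  then show ?thesis by (simp only: lookup_mrestrict mem_Collect_eq tdeg_0 simp_thms if_True)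
qed

lemma hcomp_invs: "f \<in> invs \<Longrightarrow> hcomp d f \<in> invs"
  using hcomp_act[of _ d f] unfolding invs_def mem_Collect_eq by metis

lemma deg_less_act:
  assumes g: "g \<in> carrier G" and f: "f \<in> deg_less n" shows "\<phi> g f \<in> deg_less n"
proof -
  have "\<phi> g f = (\<Sum>e<n. \<phi> g (hcomp e f))"
    using sum_hcomp[OF f] act_sum[OF g] by metis
  also have "\<dots> \<in> deg_less n"
  proof (rule deg_less_sum)
    fix e assume "e \<in> {..<n}"
    then show "\<phi> g (hcomp e f) \<in> deg_less n"
      using act_forms[OF g hcomp_forms[of e f]] by (auto simp: deg_less_def forms_iff)
  qed
  finally show ?thesis .
qed

section \<open>The group acting on the right factor of the tensor square\<close>

definition twist :: "'g \<Rightarrow> ('x, 'k) tensor_square \<Rightarrow> ('x, 'k) tensor_square" where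
  "twist g = eval_mpoly mconst (\<lambda>x. right_embed (\<phi> g (mvar x)))"

lemma type_ring_hom_twist: "type_ring_hom (twist g)"
  unfolding twist_def by (rule type_ring_hom_eval_mpoly[OF type_ring_hom_mconst])

sublocale twist: type_ring_hom "twist g" for g
  by (rule type_ring_hom_twist)

lemma twist_mconst [simp]: "twist g (mconst a) = mconst a"
  by (simp add: twist_def type_ring_hom_mconst)

lemma twist_right_embed:
  assumes g: "g \<in> carrier G" shows "twist g (right_embed b) = right_embed (\<phi> g b)"
proof (rule type_ring_hom_ext[of "\<lambda>b. twist g (right_embed b)" "\<lambda>b. right_embed (\<phi> g b)"])
  show "type_ring_hom (\<lambda>b. twist g (right_embed b))" "type_ring_hom (\<lambda>b. right_embed (\<phi> g b))"
    by (rule type_ring_hom_comp[OF type_ring_hom_right_embed type_ring_hom_twist]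
        type_ring_hom_comp[OF act_hom[OF g] type_ring_hom_right_embed])+
  show "twist g (right_embed (mconst c)) = right_embed (\<phi> g (mconst c))" for c
    by (simp add: right_embed_mconst act_mconst[OF g])
  show "twist g (right_embed (mvar x)) = right_embed (\<phi> g (mvar x))" for x
    by (simp add: right_embed_mvar twist_def type_ring_hom_mconst)
qed

lemma twist_mult:
  "g \<in> carrier G \<Longrightarrow> h \<in> carrier G \<Longrightarrow> twist (g \<otimes> h) F = twist g (twist h F)"
  by (rule tensor_hom_ext[of "twist (g \<otimes> h)" "\<lambda>F. twist g (twist h F)"])
    (simp_all add: twist_right_embed act_mult type_ring_hom_twist
       type_ring_hom_comp[OF type_ring_hom_twist type_ring_hom_twist])

lemma twist_one: "twist \<one> F = F"
  by (rule tensor_hom_ext[of "twist \<one>" "\<lambda>F. F"])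
    (auto simp: twist_right_embed act_one type_ring_hom_twist type_ring_hom_id)

definition tinvs :: "('x, 'k) tensor_square set" where
  "tinvs = {F. \<forall>g\<in>carrier G. twist g F = F}"

lemma tinvs_mult: "F \<in> tinvs \<Longrightarrow> H \<in> tinvs \<Longrightarrow> F * H \<in> tinvs"
  and tinvs_diff: "F \<in> tinvs \<Longrightarrow> H \<in> tinvs \<Longrightarrow> F - H \<in> tinvs"
  and tinvs_mconst: "mconst a \<in> tinvs"
  and tinvs_right_embed: "t \<in> invs \<Longrightarrow> right_embed t \<in> tinvs"
  by (auto simp: tinvs_def twist.hom_add twist.hom_mult twist.hom_diff twist_right_embed act_inv)

lemma tinvs_sum: "(\<And>i. i \<in> A \<Longrightarrow> F i \<in> tinvs) \<Longrightarrow> (\<Sum>i\<in>A. F i) \<in> tinvs"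
  by (auto simp: tinvs_def twist.hom_sum)

definition trace :: "('x, 'k) tensor_square \<Rightarrow> ('x, 'k) tensor_square" where
  "trace F = (\<Sum>g\<in>carrier G. twist g F)"

lemma trace_tinvs: "trace F \<in> tinvs"
  using sum_group_shift[of _ "\<lambda>h. twist h F"]
  by (auto simp: tinvs_def trace_def twist.hom_sum simp flip: twist_mult)

lemma trace_add: "trace (F + H) = trace F + trace H"
  by (simp add: trace_def twist.hom_add sum.distrib)

lemma trace_mult: "H \<in> tinvs \<Longrightarrow> trace (H * F) = H * trace F"
  by (simp add: trace_def tinvs_def twist.hom_mult sum_distrib_left)

text \<open>The projection of R \<otimes> R onto R \<otimes> T, which is \<open>tinvs\<close>. As it
  fixes \<open>tinvs\<close> and maps pure tensors to pure tensors, facts about invariant tensors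
  can be proved by induction over arbitrary ones.\<close>

definition treynolds :: "('x, 'k) tensor_square \<Rightarrow> ('x, 'k) tensor_square" where
  "treynolds F = mconst (mconst (inverse (of_nat (card (carrier G))))) * trace F"

lemma treynolds_add: "treynolds (F + H) = treynolds F + treynolds H"
  by (simp add: treynolds_def trace_add distrib_left)

lemma treynolds_tensor: "treynolds (mconst a * right_embed b) = mconst a * right_embed (reynolds b)"
  by (simp add: treynolds_def trace_def reynolds_def twist.hom_mult twist_right_embed right_embed.hom_mult
      right_embed.hom_sum right_embed_mconst mult.left_commute flip: sum_distrib_left)

lemma treynolds_id:
  assumes "F \<in> tinvs" shows "treynolds F = F"
proof -
  have "trace F = of_nat (card (carrier G)) * F"
    using assms by (simp add: trace_def tinvs_def)
  also have "of_nat (card (carrier G)) = mconst (mconst (of_nat (card (carrier G)) :: 'k) :: ('x, 'k) mpoly)"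
    by (simp add: of_nat_eq_mconst)
  finally have "trace F = mconst (mconst (of_nat (card (carrier G)))) * F" .
  then have "treynolds F = mconst (mconst (inverse (of_nat (card (carrier G))) * of_nat (card (carrier G)))) * F"
    by (simp only: treynolds_def mconst.hom_mult mult.assoc)
  then show ?thesis using card_nonzero by simp
qed

end

section \<open>Linear forms are prime\<close>

lemma tdeg_eq_1E:
  assumes "tdeg m = Suc 0" obtains x where "m = Poly_Mapping.single x 1"
proof -
  have "m \<noteq> 0" using assms by auto
  then obtain x where x: "Poly_Mapping.lookup m x \<noteq> 0" by (metis lookup_zero poly_mapping_eqI)
  have "Poly_Mapping.lookup m x + (\<Sum>y\<in>UNIV - {x}. Poly_Mapping.lookup m y) = 1"
    using assms by (simp add: tdeg_def sum.remove[symmetric])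
  then have "Poly_Mapping.lookup m x = 1" "(\<Sum>y\<in>UNIV - {x}. Poly_Mapping.lookup m y) = 0"
    using x by linarith+
  then have "m = Poly_Mapping.single x 1"
    by (intro poly_mapping_eqI) (auto simp: lookup_single when_def)
  then show ?thesis by (rule that)
qed

lemma linear_form_eq:
  assumes "l \<in> forms (Suc 0)"
  shows "l = (\<Sum>x\<in>UNIV. mconst (Poly_Mapping.lookup l (Poly_Mapping.single x 1)) * mvar x)"
    (is "_ = ?r")
proof (rule poly_mapping_eqI)
  fix m
  have s: "mconst c * mvar x = Poly_Mapping.single (Poly_Mapping.single x 1) c" for c :: 'b and x :: 'a
    by (simp add: mconst_def mvar_def mult_single)
  have i: "Poly_Mapping.single x (1::nat) = Poly_Mapping.single y 1 \<longleftrightarrow> x = y" for x y :: 'a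
    by (metis lookup_single_eq lookup_single_not_eq one_neq_zero)
  show "Poly_Mapping.lookup l m = Poly_Mapping.lookup ?r m"
  proof (cases "tdeg m = Suc 0")
    case True
    then obtain x where "m = Poly_Mapping.single x 1" by (rule tdeg_eq_1E)
    then show ?thesis by (simp only: s lookup_sum) (simp add: lookup_single i[simplified] when_def)
  next
    case False
    then have "Poly_Mapping.lookup l m = 0" using assms by (auto simp: forms_iff in_keys_iff)
    moreover have "Poly_Mapping.single x (Suc 0) \<noteq> m" for x using False by auto
    ultimately show ?thesis by (auto simp: s lookup_sum lookup_single when_def)
  qed
qed

text \<open>Solving \<open>l = 0\<close> for a variable \<open>y\<close> with nonzero coefficient
  gives a substitution \<sigma> that kills \<open>l\<close> and changes every polynomial by a
  multiple of \<open>l\<close>. Divisibility by \<open>l\<close> is therefore vanishing under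
  \<sigma>, and the target of \<sigma> has no zero divisors.\<close>

lemma linear_form_prime:
  fixes l :: "('x::finite, 'k::field) mpoly"
  assumes l: "l \<in> forms (Suc 0)" "l \<noteq> 0" and dvd: "l dvd a * b"
  shows "l dvd a \<or> l dvd b"
proof -
  let ?c = "\<lambda>x. Poly_Mapping.lookup l (Poly_Mapping.single x 1)"
  obtain y where y: "?c y \<noteq> 0"
    using l linear_form_eq[OF l(1)] by (metis (no_types, lifting) mconst.hom_zero mult_zero_left sum.neutral)
  define \<sigma> where "\<sigma> = eval_mpoly mconst (\<lambda>x. if x = y then mvar y - mconst (inverse (?c y)) * l else mvar x)"
  interpret \<sigma>: type_ring_hom \<sigma> unfolding \<sigma>_def by (rule type_ring_hom_eval_mpoly[OF type_ring_hom_mconst])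
  have \<sigma>c: "\<sigma> (mconst c) = mconst c" for c by (simp add: \<sigma>_def type_ring_hom_mconst)
  have \<sigma>v: "\<sigma> (mvar x) = (if x = y then mvar y - mconst (inverse (?c y)) * l else mvar x)" for x
    by (simp add: \<sigma>_def type_ring_hom_mconst)
  have "\<sigma> l = (\<Sum>x\<in>UNIV. mconst (?c x) * \<sigma> (mvar x))"
    by (subst linear_form_eq[OF l(1)]) (simp add: \<sigma>.hom_sum \<sigma>.hom_mult \<sigma>c)
  also have "\<dots> = (\<Sum>x\<in>UNIV. mconst (?c x) * mvar x - (if x = y then mconst (?c y) * (mconst (inverse (?c y)) * l) else 0))"
    by (rule sum.cong) (auto simp: \<sigma>v right_diff_distrib)
  also have "\<dots> = l - mconst (?c y * inverse (?c y)) * l"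
    using linear_form_eq[OF l(1)] by (simp add: sum_subtractf mconst.hom_mult mult.assoc)
  finally have \<sigma>l: "\<sigma> l = 0" using y by simp
  have diff: "l dvd r - \<sigma> r" for r
  proof (induction r rule: mpoly_induct)
    case (add f g)
    then have "l dvd (f - \<sigma> f) + (g - \<sigma> g)" by (rule dvd_add)
    then show ?case by (simp add: \<sigma>.hom_add algebra_simps)
  next
    case (mult f g)
    then have "l dvd f * (g - \<sigma> g) + (f - \<sigma> f) * \<sigma> g" by (intro dvd_add dvd_mult dvd_mult2)
    then show ?case by (simp add: \<sigma>.hom_mult algebra_simps)
  qed (auto simp: \<sigma>c \<sigma>v)
  have iff: "l dvd r \<longleftrightarrow> \<sigma> r = 0" for r
  proof
    show "l dvd r \<Longrightarrow> \<sigma> r = 0" by (auto simp: dvd_def \<sigma>.hom_mult \<sigma>l)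
    show "\<sigma> r = 0 \<Longrightarrow> l dvd r" using diff[of r] by simp
  qed
  show ?thesis using dvd by (simp add: iff \<sigma>.hom_mult)
qed

text \<open>In degree one, only the constant term of the quotient contributes.\<close>

lemma linear_form_dvd_linear_form:
  fixes l l' :: "('x::finite, 'k::field) mpoly"
  assumes l: "l \<in> forms (Suc 0)" "l' \<in> forms (Suc 0)" and "l dvd l'"
  shows "\<exists>c. l' = mconst c * l"
proof -
  obtain q where q: "l' = l * q" using \<open>l dvd l'\<close> by (auto simp: dvd_def)
  define c where "c = Poly_Mapping.lookup q 0"
  have "q - mconst c \<in> deg_ge (Suc 0)"
    by (simp add: deg_ge_1_iff c_def lookup_minus mconst_def)
  then have ge: "l * (q - mconst c) \<in> deg_ge (Suc 0 + Suc 0)"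
    using l by (intro deg_ge_mult) (auto simp: deg_ge_def forms_iff)
  have "Poly_Mapping.lookup (l * (q - mconst c)) m = 0" if "tdeg m = Suc 0" for m
  proof (rule ccontr)
    assume "Poly_Mapping.lookup (l * (q - mconst c)) m \<noteq> 0"
    then have "m \<in> Poly_Mapping.keys (l * (q - mconst c))" by (simp add: in_keys_iff)
    with ge that show False by (auto simp: deg_ge_def)
  qed
  then have "hcomp (Suc 0) (l * (q - mconst c)) = 0"
    by (intro poly_mapping_eqI) auto
  moreover have "l' = l * (q - mconst c) + mconst c * l" by (simp add: q algebra_simps)
  ultimately have "hcomp (Suc 0) l' = mconst c * hcomp (Suc 0) l"
    by (metis add_0 mrestrict_add mrestrict_mconst)
  then show ?thesis using l by (auto simp: hcomp_of_form)
qed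

text \<open>Primality and cancellation move the factors \<open>l\<close> over to \<open>b\<close>
  one at a time, which stands in for unique factorisation.\<close>

lemma linear_form_power_dvd:
  fixes l :: "('x::finite, 'k::field) mpoly"
  assumes l: "l \<in> forms (Suc 0)" "l \<noteq> 0" and "\<not> l dvd c"
  shows "l ^ n dvd c * b \<Longrightarrow> l ^ n dvd b"
proof (induction n arbitrary: b)
  case (Suc n)
  have "l dvd c * b" using Suc.prems by (meson dvd_power dvd_trans zero_less_Suc)
  then have "l dvd b" using linear_form_prime[OF l] \<open>\<not> l dvd c\<close> by blast
  then obtain b' where b: "b = l * b'" by (auto simp: dvd_def)
  obtain q where "c * b = l ^ Suc n * q" using Suc.prems by (auto simp: dvd_def)
  then have "l * (c * b') = l * (l ^ n * q)" by (simp add: b algebra_simps)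
  then have "c * b' = l ^ n * q" using mpoly_mult_left_cancel[OF l(2)] by blast
  then have "l ^ n dvd b'" using Suc.IH by auto
  then show ?case by (simp add: b mult_dvd_mono)
qed simp

lemma linear_form_not_dvd_power:
  fixes l :: "('x::finite, 'k::field) mpoly"
  assumes l: "l \<in> forms (Suc 0)" "l \<noteq> 0" and "\<not> l dvd c"
  shows "\<not> l dvd c ^ n"
proof (induction n)
  case 0
  have "\<not> l dvd 1"
  proof
    assume "l dvd 1"
    then have "l dvd c" by (metis dvd_trans one_dvd)
    then show False using assms by blast
  qed
  then show ?case by simp
next
  case (Suc n)
  then show ?case using linear_form_prime[OF l, of c "c ^ n"] \<open>\<not> l dvd c\<close> by auto
qed

section \<open>Splitting powers, and the diagonal ideal against the ideal of the origin\<close>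

text \<open>Every term of the binomial expansion has exponent at least \<open>n\<close> on
  \<open>u\<close> or at least \<open>m\<close> on \<open>w\<close>.\<close>

lemma power_add_split:
  fixes u w :: "'a::comm_ring_1"
  shows "\<exists>A B. (u + w) ^ (n + m) = u ^ n * A + w ^ m * B"
proof (induction n arbitrary: m)
  case 0
  show ?case by (rule exI[of _ "(u + w) ^ m"], rule exI[of _ 0]) simp
next
  case (Suc n)
  show ?case
  proof (induction m)
    case 0
    show ?case by (rule exI[of _ 0], rule exI[of _ "(u + w) ^ Suc n"]) simp
  next
    case (Suc m)
    obtain A B where 1: "(u + w) ^ (n + Suc m) = u ^ n * A + w ^ Suc m * B"
      using \<open>\<And>m. \<exists>A B. (u + w) ^ (n + m) = u ^ n * A + w ^ m * B\<close> by blast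
    obtain A' B' where 2: "(u + w) ^ (Suc n + m) = u ^ Suc n * A' + w ^ m * B'"
      using Suc by blast
    have "(u + w) ^ (Suc n + Suc m) = u * (u + w) ^ (n + Suc m) + w * (u + w) ^ (Suc n + m)"
      by (simp add: algebra_simps)
    also have "\<dots> = u ^ Suc n * (A + w * A') + w ^ Suc m * (u * B + B')"
      unfolding 1 2 by (simp add: algebra_simps)
    finally show ?case by blast
  qed
qed

lemma diag_pow_prod_diff:
  assumes "finite A" and "\<And>i. i \<in> A \<Longrightarrow> diag_pow n (F i - H i)"
  shows "diag_pow n ((\<Prod>i\<in>A. F i) - (\<Prod>i\<in>A. H i))"
  using assms
proof (induction A rule: finite_induct)
  case (insert i A)
  have "diag_pow n ((\<Prod>i\<in>A. F i) * (F i - H i) + H i * ((\<Prod>i\<in>A. F i) - (\<Prod>i\<in>A. H i)))"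
    using insert by (intro diag_pow.add diag_pow_mult) auto
  then show ?case using insert by (simp add: algebra_simps)
qed (simp add: diag_pow.zero)

text \<open>Each \<open>1 \<otimes> x\<close> is the sum of an element of J and of
  \<open>x \<otimes> 1\<close>. A product of \<open>n\<close> variables on the right is thus in
  \<open>J^n\<close> up to multiples of the \<open>x \<otimes> 1\<close>: vanishing at the origin is
  traded for vanishing along the diagonal.\<close>

lemma right_embed_deg_ge:
  fixes f :: "('x::finite, 'k::field) mpoly"
  shows "f \<in> deg_ge n \<Longrightarrow> \<exists>F H. right_embed f = F + (\<Sum>x\<in>UNIV. mconst (mvar x) * H x) \<and> diag_pow n F"
proof -
  let ?Q = "\<lambda>n (K :: ('x, 'k) tensor_square). \<exists>F H. K = F + (\<Sum>x\<in>UNIV. mconst (mvar x) * H x) \<and> diag_pow n F"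
  have Q: "?Q n K" if "K = F + (\<Sum>x\<in>UNIV. mconst (mvar x) * H x)" "diag_pow n F" for n K F H
    by (rule exI[of _ F], rule exI[of _ H]) (use that in simp)
  have add: "?Q n (K + K')" if "?Q n K" "?Q n K'" for n K K'
  proof -
    obtain F H where FH: "K = F + (\<Sum>x\<in>UNIV. mconst (mvar x) * H x)" "diag_pow n F"
      using \<open>?Q n K\<close> by (elim exE conjE) (rule that)
    obtain F' H' where "K' = F' + (\<Sum>x\<in>UNIV. mconst (mvar x) * H' x)" "diag_pow n F'"
      using \<open>?Q n K'\<close> by (elim exE conjE) (rule that)
    with FH have "K + K' = (F + F') + (\<Sum>x\<in>UNIV. mconst (mvar x) * (H x + H' x))" "diag_pow n (F + F')"
      by (auto simp: sum.distrib distrib_left intro: diag_pow.add)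
    then show ?thesis by (rule Q)
  qed
  have mult: "?Q n (P * K)" if "?Q n K" for n P K
  proof -
    obtain F H where "K = F + (\<Sum>x\<in>UNIV. mconst (mvar x) * H x)" "diag_pow n F"
      using \<open>?Q n K\<close> by (elim exE conjE) (rule that)
    then have "P * K = P * F + (\<Sum>x\<in>UNIV. mconst (mvar x) * (P * H x))" "diag_pow n (P * F)"
      by (auto simp: distrib_left sum_distrib_left mult.left_commute intro: diag_pow_mult)
    then show ?thesis by (rule Q)
  qed
  have monom: "?Q n (right_embed (Poly_Mapping.single m 1))" if "n \<le> tdeg m" for n m
    using that
  proof (induction n arbitrary: m)
    case 0
    have "right_embed (Poly_Mapping.single m (1 :: 'k)) = right_embed (Poly_Mapping.single m 1) + (\<Sum>x\<in>UNIV. mconst (mvar x) * 0)"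
      by simp
    then show ?case by (rule Q) (rule diag_pow.base)
  next
    case (Suc n)
    then have "m \<noteq> 0" by auto
    then obtain x where x: "Poly_Mapping.lookup m x \<noteq> 0" by (metis lookup_zero poly_mapping_eqI)
    define m' where "m' = m - Poly_Mapping.single x 1"
    have m: "m = Poly_Mapping.single x 1 + m'"
      using x by (intro poly_mapping_eqI) (auto simp: m'_def lookup_add lookup_minus lookup_single when_def)
    have "n \<le> tdeg m'" using Suc.prems unfolding m by (simp add: tdeg_add)
    from Suc.IH[OF this] obtain F H where FH: "right_embed (Poly_Mapping.single m' (1 :: 'k)) = F + (\<Sum>x\<in>UNIV. mconst (mvar x) * H x)" "diag_pow n F"
      by (elim exE conjE) (rule that)
    have "right_embed (Poly_Mapping.single m (1 :: 'k)) = right_embed (mvar x) * right_embed (Poly_Mapping.single m' 1)"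
      unfolding m by (simp add: mvar_def mult_single flip: right_embed.hom_mult)
    also have "\<dots> = (right_embed (mvar x) - mconst (mvar x)) * F
        + (right_embed (mvar x) - mconst (mvar x)) * (\<Sum>x\<in>UNIV. mconst (mvar x) * H x)
        + (\<Sum>y\<in>UNIV. if y = x then mconst (mvar x) * right_embed (Poly_Mapping.single m' 1) else 0)"
      by (simp add: FH algebra_simps)
    also have "\<dots> = (right_embed (mvar x) - mconst (mvar x)) * F
        + (\<Sum>y\<in>UNIV. mconst (mvar y) * ((right_embed (mvar x) - mconst (mvar x)) * H y
             + (if y = x then right_embed (Poly_Mapping.single m' 1) else 0)))"
      unfolding add.assoc sum_distrib_left sum.distrib[symmetric]
      by (intro arg_cong2[of _ _ _ _ "(+)"] sum.cong refl) (simp add: distrib_left mult.left_commute)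
    finally show ?case by (rule Q) (rule diag_pow.step[OF FH(2)])
  qed
  have zero: "?Q n 0"
  proof -
    have "0 = 0 + (\<Sum>x\<in>UNIV. mconst (mvar x) * (0 :: ('x, 'k) tensor_square))" by simp
    then show ?thesis by (rule Q) (rule diag_pow.zero)
  qed
  assume f: "f \<in> deg_ge n"
  have *: "right_embed f = (\<Sum>m\<in>Poly_Mapping.keys f. right_embed (mconst (Poly_Mapping.lookup f m)) * right_embed (Poly_Mapping.single m 1))"
    by (subst sum_single_keys)
      (simp add: right_embed.hom_sum mconst_def mult_single flip: right_embed.hom_mult)
  have "?Q n (\<Sum>m\<in>A. right_embed (mconst (Poly_Mapping.lookup f m)) * right_embed (Poly_Mapping.single m 1))"
    if "A \<subseteq> Poly_Mapping.keys f" for A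
    using finite_subset[OF that finite_keys] that
  proof (induction A rule: finite_induct)
    case empty
    show ?case using zero by simp
  next
    case (insert m A)
    have "n \<le> tdeg m" using f insert.prems by (auto simp: deg_ge_def)
    then show ?case
      using insert add[OF mult[OF monom]] by simp
  qed
  from this[of "Poly_Mapping.keys f"] show ?thesis unfolding * by simp
qed

section \<open>Differential operators on the ring of invariants\<close>

text \<open>\<open>two_forms\<close> is the absence of pseudoreflections: the image of \<open>g - 1\<close> on linear forms is at least
  two-dimensional.\<close>

locale small_group_action = linear_group_action +
  assumes two_forms: "g \<in> carrier G \<Longrightarrow> g \<noteq> \<one> \<Longrightarrow>
    \<exists>v w. v \<in> forms (Suc 0) \<and> w \<in> forms (Suc 0) \<and> \<phi> g v \<noteq> v \<and> (\<forall>c. \<phi> g w - w \<noteq> mconst c * (\<phi> g v - v))"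

context linear_group_action begin

text \<open>The differential operators of the ring of invariants, written with the operations of the
  polynomial type; \<open>diff_ops_inv_ring\<close> identifies them with
  \<open>diff_ops\<close>.\<close>

primrec inv_diff_op :: "nat \<Rightarrow> (('x, 'k) mpoly \<Rightarrow> ('x, 'k) mpoly) \<Rightarrow> bool" where
  "inv_diff_op 0 \<delta> \<longleftrightarrow> (\<forall>t\<in>invs. \<delta> t \<in> invs) \<and> (\<forall>s\<in>invs. \<forall>t\<in>invs. \<delta> (s + t) = \<delta> s + \<delta> t) \<and>
     (\<forall>s\<in>invs. \<forall>t\<in>invs. \<delta> (s * t) = s * \<delta> t)"
| "inv_diff_op (Suc n) \<delta> \<longleftrightarrow> (\<forall>t\<in>invs. \<delta> t \<in> invs) \<and> (\<forall>s\<in>invs. \<forall>t\<in>invs. \<delta> (s + t) = \<delta> s + \<delta> t) \<and>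
     (\<forall>c. \<forall>t\<in>invs. \<delta> (mconst c * t) = mconst c * \<delta> t) \<and>
     (\<forall>t\<in>invs. inv_diff_op n (\<lambda>x. \<delta> (t * x) - t * \<delta> x))"

lemma inv_diff_op_cong:
  "(\<And>t. t \<in> invs \<Longrightarrow> \<delta> t = \<delta>' t) \<Longrightarrow> inv_diff_op n \<delta> \<longleftrightarrow> inv_diff_op n \<delta>'"
proof (induction n arbitrary: \<delta> \<delta>')
  case 0
  then show ?case by (simp add: invs_add invs_mult)
next
  case (Suc n)
  have "inv_diff_op n (\<lambda>x. \<delta> (t * x) - t * \<delta> x) = inv_diff_op n (\<lambda>x. \<delta>' (t * x) - t * \<delta>' x)" if "t \<in> invs" for t
    by (rule Suc.IH) (use that in \<open>simp add: Suc.prems invs_mult\<close>)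
  then show ?case using Suc.prems by (simp add: invs_add invs_mult invs_mconst)
qed

lemma k_linear_inv_diff_op: "inv_diff_op n \<delta> \<Longrightarrow> k_linear (\<lambda>b. \<delta> (reynolds b))"
  by (cases n) (auto simp: k_linear_def reynolds_add reynolds_mult reynolds_invs invs_mconst)

lemma inv_diff_op_comm: "inv_diff_op (Suc n) \<delta> \<Longrightarrow> t \<in> invs \<Longrightarrow> inv_diff_op n (\<lambda>x. \<delta> (t * x) - t * \<delta> x)"
  by simp

text \<open>Passing from \<delta> to its commutator with \<open>t\<close> corresponds to multiplying
  the argument of the extended map by \<open>1 \<otimes> t - t \<otimes> 1\<close>. The order drops,
  which drives the induction in \<open>ext_vanishes\<close>.\<close>

lemma ext_commutator:
  assumes "inv_diff_op (Suc n) \<delta>" and t: "t \<in> invs"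
  shows "left_linear_ext (\<lambda>b. \<delta> (reynolds b)) ((right_embed t - mconst t) * H)
       = left_linear_ext (\<lambda>b. \<delta> (t * reynolds b) - t * \<delta> (reynolds b)) H"
proof (induction H rule: tensor_induct)
  case (tensor a b)
  have "(right_embed t - mconst t) * (mconst a * right_embed b)
      = mconst a * right_embed (t * b) - mconst (a * t) * right_embed b"
    by (simp add: right_embed.hom_mult mconst.hom_mult algebra_simps)
  then show ?case
    using t by (simp add: left_linear_ext_diff left_linear_ext_tensor k_linear_inv_diff_op[OF assms(1)]
        left_linear_ext_tensor[OF k_linear_inv_diff_op[OF inv_diff_op_comm[OF assms]]]
        reynolds_mult right_diff_distrib)
qed (simp add: distrib_left left_linear_ext_add)

text \<open>On \<open>R \<otimes> R\<^sup>G\<close>, multiplication by \<open>S\<close> and by its diagonal value differ by an element of the ideal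
  generated by all \<open>1 \<otimes> t - t \<otimes> 1\<close>, which turns \<open>\<delta>\<close> into its commutators.\<close>

lemma ext_mult_tinvs:
  assumes \<delta>: "inv_diff_op (Suc n) \<delta>"
    and IH: "\<And>\<delta> F. inv_diff_op n \<delta> \<Longrightarrow> F \<in> tinvs \<Longrightarrow> diag_pow (Suc n) F \<Longrightarrow>
               left_linear_ext (\<lambda>b. \<delta> (reynolds b)) F = 0"
    and S: "S \<in> tinvs" and H: "H \<in> tinvs" "diag_pow (Suc n) H"
  shows "left_linear_ext (\<lambda>b. \<delta> (reynolds b)) (S * H) = diagonal S * left_linear_ext (\<lambda>b. \<delta> (reynolds b)) H"
proof -
  \<comment> \<open>\<open>S\<close> equals \<open>treynolds S\<close>, so the claim for all
    \<open>treynolds E\<close> is enough, and there \<open>E\<close> may be taken to be a pure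
    tensor.\<close>
  have "left_linear_ext (\<lambda>b. \<delta> (reynolds b)) ((treynolds E - mconst (diagonal (treynolds E))) * H) = 0" for E
  proof (induction E rule: tensor_induct)
    case (tensor a b)
    have "treynolds (mconst a * right_embed b) - mconst (diagonal (treynolds (mconst a * right_embed b)))
        = mconst a * (right_embed (reynolds b) - mconst (reynolds b))"
      by (simp add: treynolds_tensor diagonal.hom_mult mconst.hom_mult right_diff_distrib)
    then show ?case
      using IH[OF inv_diff_op_comm[OF \<delta> reynolds_invs] H]
      by (simp add: mult.assoc left_linear_ext_mconst_mult ext_commutator[OF \<delta> reynolds_invs])
  next
    case (add E F)
    have "(treynolds (E + F) - mconst (diagonal (treynolds (E + F)))) * H
       = (treynolds E - mconst (diagonal (treynolds E))) * H + (treynolds F - mconst (diagonal (treynolds F))) * H"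
      by (simp add: treynolds_add diagonal.hom_add mconst.hom_add algebra_simps)
    then show ?case by (simp add: left_linear_ext_add add)
  qed
  from this[of S] show ?thesis
    by (simp add: treynolds_id[OF S] left_diff_distrib left_linear_ext_diff left_linear_ext_mconst_mult)
qed

lemma trace_split: "trace F = F + (\<Sum>g\<in>carrier G - {\<one>}. twist g F)"
  using fin by (simp add: trace_def sum.remove[of _ \<one>] twist_one)

text \<open>The summand of the trace at the identity is in the ideal because of \<open>F\<close>,
  all the others because of the twists of \<open>A\<close>.\<close>

lemma diag_pow_trace:
  assumes "\<And>g. g \<in> carrier G \<Longrightarrow> g \<noteq> \<one> \<Longrightarrow> diag_pow n (twist g A)" and "diag_pow n F"
  shows "diag_pow n (trace (F * A))"
  unfolding trace_split using assms diag_pow_mult[OF assms(2), of A]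
  by (intro diag_pow.add diag_pow_sum) (auto simp: twist.hom_mult diag_pow_mult mult.commute[of A])

lemma diag_pow_twist_gen: "g \<in> carrier G \<Longrightarrow> diag_pow (Suc 0) (twist g (right_embed v - mconst (\<phi> g v)))"
  by (simp add: twist.hom_diff twist_right_embed diag_pow_gen)

end

section \<open>Separating the diagonal from the other graphs, and dual bases\<close>

context small_group_action begin

definition moved :: "'a \<Rightarrow> ('c, 'd) mpoly" where
  "moved g = (SOME v. \<phi> g v \<noteq> v)"

lemma moved: "g \<in> carrier G \<Longrightarrow> g \<noteq> \<one> \<Longrightarrow> \<phi> g (moved g) \<noteq> moved g"
  unfolding moved_def using two_forms by (metis (mono_tags, lifting) someI_ex)

text \<open>The twist by \<open>h\<close> turns \<open>1 \<otimes> v - h v \<otimes> 1\<close> into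
  \<open>1 \<otimes> h v - h v \<otimes> 1\<close>, an element of J, so the product vanishes to
  order \<open>n\<close> on the graph of every \<open>h \<noteq> \<one>\<close>. On the diagonal it
  is a product of powers of \<open>v - h v\<close>, which is nonzero for the chosen
  \<open>v\<close>.\<close>

definition separator :: "nat \<Rightarrow> ('c, 'd) tensor_square" where
  "separator n = (\<Prod>h\<in>carrier G - {\<one>}. (right_embed (moved h) - mconst (\<phi> h (moved h))) ^ n)"

lemma diagonal_separator: "diagonal (separator n) \<noteq> 0"
  using moved[THEN not_sym] fin
  by (auto simp: separator_def diagonal.hom_prod diagonal.hom_power diagonal.hom_diff mpoly_prod_eq_0_iff)

lemma twist_separator:
  assumes "g \<in> carrier G" "g \<noteq> \<one>" shows "diag_pow n (twist g (separator n))"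
  unfolding separator_def twist.hom_prod twist.hom_power
  by (rule diag_pow_prod[of _ g]) (use assms fin in \<open>auto intro: diag_pow_power diag_pow_twist_gen\<close>)

text \<open>If the separator is the sum of the \<open>a i \<otimes> b i\<close>, its restriction to
  the graph of \<open>k\<close> is the sum of the \<open>a i * \<phi> k (b i)\<close>, which
  vanishes for \<open>k \<noteq> \<one>\<close>. Applying \<open>g\<close> and setting
  \<open>k = inv g \<otimes> h\<close> gives the orthogonality.\<close>

lemma dual_bases:
  obtains D and I :: "('c \<Rightarrow>\<^sub>0 nat) set" and e e'
  where "D \<in> invs" "D \<noteq> 0"
    and "\<And>g h. g \<in> carrier G \<Longrightarrow> h \<in> carrier G \<Longrightarrow> (\<Sum>i\<in>I. \<phi> g (e i) * \<phi> h (e' i)) = (if g = h then D else 0)"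
proof -
  define Z where "Z = separator 1"
  define I where "I = Poly_Mapping.keys Z"
  define a where "a i = Poly_Mapping.lookup Z i" for i
  define b :: "('c \<Rightarrow>\<^sub>0 nat) \<Rightarrow> ('c, 'd) mpoly" where "b i = Poly_Mapping.single i 1" for i
  have Z: "Z = (\<Sum>i\<in>I. mconst (a i) * right_embed (b i))"
    unfolding I_def a_def b_def by (subst sum_single_keys) (simp only: single_eq_mconst_right_embed[of _ "Poly_Mapping.lookup Z _"])
  define z where "z = diagonal Z"
  define D where "D = (\<Prod>h\<in>carrier G. \<phi> h z)"
  \<comment> \<open>The bare sums give \<open>\<phi> g z\<close>, which depends on \<open>g\<close>.
    Scaling by the remaining conjugates of \<open>z\<close> replaces it by the norm
    \<open>D\<close>, which is invariant.\<close>
  define c where "c = (\<Prod>h\<in>carrier G - {\<one>}. \<phi> h z)"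
  have z: "z \<noteq> 0" by (simp add: z_def Z_def diagonal_separator)
  have D: "D \<in> invs" unfolding D_def by (rule norm_invs)
  have cz: "c * z = D" unfolding D_def c_def using fin by (simp add: prod.remove[of _ \<one>] act_one mult.commute)
  have key: "(\<Sum>i\<in>I. \<phi> g (a i) * \<phi> h (b i)) = (if g = h then \<phi> g z else 0)"
    if g: "g \<in> carrier G" and h: "h \<in> carrier G" for g h
  proof -
    let ?k = "inv g \<otimes> h"
    have k: "?k \<in> carrier G" using g h by simp
    have gk: "g \<otimes> ?k = h" using g h by (simp add: m_assoc[symmetric])
    have "\<phi> g (diagonal (twist ?k Z)) = (\<Sum>i\<in>I. \<phi> g (a i) * \<phi> h (b i))"
      by (simp add: Z twist.hom_sum twist.hom_mult twist_right_embed[OF k] diagonal.hom_sum diagonal.hom_mult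
          act_sum[OF g] act_times[OF g] act_mult[OF g k, symmetric] gk)
    moreover have "diagonal (twist ?k Z) = 0" if "g \<noteq> h"
    proof -
      have "?k \<noteq> \<one>" using gk g that by auto
      then show ?thesis using twist_separator[OF k, of 1] unfolding Z_def by (simp add: diagonal_diag_pow)
    qed
    moreover have "twist ?k Z = Z" if "g = h" using that g by (simp add: twist_one)
    ultimately show ?thesis using g by (auto simp: act_zero z_def)
  qed
  show ?thesis
  proof (rule that[of D "\<lambda>i. c * a i" b I])
    show "D \<noteq> 0" using z fin by (auto simp: D_def mpoly_prod_eq_0_iff act_eq_0_iff)
    fix g h assume g: "g \<in> carrier G" and h: "h \<in> carrier G"
    have "(\<Sum>i\<in>I. \<phi> g (c * a i) * \<phi> h (b i)) = \<phi> g c * (\<Sum>i\<in>I. \<phi> g (a i) * \<phi> h (b i))"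
      by (simp add: act_times[OF g] sum_distrib_left mult.assoc)
    also have "\<dots> = (if g = h then \<phi> g (c * z) else 0)"
      using h by (simp add: key[OF g h] act_times)
    finally show "(\<Sum>i\<in>I. \<phi> g (c * a i) * \<phi> h (b i)) = (if g = h then D else 0)"
      by (simp add: cz act_inv[OF h D])
  qed (rule D)
qed

text \<open>Multiplying out the two traces gives a sum over pairs of group elements, of which
  orthogonality keeps the equal ones. The use is to write the trace of a product through products of
  traces, whose factors are invariant tensors.\<close>

lemma trace_mult_dual:
  assumes dual: "\<And>g h. g \<in> carrier G \<Longrightarrow> h \<in> carrier G \<Longrightarrow>
      (\<Sum>i\<in>I. \<phi> g (e i) * \<phi> h (e' i)) = (if g = h then D else 0)"
  shows "(\<Sum>i\<in>I. trace (F * right_embed (e i)) * trace (H * right_embed (e' i))) = right_embed D * trace (F * H)"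
proof -
  have "(\<Sum>i\<in>I. trace (F * right_embed (e i)) * trace (H * right_embed (e' i)))
      = (\<Sum>i\<in>I. \<Sum>g\<in>carrier G. \<Sum>h\<in>carrier G.
           twist g F * twist h H * right_embed (\<phi> g (e i) * \<phi> h (e' i)))"
    unfolding trace_def sum_product
    by (intro sum.cong refl) (simp add: twist.hom_mult twist_right_embed right_embed.hom_mult mult_ac)
  also have "\<dots> = (\<Sum>g\<in>carrier G. \<Sum>h\<in>carrier G. \<Sum>i\<in>I.
           twist g F * twist h H * right_embed (\<phi> g (e i) * \<phi> h (e' i)))"
    by (subst sum.swap, intro sum.cong refl, subst sum.swap, rule refl)
  also have "\<dots> = (\<Sum>g\<in>carrier G. \<Sum>h\<in>carrier G. if g = h then right_embed D * twist g (F * H) else 0)"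
    by (intro sum.cong refl)
      (simp add: dual twist.hom_mult mult_ac flip: sum_distrib_left right_embed.hom_sum)
  also have "\<dots> = right_embed D * trace (F * H)"
    using fin by (simp add: trace_def sum_distrib_left)
  finally show ?thesis .
qed

text \<open>The dual bases write the trace of \<open>A\<^sup>2 F\<close>, up to the factor \<open>D\<close>, as a sum of products of an invariant
  tensor in \<open>J\<close> and one in the next lower power of \<open>J\<close>; on such products \<open>\<delta>\<close> acts through its commutators.\<close>

lemma ext_vanishes:
  "inv_diff_op n \<delta> \<Longrightarrow> F \<in> tinvs \<Longrightarrow> diag_pow (Suc n) F \<Longrightarrow> left_linear_ext (\<lambda>b. \<delta> (reynolds b)) F = 0"
proof (induction n arbitrary: \<delta> F)
  case 0
  \<comment> \<open>An operator of order 0 is multiplication by \<open>\<delta> 1\<close>, so its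
    extension factors through the diagonal.\<close>
  have "left_linear_ext (\<lambda>b. \<delta> (reynolds b)) H = \<delta> 1 * diagonal (treynolds H)" for H
  proof (induction H rule: tensor_induct)
    case (tensor a b)
    have "\<delta> (reynolds b) = reynolds b * \<delta> 1"
      using 0(1) reynolds_invs[of b] invs_one by (metis inv_diff_op.simps(1) mult.right_neutral)
    then show ?case
      by (simp add: left_linear_ext_tensor k_linear_inv_diff_op[OF 0(1)] treynolds_tensor diagonal.hom_mult)
  qed (simp add: left_linear_ext_add treynolds_add diagonal.hom_add distrib_left)
  then show ?case using 0 by (simp add: treynolds_id diagonal_diag_pow)
next
  case (Suc n)
  let ?L = "left_linear_ext (\<lambda>b. \<delta> (reynolds b))"
  obtain D and I :: "('c \<Rightarrow>\<^sub>0 nat) set" and e e' where D: "D \<in> invs" "D \<noteq> 0"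
    and dual: "\<And>g h. g \<in> carrier G \<Longrightarrow> h \<in> carrier G \<Longrightarrow> (\<Sum>i\<in>I. \<phi> g (e i) * \<phi> h (e' i)) = (if g = h then D else 0)"
    by (rule dual_bases) blast
  \<comment> \<open>The exponent \<open>Suc n\<close> keeps the traces \<open>H' i\<close> below in
    \<open>J^(n+1)\<close>, the power at which the induction hypothesis applies to commutators of
    \<delta>.\<close>
  define A where "A = separator (Suc n)"
  have A: "diag_pow (Suc n) (twist g A)" if "g \<in> carrier G" "g \<noteq> \<one>" for g
    unfolding A_def by (rule twist_separator[OF that])
  have A1: "diag_pow (Suc 0) (twist g A)" if "g \<in> carrier G" "g \<noteq> \<one>" for g
    using A[OF that] by (rule diag_pow_mono) simp
  note mult_tinvs = ext_mult_tinvs[OF Suc.prems(1) Suc.IH]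
  have zero: "?L (right_embed D * trace (A * A * H)) = 0" if "diag_pow (Suc (Suc n)) H" for H
    using that
  proof (induction "Suc (Suc n)" H rule: diag_pow.induct)
    case (step H w)
    define E where "E i = trace ((right_embed w - mconst w) * A * right_embed (e i))" for i
    define H' where "H' i = trace (H * A * right_embed (e' i))" for i
    have E: "E i \<in> tinvs" "diagonal (E i) = 0" for i
    proof -
      have "diag_pow (Suc 0) (trace (((right_embed w - mconst w) * right_embed (e i)) * A))"
        by (rule diag_pow_trace) (auto simp: A1 mult.commute[of _ "right_embed (e i)"] diag_pow_mult diag_pow_gen)
      then have "diag_pow (Suc 0) (E i)" by (simp add: E_def mult_ac)
      then show "diagonal (E i) = 0" by (rule diagonal_diag_pow) simp
    qed (simp add: E_def trace_tinvs)
    have H': "H' i \<in> tinvs" "diag_pow (Suc n) (H' i)" for i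
    proof -
      have "diag_pow (Suc n) (trace ((H * right_embed (e' i)) * A))"
        by (rule diag_pow_trace) (auto simp: A mult.commute[of H] diag_pow_mult step)
      then show "diag_pow (Suc n) (H' i)" by (simp add: H'_def mult_ac)
    qed (simp add: H'_def trace_tinvs)
    have "(\<Sum>i\<in>I. E i * H' i) = right_embed D * trace (((right_embed w - mconst w) * A) * (H * A))"
      unfolding E_def H'_def by (rule trace_mult_dual[OF dual])
    also have "((right_embed w - mconst w) * A) * (H * A) = A * A * ((right_embed w - mconst w) * H)"
      by (simp only: mult_ac)
    finally have "right_embed D * trace (A * A * ((right_embed w - mconst w) * H)) = (\<Sum>i\<in>I. E i * H' i)" ..
    then show ?case by (simp add: left_linear_ext_sum mult_tinvs E H')
  next
    case (add H K)
    then show ?case by (simp add: distrib_left trace_add left_linear_ext_add)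
  qed (simp add: trace_def twist.hom_zero)
  \<comment> \<open>For invariant \<open>F\<close> the trace of \<open>A * A * F\<close> is
    \<open>F\<close> times that of \<open>A * A\<close>. Restricted to the diagonal, only the
    identity summand of the latter survives, so \<open>S\<close> contributes a nonzero factor that
    can be cancelled.\<close>
  define S where "S = right_embed D * trace (A * A)"
  have S: "S \<in> tinvs" unfolding S_def by (intro tinvs_mult tinvs_right_embed D trace_tinvs)
  have "diagonal (trace (A * A)) = diagonal A * diagonal A"
  proof -
    have "diagonal (twist g (A * A)) = 0" if "g \<in> carrier G - {\<one>}" for g
      using that A1[of g] by (simp add: twist.hom_mult diagonal.hom_mult diagonal_diag_pow)
    then show ?thesis by (simp add: trace_split diagonal.hom_add diagonal.hom_sum diagonal.hom_mult)
  qed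
  then have S0: "diagonal S \<noteq> 0"
    using D diagonal_separator[of "Suc n"] by (simp add: S_def A_def diagonal.hom_mult)
  have "diagonal S * ?L F = ?L (S * F)"
    using Suc.prems by (intro mult_tinvs[symmetric] S) (auto intro: diag_pow_mono)
  also have "S * F = right_embed D * trace (A * A * F)"
    using Suc.prems by (simp add: S_def trace_mult mult.commute[of _ F] mult.assoc mult.left_commute[of _ F])
  finally show ?case using zero[OF Suc.prems(3)] S0 by simp
qed

text \<open>Modulo a high power of the diagonal ideal, every tensor becomes invariant after multiplication by
  a product of powers of linear forms \<open>g v - v\<close>.\<close>

lemma cut_factor:
  assumes "g \<in> carrier G"
  obtains A where "diag_pow n (twist g A)" and "diag_pow n (A - mconst ((\<phi> g v - v) ^ (n + n)))"
proof -
  \<comment> \<open>\<open>?u\<close> lies in J, and \<open>?w\<close> does after the twist by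
    \<open>g\<close>, while their sum is \<open>(g v - v) \<otimes> 1\<close>. In the splitting of
    the \<open>2n\<close>-th power, one part is in \<open>J^n\<close> and the other is in
    \<open>J^n\<close> after the twist.\<close>
  let ?u = "right_embed v - mconst v" and ?w = "mconst (\<phi> g v) - right_embed v"
  obtain Z1 A where "(?u + ?w) ^ (n + n) = ?u ^ n * Z1 + ?w ^ n * A" using power_add_split by blast
  then have "?w ^ n * A - mconst ((\<phi> g v - v) ^ (n + n)) = ?u ^ n * - Z1"
    by (simp add: mconst.hom_power mconst.hom_diff)
  moreover have "diag_pow n (?u ^ n * - Z1)"
    using diag_pow_mult[OF diag_pow_power[OF diag_pow_gen[of v]], of n "- Z1"] by (simp only: mult.commute)
  moreover have "diag_pow (Suc 0) (twist g ?w)"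
    using diag_pow_uminus[OF diag_pow_twist_gen[OF assms, of v]] by (simp add: twist.hom_diff)
  then have "diag_pow n (twist g (?w ^ n * A))"
    unfolding twist.hom_mult twist.hom_power
    by (subst mult.commute) (rule diag_pow_mult[OF diag_pow_power])
  ultimately show ?thesis using that[of "?w ^ n * A"] by simp
qed

lemma approximation:
  obtains E where "E \<in> tinvs"
    and "diag_pow n (E - mconst (\<Prod>g\<in>carrier G - {\<one>}. (\<phi> g (v g) - v g) ^ (n + n)) * F)"
proof -
  have "\<forall>g\<in>carrier G. \<exists>A. diag_pow n (twist g A) \<and> diag_pow n (A - mconst ((\<phi> g (v g) - v g) ^ (n + n)))"
    using cut_factor by metis
  then obtain A where A: "\<And>g. g \<in> carrier G \<Longrightarrow> diag_pow n (twist g (A g))"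
      "\<And>g. g \<in> carrier G \<Longrightarrow> diag_pow n (A g - mconst ((\<phi> g (v g) - v g) ^ (n + n)))"
    by (auto simp: bchoice_iff)
  define P where "P = (\<Prod>g\<in>carrier G - {\<one>}. A g)"
  \<comment> \<open>All nontrivial twists of \<open>P\<close> lie in \<open>J^n\<close>, so modulo
    \<open>J^n\<close> the trace is its identity summand \<open>F * P\<close>, and \<open>P\<close>
    is congruent to the product of the linear forms.\<close>
  define E where "E = trace (F * P)"
  let ?s = "\<Prod>g\<in>carrier G - {\<one>}. (\<phi> g (v g) - v g) ^ (n + n)"
  have "diag_pow n (P - mconst ?s)"
    unfolding P_def mconst.hom_prod using fin A(2) by (intro diag_pow_prod_diff) auto
  then have 1: "diag_pow n (F * (P - mconst ?s))" by (rule diag_pow_mult)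
  have 2: "diag_pow n (\<Sum>g\<in>carrier G - {\<one>}. twist g (F * P))"
    unfolding twist.hom_mult P_def twist.hom_prod
    using fin A(1) by (intro diag_pow_sum diag_pow_mult diag_pow_prod) auto
  have "E - mconst ?s * F = F * (P - mconst ?s) + (\<Sum>g\<in>carrier G - {\<one>}. twist g (F * P))"
    by (simp add: E_def trace_split algebra_simps)
  then have "diag_pow n (E - mconst ?s * F)" using diag_pow.add[OF 1 2] by simp
  then show ?thesis using that[of E] by (simp add: E_def trace_tinvs)
qed

text \<open>The pair \<open>s\<close>, \<open>E\<close> stands for the fraction
  \<open>E / s\<close>, which agrees with \<open>F\<close> modulo \<open>J^n\<close>; applying the
  extended \<delta> to \<open>E\<close> and dividing by \<open>s\<close> is the candidate for its
  value at \<open>F\<close>.\<close>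

definition approximates :: "nat \<Rightarrow> ('c, 'd) tensor_square \<Rightarrow> ('c, 'd) mpoly \<Rightarrow> ('c, 'd) tensor_square \<Rightarrow> bool" where
  "approximates n F s E \<longleftrightarrow> E \<in> tinvs \<and> diag_pow n (E - mconst s * F)"

lemma act_diff_forms: "g \<in> carrier G \<Longrightarrow> v \<in> forms d \<Longrightarrow> \<phi> g v - v \<in> forms d"
  using act_forms[of g v d] unfolding forms_iff by (fastforce simp: in_keys_iff lookup_minus)

text \<open>The value at \<open>F\<close> of the extension of \<open>\<delta>\<close> to \<open>R\<close> exists in the fraction field with denominator the
  product in \<open>approximation\<close>; the factors of this denominator are removed one after the other, since
  for each \<open>g\<close> two coprime choices of the linear form are available.\<close>

lemma extension_exists:
  assumes \<delta>: "inv_diff_op n \<delta>"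
  obtains c where "\<And>s E. approximates (Suc n) F s E \<Longrightarrow> left_linear_ext (\<lambda>b. \<delta> (reynolds b)) E = s * c"
proof -
  let ?L = "left_linear_ext (\<lambda>b. \<delta> (reynolds b))"
  let ?M = "Suc n + Suc n"
  let ?good = "\<lambda>Z1 (v :: 'a \<Rightarrow> ('c, 'd) mpoly). (\<forall>g\<in>Z1. v g \<in> forms (Suc 0))"
  let ?p = "\<lambda>Z1 v. \<Prod>g\<in>Z1. (\<phi> g (v g) - v g) ^ ?M"
  \<comment> \<open>The candidate value does not depend on the chosen fraction: the cross difference
    is invariant and lies in \<open>J^(n+1)\<close>, hence is killed.\<close>
  have cross: "s' * ?L E = s * ?L E'" if "approximates (Suc n) F s E" "approximates (Suc n) F s' E'" for s s' E E'
  proof -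
    have "diag_pow (Suc n) (mconst s' * (E - mconst s * F) - mconst s * (E' - mconst s' * F))"
      using that unfolding approximates_def by (metis diag_pow_diff diag_pow_mult)
    then have "diag_pow (Suc n) (mconst s' * E - mconst s * E')" by (simp add: algebra_simps)
    moreover have "mconst s' * E - mconst s * E' \<in> tinvs"
      using that by (auto simp: approximates_def intro!: tinvs_diff tinvs_mult tinvs_mconst)
    ultimately have "?L (mconst s' * E - mconst s * E') = 0"
      by (intro ext_vanishes[OF \<delta>])
    then show ?thesis by (simp add: left_linear_ext_diff left_linear_ext_mconst_mult)
  qed
  have nonzero: "\<exists>s E. approximates (Suc n) F s E \<and> s \<noteq> 0"
  proof -
    obtain E where "approximates (Suc n) F (?p (carrier G - {\<one>}) moved) E"
      using approximation[of "Suc n" moved F] unfolding approximates_def by blast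
    moreover have "?p (carrier G - {\<one>}) moved \<noteq> 0"
      using fin moved by (auto simp: mpoly_prod_eq_0_iff)
    ultimately show ?thesis by blast
  qed
  \<comment> \<open>\<open>Z1\<close> holds the elements whose factor has left the denominator. The
    claim is made for every choice of linear forms at the others, because removing the next factor
    compares two choices there.\<close>
  have "Z1 \<subseteq> carrier G - {\<one>} \<Longrightarrow> \<forall>v. ?good (carrier G - {\<one>} - Z1) v \<longrightarrow>
      (\<exists>w. \<forall>s E. approximates (Suc n) F s E \<longrightarrow> s * w = ?p (carrier G - {\<one>} - Z1) v * ?L E)" if "finite Z1" for Z1
    using that
  proof (induction Z1 rule: finite_induct)
    case empty
    show ?case
    proof (intro allI impI)
      fix v
      obtain E where "approximates (Suc n) F (?p (carrier G - {\<one>} - {}) v) E"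
        using approximation[of "Suc n" v F] unfolding approximates_def by auto
      then show "\<exists>w. \<forall>s E. approximates (Suc n) F s E \<longrightarrow> s * w = ?p (carrier G - {\<one>} - {}) v * ?L E"
        using cross by (metis (no_types, lifting))
    qed
  next
    case (insert g Z1)
    let ?Y = "carrier G - {\<one>} - insert g Z1"
    have g: "g \<in> carrier G" "g \<noteq> \<one>" and Y: "carrier G - {\<one>} - Z1 = insert g ?Y" "g \<notin> ?Y" "finite ?Y"
      using insert fin by auto
    show ?case
    proof (intro allI impI)
      fix v assume good: "?good ?Y v"
      obtain a b where ab: "a \<in> forms (Suc 0)" "b \<in> forms (Suc 0)" "\<phi> g a \<noteq> a"
          "\<And>c. \<phi> g b - b \<noteq> mconst c * (\<phi> g a - a)"
        using two_forms[OF g] by blast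
      define l where "l = \<phi> g a - a"
      define l' where "l' = \<phi> g b - b"
      have l: "l \<in> forms (Suc 0)" "l \<noteq> 0" and l': "l' \<in> forms (Suc 0)"
        using ab g by (auto simp: l_def l'_def intro: act_diff_forms)
      have ndvd: "\<not> l dvd l'"
        using linear_form_dvd_linear_form[OF l(1) l'] ab(4) unfolding l_def l'_def by blast
      have "\<exists>w. \<forall>s E. approximates (Suc n) F s E \<longrightarrow> s * w = (\<phi> g u - u) ^ ?M * ?p ?Y v * ?L E"
        if "u \<in> forms (Suc 0)" for u
      proof -
        have eq: "?p (carrier G - {\<one>} - Z1) (v(g := u)) = (\<phi> g u - u) ^ ?M * ?p ?Y v"
          unfolding Y(1) using Y(2,3) by (subst prod.insert) (auto intro!: prod.cong)
        have "?good (carrier G - {\<one>} - Z1) (v(g := u))"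
          unfolding Y(1) using good that by auto
        moreover have "Z1 \<subseteq> carrier G - {\<one>}" using insert.prems by blast
        ultimately show ?thesis using insert.IH[rule_format, of "v(g := u)"] unfolding eq by blast
      qed
      from this[OF ab(1)] this[OF ab(2)] obtain w1 w2 where
        w: "\<And>s E. approximates (Suc n) F s E \<Longrightarrow> s * w1 = l ^ ?M * ?p ?Y v * ?L E"
           "\<And>s E. approximates (Suc n) F s E \<Longrightarrow> s * w2 = l' ^ ?M * ?p ?Y v * ?L E"
        unfolding l_def l'_def by blast
      obtain s0 E0 where 0: "approximates (Suc n) F s0 E0" "s0 \<noteq> 0" using nonzero by blast
      have "s0 * (l' ^ ?M * w1) = l' ^ ?M * (s0 * w1)" by (rule mult.left_commute)
      also have "\<dots> = l ^ ?M * (s0 * w2)" unfolding w[OF 0(1)] by (simp only: mult_ac)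
      also have "\<dots> = s0 * (l ^ ?M * w2)" by (rule mult.left_commute)
      finally have "l' ^ ?M * w1 = l ^ ?M * w2" using mpoly_mult_left_cancel[OF 0(2)] by blast
      \<comment> \<open>\<open>l\<close> is prime and does not divide \<open>l'\<close>, so the
        whole power of \<open>l\<close> must divide \<open>w1\<close>.\<close>
      then have "l ^ ?M dvd l' ^ ?M * w1" by simp
      then have "l ^ ?M dvd w1"
        using linear_form_power_dvd[OF l linear_form_not_dvd_power[OF l ndvd]] by blast
      then obtain w0 where w0: "w1 = l ^ ?M * w0" by (auto simp: dvd_def)
      have "s * w0 = ?p ?Y v * ?L E" if "approximates (Suc n) F s E" for s E
      proof -
        have "l ^ ?M * (s * w0) = s * w1" unfolding w0 by (rule mult.left_commute)
        also have "\<dots> = l ^ ?M * (?p ?Y v * ?L E)" unfolding w(1)[OF that] by (rule mult.assoc)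
        finally show ?thesis using mpoly_mult_left_cancel[of "l ^ ?M"] l by simp
      qed
      then show "\<exists>w. \<forall>s E. approximates (Suc n) F s E \<longrightarrow> s * w = ?p ?Y v * ?L E" by blast
    qed
  qed
  from this[of "carrier G - {\<one>}"] fin
  obtain w where "\<forall>s E. approximates (Suc n) F s E \<longrightarrow> s * w = ?L E" by auto
  then show ?thesis using that[of w] by metis
qed

text \<open>Modulo \<open>J^(n+1)\<close>, the tensor \<open>1 \<otimes> f\<close> is a combination
  of the \<open>x \<otimes> 1\<close>, so the extended operator sends it to a combination of the
  variables. The coefficients \<open>H x\<close> need not be invariant tensors, which is why the
  existence of values on all of R \<otimes> R is required.\<close>

lemma inv_diff_op_deg_ge:
  assumes \<delta>: "inv_diff_op n \<delta>" and f: "f \<in> invs" "f \<in> deg_ge (Suc n)"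
  shows "\<delta> f \<in> deg_ge (Suc 0)"
proof -
  let ?L = "left_linear_ext (\<lambda>b. \<delta> (reynolds b))"
  obtain F H where FH: "right_embed f = F + (\<Sum>x\<in>UNIV. mconst (mvar x) * H x)" "diag_pow (Suc n) F"
    using right_embed_deg_ge[OF f(2)] by (elim exE conjE) (rule that)
  have "\<exists>c. \<forall>s E. approximates (Suc n) (H x) s E \<longrightarrow> ?L E = s * c" for x
    using extension_exists[OF \<delta>, of "H x"] by metis
  then obtain c where c: "\<And>x s E. approximates (Suc n) (H x) s E \<Longrightarrow> ?L E = s * c x" by metis
  define s where "s = (\<Prod>g\<in>carrier G - {\<one>}. (\<phi> g (moved g) - moved g) ^ (Suc n + Suc n))"
  have s: "s \<noteq> 0" using fin moved by (auto simp: s_def mpoly_prod_eq_0_iff)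
  have "\<exists>E. approximates (Suc n) (H x) s E" for x
    by (rule approximation[of "Suc n" moved "H x"]) (auto simp: approximates_def s_def)
  then obtain E where E: "\<And>x. approximates (Suc n) (H x) s (E x)" by metis
  \<comment> \<open>This form shows that \<open>K\<close> is an invariant tensor, and
    \<open>K_eq\<close> that it lies in \<open>J^(n+1)\<close>, although \<open>F\<close> and the
    \<open>H x\<close> themselves need not be invariant.\<close>
  define K where "K = mconst s * right_embed f - (\<Sum>x\<in>UNIV. mconst (mvar x) * E x)"
  have K_eq: "K = mconst s * F - (\<Sum>x\<in>UNIV. mconst (mvar x) * (E x - mconst s * H x))"
    by (simp add: K_def FH(1) distrib_left sum_distrib_left sum_subtractf right_diff_distrib mult.left_commute)
  have "diag_pow (Suc n) (mconst (mvar x) * (E x - mconst s * H x))" for x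
    using E[of x] by (auto simp: approximates_def intro: diag_pow_mult)
  then have "diag_pow (Suc n) K"
    unfolding K_eq by (intro diag_pow_diff[OF diag_pow_mult[OF FH(2)] diag_pow_sum])
  moreover have "K \<in> tinvs"
    using E f unfolding K_def approximates_def
    by (intro tinvs_diff tinvs_mult tinvs_sum tinvs_mconst tinvs_right_embed) auto
  ultimately have "?L K = 0" by (intro ext_vanishes[OF \<delta>])
  moreover have "?L (right_embed f) = \<delta> f"
    using left_linear_ext_tensor[OF k_linear_inv_diff_op[OF \<delta>], of 1 f] f by (simp add: reynolds_id)
  ultimately have "s * \<delta> f = (\<Sum>x\<in>UNIV. mvar x * (s * c x))"
    by (simp add: K_def left_linear_ext_diff left_linear_ext_sum left_linear_ext_mconst_mult c[OF E])
  also have "\<dots> = s * (\<Sum>x\<in>UNIV. mvar x * c x)" by (simp add: sum_distrib_left mult.left_commute)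
  finally have "\<delta> f = (\<Sum>x\<in>UNIV. mvar x * c x)" using mpoly_mult_left_cancel[OF s] by blast
  also have "\<dots> \<in> deg_ge (Suc 0)"
  proof -
    have "mvar x * c x \<in> deg_ge (Suc 0 + 0)" for x
      by (rule deg_ge_mult) (auto simp: mvar_def deg_ge_def)
    then have "mvar x * c x \<in> deg_ge (Suc 0)" for x by simp
    then show ?thesis by (rule deg_ge_sum)
  qed
  finally show ?thesis .
qed

end

section \<open>Coefficients of Taylor expansions\<close>

lemma type_ring_hom_lookup_0:
  "type_ring_hom (\<lambda>f :: ('x::finite \<Rightarrow>\<^sub>0 nat) \<Rightarrow>\<^sub>0 'c::comm_ring_1. Poly_Mapping.lookup f 0)"
proof
  fix f g :: "('x \<Rightarrow>\<^sub>0 nat) \<Rightarrow>\<^sub>0 'c"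
  have 0: "a + b = 0 \<longleftrightarrow> a = 0 \<and> b = 0" for a b :: "'x \<Rightarrow>\<^sub>0 nat"
    using tdeg_add[of a b] by (metis add_is_0 tdeg_eq_0_iff)
  have "Poly_Mapping.lookup (Poly_Mapping.single m c * g) 0 = Poly_Mapping.lookup (Poly_Mapping.single m c) 0 * Poly_Mapping.lookup g 0" for m c
    by (induction g rule: poly_mapping_induct)
      (auto simp: mult_single lookup_single when_def 0 lookup_add distrib_left)
  then show "Poly_Mapping.lookup (f * g) 0 = Poly_Mapping.lookup f 0 * Poly_Mapping.lookup g 0"
    by (induction f rule: poly_mapping_induct) (auto simp: lookup_add distrib_right)
qed (auto simp: lookup_add)

interpretation lookup_0: type_ring_hom
  "\<lambda>f :: ('x::finite \<Rightarrow>\<^sub>0 nat) \<Rightarrow>\<^sub>0 'c::comm_ring_1. Poly_Mapping.lookup f 0"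
  by (rule type_ring_hom_lookup_0)

text \<open>Substituting \<open>x + y\<close> for \<open>y\<close> turns
  \<open>1 \<otimes> f\<close> into \<open>f (x + y)\<close>, whose coefficient at
  \<open>y^m\<close> is a Hasse derivative of \<open>f\<close>, available in every characteristic.
  The diagonal ideal goes into the ideal generated by the \<open>y\<close>.\<close>

definition taylor :: "('x::finite, 'k::field) tensor_square \<Rightarrow> ('x, 'k) tensor_square" where
  "taylor = eval_mpoly mconst (\<lambda>x. mconst (mvar x) + mvar x)"

lemma type_ring_hom_taylor: "type_ring_hom taylor"
  unfolding taylor_def by (rule type_ring_hom_eval_mpoly[OF type_ring_hom_mconst])

interpretation taylor: type_ring_hom taylor
  by (rule type_ring_hom_taylor)

lemma taylor_mconst [simp]: "taylor (mconst a) = mconst a"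
  and taylor_mvar: "taylor (mvar x) = mconst (mvar x) + mvar x"
  by (simp_all add: taylor_def type_ring_hom_mconst)

lemma lookup_mvar_0 [simp]: "Poly_Mapping.lookup (mvar (x :: 'x::finite)) 0 = 0"
  using tdeg_single[of x 1] by (auto simp: mvar_def lookup_single when_def simp del: tdeg_single)

lemma lookup_mconst_0 [simp]: "Poly_Mapping.lookup (mconst c) 0 = c"
  by (simp add: mconst_def)

lemma lookup_taylor_right_embed_0: "Poly_Mapping.lookup (taylor (right_embed w)) 0 = w"
proof (rule type_ring_hom_ext[of "\<lambda>w. Poly_Mapping.lookup (taylor (right_embed w)) 0" "\<lambda>w. w"])
  show "type_ring_hom (\<lambda>w. Poly_Mapping.lookup (taylor (right_embed w)) 0)"
    by (rule type_ring_hom_comp[OF type_ring_hom_comp[OF type_ring_hom_right_embed type_ring_hom_taylor]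
          type_ring_hom_lookup_0])
qed (simp_all add: type_ring_hom_id right_embed_mconst right_embed_mvar taylor_mvar lookup_add)

lemma deg_ge_taylor: "diag_pow n F \<Longrightarrow> taylor F \<in> deg_ge n"
proof (induction rule: diag_pow.induct)
  case (step n F w)
  have "taylor (right_embed w - mconst w) \<in> deg_ge (Suc 0)"
    by (simp add: deg_ge_1_iff taylor.hom_diff lookup_minus lookup_taylor_right_embed_0)
  from deg_ge_mult[OF this step.IH] show ?case by (simp add: taylor.hom_mult)
qed (auto simp: taylor.hom_add deg_ge_add)

text \<open>Setting \<open>x = 0\<close> in \<open>f (x + y)\<close> returns \<open>f (y)\<close>;
  the auxiliary \<open>h\<close> performs this substitution. Hence a Hasse derivative detects one
  coefficient of \<open>f\<close> at the origin.\<close>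

lemma lookup_lookup_taylor:
  fixes f :: "('x::finite, 'k::field) mpoly"
  shows "Poly_Mapping.lookup (Poly_Mapping.lookup (taylor (right_embed f)) m) 0 = Poly_Mapping.lookup f m"
proof -
  define h :: "('x, 'k) tensor_square \<Rightarrow> ('x, 'k) mpoly"
    where "h = eval_mpoly (\<lambda>a. mconst (Poly_Mapping.lookup a 0)) mvar"
  have hom: "type_ring_hom (\<lambda>a :: ('x, 'k) mpoly. mconst (Poly_Mapping.lookup a 0) :: ('x, 'k) mpoly)"
    by (rule type_ring_hom_comp[OF type_ring_hom_lookup_0 type_ring_hom_mconst])
  interpret h: type_ring_hom h unfolding h_def by (rule type_ring_hom_eval_mpoly[OF hom])
  have lookup_h: "Poly_Mapping.lookup (h F) m = Poly_Mapping.lookup (Poly_Mapping.lookup F m) 0" for F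
  proof (induction F rule: poly_mapping_induct)
    case (single k a)
    have "h (Poly_Mapping.single k a) = Poly_Mapping.single k (Poly_Mapping.lookup a 0)"
      unfolding h_def by (simp add: eval_mpoly_single[OF hom] prod_mvar_power) (simp add: mconst_def mult_single)
    then show ?case by (simp add: lookup_single when_def)
  qed (simp add: h.hom_add lookup_add)
  have "h (taylor (right_embed f)) = f"
  proof (rule type_ring_hom_ext[of "\<lambda>f. h (taylor (right_embed f))" "\<lambda>f. f"])
    show "type_ring_hom (\<lambda>f. h (taylor (right_embed f)))"
      by (rule type_ring_hom_comp[OF type_ring_hom_comp[OF type_ring_hom_right_embed type_ring_hom_taylor]
          h.type_ring_hom_axioms])
    have c: "h (mconst a) = mconst (Poly_Mapping.lookup a 0)" for a unfolding h_def by (simp add: hom)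
    show "h (taylor (right_embed (mconst c))) = mconst c" for c
      by (simp add: right_embed_mconst c)
    show "h (taylor (right_embed (mvar x))) = mvar x" for x
      by (simp add: right_embed_mvar taylor_mvar h.hom_add c) (simp add: h_def hom)
  qed (rule type_ring_hom_id)
  then show ?thesis by (metis lookup_h)
qed

context linear_group_action begin

lemma lookup_reynolds_0: "Poly_Mapping.lookup (reynolds f) 0 = Poly_Mapping.lookup f 0"
proof -
  have "Poly_Mapping.lookup (reynolds f) 0
      = inverse (of_nat (card (carrier G))) * (\<Sum>g\<in>carrier G. Poly_Mapping.lookup (\<phi> g f) 0)"
    by (simp add: reynolds_def lookup_0.hom_mult lookup_0.hom_sum)
  also have "(\<Sum>g\<in>carrier G. Poly_Mapping.lookup (\<phi> g f) 0) = of_nat (card (carrier G)) * Poly_Mapping.lookup f 0"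
    by (simp add: lookup_act_0)
  finally show ?thesis using card_nonzero by simp
qed

text \<open>For \<open>H = 1\<close> this is a Hasse derivative followed by the Reynolds operator; commutators multiply \<open>H\<close> by
  \<open>1 \<otimes> t - t \<otimes> 1\<close>.\<close>

lemma inv_diff_op_taylor_coeff:
  assumes "diag_pow j H" and "tdeg m \<le> n + j"
  shows "inv_diff_op n (\<lambda>f. reynolds (Poly_Mapping.lookup (taylor (H * right_embed f)) m))"
  using assms
proof (induction n arbitrary: j H)
  case 0
  \<comment> \<open>The difference of both sides is a coefficient at \<open>m\<close> of the Taylor
    image of an element of \<open>J^(j+1)\<close>, and the degree of \<open>m\<close> is at most
    \<open>j\<close>.\<close>
  have "Poly_Mapping.lookup (taylor (H * right_embed (s * t))) m = s * Poly_Mapping.lookup (taylor (H * right_embed t)) m" for s t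
  proof -
    have "diag_pow (Suc j) (right_embed t * ((right_embed s - mconst s) * H))"
      by (intro diag_pow_mult diag_pow.step 0)
    then have "taylor (right_embed t * ((right_embed s - mconst s) * H)) \<in> deg_ge (Suc j)"
      by (rule deg_ge_taylor)
    then have "Poly_Mapping.lookup (taylor (right_embed t * ((right_embed s - mconst s) * H))) m = 0"
      using 0(2) by (force simp: deg_ge_def in_keys_iff)
    moreover have "right_embed t * ((right_embed s - mconst s) * H) = H * right_embed (s * t) - mconst s * (H * right_embed t)"
      by (simp add: right_embed.hom_mult algebra_simps)
    ultimately show ?thesis
      by (simp add: taylor.hom_diff taylor.hom_mult[of "mconst s"] lookup_minus lookup_mconst_mult)
  qed
  then show ?case
    by (simp add: reynolds_invs reynolds_mult right_embed.hom_add distrib_left taylor.hom_add lookup_add reynolds_add)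
next
  case (Suc n)
  let ?L = "\<lambda>H f. reynolds (Poly_Mapping.lookup (taylor (H * right_embed f)) m)"
  have "inv_diff_op n (\<lambda>x. ?L H (t * x) - t * ?L H x)" if t: "t \<in> invs" for t
  proof -
    have "diag_pow (Suc j) ((right_embed t - mconst t) * H)" by (intro diag_pow.step Suc.prems)
    then have "inv_diff_op n (?L ((right_embed t - mconst t) * H))"
      using Suc.prems by (intro Suc.IH) auto
    moreover have "?L ((right_embed t - mconst t) * H) x = ?L H (t * x) - t * ?L H x" for x
    proof -
      have "(right_embed t - mconst t) * H * right_embed x = H * right_embed (t * x) - mconst t * (H * right_embed x)"
        by (simp add: right_embed.hom_mult algebra_simps)
      then have "Poly_Mapping.lookup (taylor ((right_embed t - mconst t) * H * right_embed x)) m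
          = Poly_Mapping.lookup (taylor (H * right_embed (t * x))) m - t * Poly_Mapping.lookup (taylor (H * right_embed x)) m"
        by (simp add: taylor.hom_diff taylor.hom_mult[of "mconst t"] lookup_minus lookup_mconst_mult)
      then have "?L ((right_embed t - mconst t) * H) x + t * ?L H x = ?L H (t * x)"
        using t by (simp flip: reynolds_mult reynolds_add)
      then show ?thesis by (simp add: algebra_simps)
    qed
    ultimately show ?thesis by simp
  qed
  moreover have "?L H (mconst c * t) = mconst c * ?L H t" for c t
  proof -
    have "H * right_embed (mconst c * t) = mconst (mconst c) * (H * right_embed t)"
      by (simp add: right_embed.hom_mult right_embed_mconst mult.left_commute)
    then show ?thesis
      by (simp add: taylor.hom_mult[of "mconst _"] lookup_mconst_mult reynolds_mult invs_mconst)
  qed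
  ultimately show ?case
    by (simp add: reynolds_invs right_embed.hom_add distrib_left taylor.hom_add lookup_add reynolds_add)
qed

lemma inv_diff_op_closed: "inv_diff_op n \<delta> \<Longrightarrow> t \<in> invs \<Longrightarrow> \<delta> t \<in> invs"
  by (cases n) auto

section \<open>Differential powers of the homogeneous maximal ideal\<close>

abbreviation "inv_ring \<equiv> invariant_ring G \<phi>"

lemma inv_ring_simps [simp]:
  "carrier inv_ring = invs" "monoid.mult inv_ring = (*)" "ring.add inv_ring = (+)"
  "one inv_ring = 1" "ring.zero inv_ring = 0" "module.smult inv_ring = mpoly_scale"
  by (simp_all add: invariant_ring_def mpoly_algebra_def invs_def)

lemma cring_inv_ring: "cring inv_ring"
proof (rule cringI)
  show "abelian_group inv_ring"
  proof (rule abelian_groupI)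
    fix x assume "x \<in> carrier inv_ring"
    then show "\<exists>y\<in>carrier inv_ring. y \<oplus>\<^bsub>inv_ring\<^esub> x = \<zero>\<^bsub>inv_ring\<^esub>"
      by (intro bexI[of _ "- x"]) (auto intro: invs_uminus)
  qed (auto intro: invs_add)
  show "comm_monoid inv_ring" by (rule comm_monoidI) (auto intro: invs_mult)
qed (auto simp: distrib_right)

sublocale inv_ring: cring inv_ring
  by (rule cring_inv_ring)

lemma inv_ring_uminus: "x \<in> invs \<Longrightarrow> \<ominus>\<^bsub>inv_ring\<^esub> x = - x"
  using inv_ring.minus_equality[of "- x" x] by (simp add: invs_uminus)

lemma inv_ring_minus: "x \<in> invs \<Longrightarrow> y \<in> invs \<Longrightarrow> x \<ominus>\<^bsub>inv_ring\<^esub> y = x - y"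
  by (simp add: a_minus_def inv_ring_uminus)

lemma diff_ops_inv_ring:
  "\<delta> \<in> diff_ops (ring_of_type_algebra :: 'k ring) inv_ring n \<longleftrightarrow> inv_diff_op n \<delta>"
proof (induction n arbitrary: \<delta>)
  case 0
  show ?case by (auto simp: linear_endos_def regular_module_def)
next
  case (Suc n)
  have "(\<forall>t\<in>invs. commutator inv_ring \<delta> t \<in> diff_ops (ring_of_type_algebra :: 'k ring) inv_ring n)
      \<longleftrightarrow> (\<forall>t\<in>invs. inv_diff_op n (\<lambda>x. \<delta> (t * x) - t * \<delta> x))" if "\<forall>t\<in>invs. \<delta> t \<in> invs"
    unfolding Suc.IH using that
    by (intro ball_cong refl inv_diff_op_cong) (simp add: commutator_def inv_ring_minus invs_mult)
  then show ?case
    by (auto simp: linear_endos_def ring_of_type_algebra_def mpoly_scale_eq)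
qed

lemma invs_ideal:
  assumes "I \<subseteq> invs" "0 \<in> I" and "\<And>x y. x \<in> I \<Longrightarrow> y \<in> I \<Longrightarrow> x + y \<in> I"
    and mult: "\<And>t x. t \<in> invs \<Longrightarrow> x \<in> I \<Longrightarrow> t * x \<in> I"
  shows "ideal I inv_ring"
proof (rule idealI)
  show "subgroup I (add_monoid inv_ring)"
  proof
    fix x assume x: "x \<in> I"
    then have "- 1 * x \<in> I" by (intro mult invs_uminus) auto
    moreover have "inv\<^bsub>add_monoid inv_ring\<^esub> x = - x"
      using x assms(1) inv_ring_uminus[of x] by (auto simp: a_inv_def)
    ultimately show "inv\<^bsub>add_monoid inv_ring\<^esub> x \<in> I" by simp
  qed (use assms in auto)
  show "ring inv_ring" by (rule inv_ring.ring_axioms)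
  fix a x assume "a \<in> I" "x \<in> carrier inv_ring"
  then show "x \<otimes>\<^bsub>inv_ring\<^esub> a \<in> I" "a \<otimes>\<^bsub>inv_ring\<^esub> x \<in> I"
    using mult[of x a] by (simp_all add: mult.commute)
qed

text \<open>An invariant without constant term is the sum of its components of positive degree, and
  these are invariant themselves.\<close>

lemma homogeneous_maximal_ideal_inv_ring:
  "homogeneous_maximal_ideal inv_ring (invariant_forms G \<phi>) = invs \<inter> deg_ge (Suc 0)"
proof -
  let ?U = "\<Union>n\<in>{0<..}. invariant_forms G \<phi> n"
  have U: "?U \<subseteq> invs \<inter> deg_ge (Suc 0)"
    by (auto simp: invariant_forms_def forms_iff deg_ge_def)
  have "Idl\<^bsub>inv_ring\<^esub> ?U = invs \<inter> deg_ge (Suc 0)"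
  proof
    have "ideal (invs \<inter> deg_ge (Suc 0)) inv_ring"
      by (rule invs_ideal) (auto intro: invs_add invs_mult deg_ge_add simp: deg_ge_1_iff lookup_0.hom_mult lookup_add)
    then show "Idl\<^bsub>inv_ring\<^esub> ?U \<subseteq> invs \<inter> deg_ge (Suc 0)"
      using U by (rule inv_ring.genideal_minimal)
    show "invs \<inter> deg_ge (Suc 0) \<subseteq> Idl\<^bsub>inv_ring\<^esub> ?U"
    proof
      fix f assume f: "f \<in> invs \<inter> deg_ge (Suc 0)"
      have Uc: "?U \<subseteq> carrier inv_ring" using U by auto
      interpret I: ideal "Idl\<^bsub>inv_ring\<^esub> ?U" inv_ring by (rule inv_ring.genideal_ideal[OF Uc])
      obtain n where n: "f \<in> deg_less n" using ex_deg_less by blast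
      have mem: "hcomp d f \<in> Idl\<^bsub>inv_ring\<^esub> ?U" for d
      proof (cases "d = 0")
        case True
        then have "hcomp d f = 0" using f
          by (intro poly_mapping_eqI) (auto simp: deg_ge_1_iff)
        then show ?thesis using I.zero_closed by simp
      next
        case False
        then have "hcomp d f \<in> ?U" using f hcomp_forms[of d f]
          by (auto simp: invariant_forms_def intro!: hcomp_invs bexI[of _ d])
        then show ?thesis using inv_ring.genideal_self[OF Uc] by blast
      qed
      have "(\<Sum>d<n. hcomp d f) \<in> Idl\<^bsub>inv_ring\<^esub> ?U" for n
        by (induction n) (use I.zero_closed I.a_closed mem in auto)
      then show "f \<in> Idl\<^bsub>inv_ring\<^esub> ?U" by (metis sum_hcomp[OF n])
    qed
  qed
  then show ?thesis by (simp add: homogeneous_maximal_ideal_def)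
qed

end

context small_group_action begin

lemma diff_power_inv_ring:
  assumes "n > 0"
  shows "diff_power (ring_of_type_algebra :: 'd ring) inv_ring
      (homogeneous_maximal_ideal inv_ring (invariant_forms G \<phi>)) n = invs \<inter> deg_ge n"
proof -
  have "f \<in> deg_ge n \<longleftrightarrow> (\<forall>\<delta>. inv_diff_op (n - 1) \<delta> \<longrightarrow> \<delta> f \<in> invs \<inter> deg_ge (Suc 0))" if f: "f \<in> invs" for f
  proof
    assume "f \<in> deg_ge n"
    then show "\<forall>\<delta>. inv_diff_op (n - 1) \<delta> \<longrightarrow> \<delta> f \<in> invs \<inter> deg_ge (Suc 0)"
      using f inv_diff_op_deg_ge[of "n - 1" _ f] assms by (cases n) (auto intro: inv_diff_op_closed)
  next
    assume *: "\<forall>\<delta>. inv_diff_op (n - 1) \<delta> \<longrightarrow> \<delta> f \<in> invs \<inter> deg_ge (Suc 0)"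
    show "f \<in> deg_ge n"
      unfolding deg_ge_def mem_Collect_eq
    proof (intro ballI, rule ccontr)
      fix m assume m: "m \<in> Poly_Mapping.keys f" "\<not> n \<le> tdeg m"
      \<comment> \<open>The degree of \<open>m\<close> is at most \<open>n - 1\<close>, the order
        allowed in the \<open>n\<close>-th differential power. Averaging keeps the constant term,
        here the nonzero coefficient of \<open>f\<close> at \<open>m\<close>.\<close>
      let ?\<delta> = "\<lambda>f. reynolds (Poly_Mapping.lookup (taylor (1 * right_embed f)) m)"
      have "inv_diff_op (n - 1) ?\<delta>"
        using m by (intro inv_diff_op_taylor_coeff[of 0]) (auto intro: diag_pow.base)
      then have "?\<delta> f \<in> deg_ge (Suc 0)" using * by blast
      then show False using m
        by (simp add: deg_ge_1_iff lookup_reynolds_0 lookup_lookup_taylor in_keys_iff)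
    qed
  qed
  then show ?thesis
    by (auto simp: diff_power_def diff_ops_inv_ring homogeneous_maximal_ideal_inv_ring)
qed

end

section \<open>Counting monomials\<close>

text \<open>Stars and bars: a slack entry \<open>n - 1 - tdeg m\<close> turns exponent vectors of
  degree below \<open>n\<close> into lists of fixed length with sum \<open>n - 1\<close>.\<close>

lemma card_tdeg_less:
  assumes "n > 0"
  shows "finite {m :: 'x::finite \<Rightarrow>\<^sub>0 nat. tdeg m < n}"
    and "card {m :: 'x \<Rightarrow>\<^sub>0 nat. tdeg m < n} = (n - 1 + card (UNIV :: 'x set)) choose card (UNIV :: 'x set)"
proof -
  let ?M = "{m :: 'x \<Rightarrow>\<^sub>0 nat. tdeg m < n}" and ?L = "{l :: nat list. length l = Suc (card (UNIV :: 'x set)) \<and> sum_list l = n - 1}"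
  obtain xs where xs: "set xs = (UNIV :: 'x set)" "distinct xs" using finite_distinct_list[OF finite] by blast
  have len: "length xs = card (UNIV :: 'x set)" using xs distinct_card by metis
  have sum: "sum_list (map f xs) = (\<Sum>x\<in>UNIV. f x)" for f :: "'x \<Rightarrow> nat"
    using xs by (simp add: sum_list_distinct_conv_sum_set)
  define F where "F m = map (Poly_Mapping.lookup m) xs @ [n - 1 - tdeg m]" for m :: "'x \<Rightarrow>\<^sub>0 nat"
  have bij: "bij_betw F ?M ?L"
    unfolding bij_betw_def
  proof
    show "inj_on F ?M"
    proof (rule inj_onI)
      fix m m' assume "F m = F m'"
      then have "Poly_Mapping.lookup m x = Poly_Mapping.lookup m' x" for x
        using xs by (auto simp: F_def)
      then show "m = m'" by (rule poly_mapping_eqI)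
    qed
    show "F ` ?M = ?L"
    proof
      show "F ` ?M \<subseteq> ?L" using assms by (auto simp: F_def len sum tdeg_def)
      show "?L \<subseteq> F ` ?M"
      proof
        fix l assume "l \<in> ?L"
        then have l: "length l = Suc (length xs)" "sum_list l = n - 1" by (auto simp: len)
        obtain l' a where la: "l = l' @ [a]" using l(1) by (cases l rule: rev_cases) auto
        then have l': "length l' = length xs" "sum_list l' + a = n - 1" using l by auto
        define f where "f x = the (map_of (zip xs l') x)" for x
        define m where "m = Abs_poly_mapping f"
        have m: "Poly_Mapping.lookup m = f" unfolding m_def by simp
        have "map f xs = l'"
          using l'(1) xs(2) by (intro nth_equalityI) (auto simp: f_def map_of_zip_nth)
        moreover from this have "tdeg m = sum_list l'" by (simp add: tdeg_def m flip: sum)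
        ultimately have "F m = l" "tdeg m < n" using l' la assms by (auto simp: F_def m)
        then show "l \<in> F ` ?M" by auto
      qed
    qed
  qed
  have L: "card ?L = (n - 1 + card (UNIV :: 'x set)) choose card (UNIV :: 'x set)"
    unfolding card_length_sum_list using binomial_symmetric[of "n - 1" "n - 1 + card (UNIV :: 'x set)"] by simp
  have "finite ?L" using L by (intro card_ge_0_finite) simp
  then show "finite ?M" using bij_betw_finite[OF bij] by blast
  show "card ?M = (n - 1 + card (UNIV :: 'x set)) choose card (UNIV :: 'x set)"
    using bij_betw_same_card[OF bij] L by simp
qed

lemma finite_tdeg_less: "finite {m :: 'x::finite \<Rightarrow>\<^sub>0 nat. tdeg m < n}"
  using card_tdeg_less(1)[of n] by (cases "n = 0") auto

section \<open>The monomial basis of the polynomials of bounded degree\<close>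

definition monomials_less :: "nat \<Rightarrow> ('x::finite, 'k::field) mpoly set" where
  "monomials_less n = (\<lambda>m. Poly_Mapping.single m 1) ` {m. tdeg m < n}"

lemma inj_monomial: "inj (\<lambda>m. Poly_Mapping.single m (1 :: 'k::field))"
  by (rule injI) (metis keys_single the_elem_eq one_neq_zero)

lemma finite_monomials_less: "finite (monomials_less n)"
  unfolding monomials_less_def by (intro finite_imageI finite_tdeg_less)

lemma card_monomials_less:
  "n > 0 \<Longrightarrow> card (monomials_less n :: ('x::finite, 'k::field) mpoly set) = (n - 1 + card (UNIV :: 'x set)) choose card (UNIV :: 'x set)"
  unfolding monomials_less_def
  by (simp add: card_image inj_on_subset[OF inj_monomial] card_tdeg_less(2))

lemma independent_monomials_less: "V.independent (monomials_less n :: ('x::finite, 'k::field) mpoly set)"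
proof (rule V.independent_if_scalars_zero[OF finite_monomials_less])
  fix f :: "('x, 'k) mpoly \<Rightarrow> 'k" and x :: "('x, 'k) mpoly"
  assume 0: "(\<Sum>x\<in>monomials_less n. mpoly_scale (f x) x) = 0" and "x \<in> monomials_less n"
  then obtain k where k: "tdeg k < n" "x = Poly_Mapping.single k 1" by (auto simp: monomials_less_def)
  have "(\<Sum>x\<in>monomials_less n. mpoly_scale (f x) x)
      = (\<Sum>m | tdeg m < n. Poly_Mapping.single m (f (Poly_Mapping.single m 1)))"
    unfolding monomials_less_def
    by (subst sum.reindex) (auto intro: inj_on_subset[OF inj_monomial] simp: mpoly_scale_def mult_single)
  then have "Poly_Mapping.lookup (\<Sum>m | tdeg m < n. Poly_Mapping.single m (f (Poly_Mapping.single m 1))) k = 0"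
    using 0 by simp
  then show "f x = 0"
    using k finite_tdeg_less[of n, where ?'x = 'x] by (simp add: lookup_sum lookup_single when_def)
qed

lemma subspace_deg_less: "V.subspace (deg_less n)"
proof (rule V.subspaceI)
  fix c and f :: "('x::finite, 'k::field) mpoly"
  assume "f \<in> deg_less n"
  then show "mpoly_scale c f \<in> deg_less n"
    using keys_mconst_mult[of c f] by (auto simp: deg_less_def mpoly_scale_eq)
qed (auto intro: deg_less_add)

lemma subspace_forms: "V.subspace (forms d :: ('x::finite, 'k::field) mpoly set)"
proof (rule V.subspaceI)
  fix f g :: "('x, 'k) mpoly" and c
  show "f \<in> forms d \<Longrightarrow> g \<in> forms d \<Longrightarrow> f + g \<in> forms d"
    using Poly_Mapping.keys_add[of f g] by (auto simp: forms_iff)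
  show "f \<in> forms d \<Longrightarrow> mpoly_scale c f \<in> forms d"
    using keys_mconst_mult[of c f] by (auto simp: forms_iff mpoly_scale_eq)
qed (simp add: forms_iff)

lemma span_monomials_less: "V.span (monomials_less n) = deg_less n"
proof (rule V.span_subspace)
  show "monomials_less n \<subseteq> deg_less n" by (auto simp: monomials_less_def deg_less_def)
  show "deg_less n \<subseteq> V.span (monomials_less n)"
  proof
    fix f :: "('x::finite, 'k::field) mpoly" assume f: "f \<in> deg_less n"
    have "Poly_Mapping.single m (Poly_Mapping.lookup f m) \<in> V.span (monomials_less n)" if "m \<in> Poly_Mapping.keys f" for m
    proof -
      have "Poly_Mapping.single m (Poly_Mapping.lookup f m) = mpoly_scale (Poly_Mapping.lookup f m) (Poly_Mapping.single m 1)"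
        by (simp add: mpoly_scale_def mult_single)
      moreover have "Poly_Mapping.single m (1 :: 'k) \<in> V.span (monomials_less n)"
        using f that by (intro V.span_base) (auto simp: monomials_less_def deg_less_def)
      ultimately show ?thesis by (simp add: V.span_scale)
    qed
    then have "(\<Sum>m\<in>Poly_Mapping.keys f. Poly_Mapping.single m (Poly_Mapping.lookup f m)) \<in> V.span (monomials_less n)"
      by (rule V.span_sum)
    then show "f \<in> V.span (monomials_less n)" by (simp flip: sum_single_keys)
  qed
qed (rule subspace_deg_less)

lemma finite_basis_exists:
  assumes "V.subspace W" "W \<subseteq> deg_less n"
  obtains B where "finite B" "V.independent B" "V.span B = W"
proof -
  obtain B where B: "B \<subseteq> W" "V.independent B" "W \<subseteq> V.span B"
    using V.basis_exists[of W] by metis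
  have "finite B"
    using V.independent_span_bound[OF finite_monomials_less[of n] B(2)] B(1) assms(2)
    by (auto simp: span_monomials_less)
  then show ?thesis using that B V.span_subspace[OF B(1,3) assms(1)] by blast
qed

section \<open>The length of the quotients\<close>

lemma lookup_deg_ge: "f \<in> deg_ge n \<Longrightarrow> tdeg m < n \<Longrightarrow> Poly_Mapping.lookup f m = 0"
  unfolding deg_ge_def mem_Collect_eq by (metis in_keys_iff leD)

context linear_group_action begin

lemma subspace_invs: "V.subspace invs"
  by (rule V.subspaceI) (auto intro: invs_add invs_mult invs_mconst simp: mpoly_scale_eq)

lemma inv_forms_basis_exists: "\<exists>B. finite B \<and> V.independent B \<and> V.span B = invs \<inter> forms d"
  by (rule finite_basis_exists[of "invs \<inter> forms d" "Suc d"])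
    (auto simp: deg_less_def forms_iff intro: V.subspace_inter subspace_invs subspace_forms)

definition inv_basis :: "nat \<Rightarrow> ('x, 'k) mpoly set" where
  "inv_basis d = (SOME B. finite B \<and> V.independent B \<and> V.span B = invs \<inter> forms d)"

lemma inv_basis: "finite (inv_basis d)" "V.independent (inv_basis d)" "V.span (inv_basis d) = invs \<inter> forms d"
  using someI_ex[OF inv_forms_basis_exists[of d]] by (auto simp: inv_basis_def)

lemma inv_basis_forms: "b \<in> inv_basis d \<Longrightarrow> b \<in> invs \<and> b \<in> forms d \<and> b \<noteq> 0"
  using inv_basis[of d] V.span_base[of b "inv_basis d"] V.dependent_zero by blast

lemma inv_basis_degree_unique: "b \<in> inv_basis d \<Longrightarrow> b \<in> inv_basis e \<Longrightarrow> d = e"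
  using inv_basis_forms[of b] by (metis hcomp_of_form)

text \<open>Collected degree by degree, so that the basis is homogeneous; its size is
  \<open>h n\<close>.\<close>

definition inv_basis_less :: "nat \<Rightarrow> ('x, 'k) mpoly set" where
  "inv_basis_less n = (\<Union>d<n. inv_basis d)"

lemma finite_inv_basis_less: "finite (inv_basis_less n)"
  by (simp add: inv_basis_less_def inv_basis)

text \<open>The component of degree \<open>d\<close> of a relation is a relation among the basis
  elements of that degree.\<close>

lemma independent_inv_basis_less: "V.independent (inv_basis_less n)"
proof (rule V.independent_if_scalars_zero[OF finite_inv_basis_less])
  fix f x assume 0: "(\<Sum>x\<in>inv_basis_less n. mpoly_scale (f x) x) = 0" and "x \<in> inv_basis_less n"
  then obtain d where d: "d < n" "x \<in> inv_basis d" by (auto simp: inv_basis_less_def)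
  have "hcomp d (mpoly_scale (f y) y) = (if y \<in> inv_basis d then mpoly_scale (f y) y else 0)"
    if y: "y \<in> inv_basis_less n" for y
  proof -
    obtain e where e: "y \<in> inv_basis e" using y by (auto simp: inv_basis_less_def)
    then have "hcomp d y = (if d = e then y else 0)" using inv_basis_forms[of y e] by (simp add: hcomp_of_form)
    moreover have "y \<in> inv_basis d \<longleftrightarrow> d = e" using e inv_basis_degree_unique[of y d e] by blast
    ultimately show ?thesis by (simp add: mpoly_scale_eq mrestrict_mconst)
  qed
  then have "hcomp d (\<Sum>x\<in>inv_basis_less n. mpoly_scale (f x) x)
      = (\<Sum>y\<in>inv_basis_less n. if y \<in> inv_basis d then mpoly_scale (f y) y else 0)"
    by (simp add: mrestrict_sum)
  also have "\<dots> = (\<Sum>y\<in>inv_basis_less n \<inter> inv_basis d. mpoly_scale (f y) y)"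
    by (simp add: sum.inter_restrict[symmetric] finite_inv_basis_less)
  also have "inv_basis_less n \<inter> inv_basis d = inv_basis d"
    using d by (auto simp: inv_basis_less_def)
  finally have "(\<Sum>y\<in>inv_basis d. mpoly_scale (f y) y) = 0"
    using 0 by (simp add: mrestrict_zero)
  then show "f x = 0"
    using V.independentD[OF inv_basis(2) inv_basis(1) subset_refl _ d(2)] by blast
qed

lemma in_span_inv_basis:
  assumes "f \<in> invs" "f \<in> deg_ge e" "f \<in> deg_less n"
  shows "f \<in> V.span (\<Union>d\<in>{e..<n}. inv_basis d)"
proof -
  have "hcomp d f \<in> V.span (\<Union>d\<in>{e..<n}. inv_basis d)" if "d < n" for d
  proof (cases "d < e")
    case True
    then have "hcomp d f = 0" using assms(2)
      by (intro poly_mapping_eqI) (auto simp: lookup_deg_ge)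
    then show ?thesis by (simp add: V.span_zero)
  next
    case False
    have "hcomp d f \<in> V.span (inv_basis d)"
      unfolding inv_basis(3) using assms(1) by (simp add: hcomp_invs hcomp_forms)
    moreover have "V.span (inv_basis d) \<subseteq> V.span (\<Union>d\<in>{e..<n}. inv_basis d)"
      using False that by (intro V.span_mono UN_upper) simp
    ultimately show ?thesis by blast
  qed
  then have "(\<Sum>d<n. hcomp d f) \<in> V.span (\<Union>d\<in>{e..<n}. inv_basis d)" by (intro V.span_sum) auto
  then show ?thesis by (simp only: sum_hcomp[OF assms(3)])
qed

lemma span_inv_basis_less: "V.span (inv_basis_less n) = invs \<inter> deg_less n"
proof (rule V.span_subspace)
  show "inv_basis_less n \<subseteq> invs \<inter> deg_less n"
    using inv_basis_forms by (fastforce simp: inv_basis_less_def deg_less_def forms_iff)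
  show "invs \<inter> deg_less n \<subseteq> V.span (inv_basis_less n)"
    using in_span_inv_basis[of _ 0 n] by (auto simp: inv_basis_less_def lessThan_atLeast0)
  show "V.subspace (invs \<inter> deg_less n)" by (intro V.subspace_inter subspace_invs subspace_deg_less)
qed

text \<open>A canonical representative modulo \<open>deg_ge n\<close>, so that submodules of the
  quotient can be compared as spaces of polynomials of degree below \<open>n\<close>.\<close>

abbreviation truncate :: "nat \<Rightarrow> ('x, 'k) mpoly \<Rightarrow> ('x, 'k) mpoly" where
  "truncate n \<equiv> mrestrict {m. tdeg m < n}"

lemma truncate_scale: "truncate n (mpoly_scale c f) = mpoly_scale c (truncate n f)"
  by (simp add: mpoly_scale_eq mrestrict_mconst)

lemma truncate_deg_ge: "f \<in> deg_ge n \<Longrightarrow> truncate n f = 0"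
  by (intro poly_mapping_eqI) (auto simp: lookup_deg_ge)

lemma truncate_eq_0_iff: "truncate n f = 0 \<longleftrightarrow> f \<in> deg_ge n"
proof
  assume "truncate n f = 0"
  then have "Poly_Mapping.keys f \<inter> {m. tdeg m < n} = {}" by (metis keys_mrestrict keys_zero)
  then show "f \<in> deg_ge n" by (auto simp: deg_ge_def not_less[symmetric])
qed (rule truncate_deg_ge)

lemma truncate_deg_less: "truncate n f \<in> deg_less n"
  by (auto simp: deg_less_def keys_mrestrict)

lemma truncate_id: "f \<in> deg_less n \<Longrightarrow> truncate n f = f"
  by (intro poly_mapping_eqI) (auto simp: deg_less_def in_keys_iff)

lemma truncate_eq_sum: "truncate n f = (\<Sum>d<n. hcomp d f)"
  by (intro poly_mapping_eqI) (auto simp: lookup_sum)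

lemma truncate_invs: "f \<in> invs \<Longrightarrow> truncate n f \<in> invs"
  unfolding truncate_eq_sum by (intro invs_sum hcomp_invs)

lemma truncate_diff: "truncate n (f - g) = truncate n f - truncate n g"
  by (intro poly_mapping_eqI) (auto simp: lookup_minus)

lemma truncate_mult: "truncate n (f * truncate n g) = truncate n (f * g)"
proof -
  have "truncate n (g - truncate n g) = 0"
    by (simp add: truncate_diff truncate_id truncate_deg_less)
  then have "f * (g - truncate n g) \<in> deg_ge (0 + n)"
    by (intro deg_ge_mult) (auto simp: truncate_eq_0_iff)
  then have "truncate n (f * (g - truncate n g)) = 0" by (simp add: truncate_eq_0_iff)
  then show ?thesis by (simp add: right_diff_distrib truncate_diff)
qed

definition cut_ideal :: "nat \<Rightarrow> ('x, 'k) mpoly set" where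
  "cut_ideal n = invs \<inter> deg_ge n"

lemma ideal_cut_ideal: "ideal (cut_ideal n) inv_ring"
proof (rule invs_ideal)
  fix t x assume "t \<in> invs" "x \<in> cut_ideal n"
  then show "t * x \<in> cut_ideal n"
    using deg_ge_mult[of t 0 x n] by (auto simp: cut_ideal_def intro: invs_mult)
qed (auto simp: cut_ideal_def intro: invs_add deg_ge_add)

abbreviation "quot_mod n \<equiv> quotient_module inv_ring (cut_ideal n)"
abbreviation "coset n z \<equiv> cut_ideal n +>\<^bsub>inv_ring\<^esub> z"

lemma coset_eq: "coset n z = (\<lambda>h. h + z) ` cut_ideal n"
  by (auto simp: a_r_coset_def')

lemma cut_ideal_group: "x \<in> cut_ideal n \<Longrightarrow> y \<in> cut_ideal n \<Longrightarrow> x - y \<in> cut_ideal n"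
  by (auto simp: cut_ideal_def intro: invs_diff) (metis diff_self truncate_diff truncate_eq_0_iff)

lemma coset_eq_iff: "coset n z = coset n w \<longleftrightarrow> z - w \<in> cut_ideal n"
proof
  assume "coset n z = coset n w"
  moreover have "z \<in> coset n z" unfolding coset_eq by (rule image_eqI[of _ _ 0]) (auto simp: cut_ideal_def)
  ultimately show "z - w \<in> cut_ideal n" by (auto simp: coset_eq)
next
  assume zw: "z - w \<in> cut_ideal n"
  have wz: "w - z \<in> cut_ideal n"
    using cut_ideal_group[of 0 n "z - w"] zw by (simp add: cut_ideal_def)
  have "h + (z - w) \<in> cut_ideal n" "h - (z - w) \<in> cut_ideal n" if "h \<in> cut_ideal n" for h
    using cut_ideal_group[OF that wz] cut_ideal_group[OF that zw] by (simp_all add: algebra_simps)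
  then have "h + z \<in> coset n w" "h + w \<in> coset n z" if "h \<in> cut_ideal n" for h
    unfolding coset_eq using that
    by (auto intro: image_eqI[of _ _ "h + (z - w)"] image_eqI[of _ _ "h - (z - w)"])
  then show "coset n z = coset n w"
    unfolding coset_eq by blast
qed

lemma quot_mod_simps:
  "carrier (quot_mod n) = coset n ` invs"
  "z \<in> invs \<Longrightarrow> w \<in> invs \<Longrightarrow> coset n z \<oplus>\<^bsub>quot_mod n\<^esub> coset n w = coset n (z + w)"
  "t \<in> invs \<Longrightarrow> z \<in> invs \<Longrightarrow> t \<odot>\<^bsub>quot_mod n\<^esub> coset n z = coset n (t * z)"
  "\<zero>\<^bsub>quot_mod n\<^esub> = coset n 0"
proof -
  interpret I: ideal "cut_ideal n" inv_ring by (rule ideal_cut_ideal)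
  show "carrier (quot_mod n) = coset n ` invs"
    by (auto simp: quotient_module_def FactRing_def A_RCOSETS_def')
  show "z \<in> invs \<Longrightarrow> w \<in> invs \<Longrightarrow> coset n z \<oplus>\<^bsub>quot_mod n\<^esub> coset n w = coset n (z + w)"
    using I.a_rcos_sum[of z w] by (simp add: quotient_module_def FactRing_def)
  show "t \<in> invs \<Longrightarrow> z \<in> invs \<Longrightarrow> t \<odot>\<^bsub>quot_mod n\<^esub> coset n z = coset n (t * z)"
    using I.rcoset_mult_add[of t z] by (simp add: quotient_module_def FactRing_def)
  show "\<zero>\<^bsub>quot_mod n\<^esub> = coset n 0"
    by (simp add: quotient_module_def FactRing_def coset_eq)
qed

lemma quot_mod_minus:
  assumes z: "z \<in> invs" shows "inv\<^bsub>add_monoid (quot_mod n)\<^esub> (coset n z) = coset n (- z)"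
proof -
  have "group (add_monoid (quot_mod n))"
  proof (rule groupI)
    fix x assume "x \<in> carrier (add_monoid (quot_mod n))"
    then obtain a where "a \<in> invs" "x = coset n a" by (auto simp: quot_mod_simps)
    then show "\<exists>y\<in>carrier (add_monoid (quot_mod n)). y \<otimes>\<^bsub>add_monoid (quot_mod n)\<^esub> x = \<one>\<^bsub>add_monoid (quot_mod n)\<^esub>"
      by (intro bexI[of _ "coset n (- a)"]) (auto simp: quot_mod_simps invs_uminus)
  qed (auto simp: quot_mod_simps invs_add add.assoc)
  then show ?thesis
    by (rule group.inv_equality) (use z in \<open>auto simp: quot_mod_simps invs_uminus\<close>)
qed

lemma submodule_quot_modI:
  assumes "L \<subseteq> invs" "0 \<in> L" "\<And>x y. x \<in> L \<Longrightarrow> y \<in> L \<Longrightarrow> x + y \<in> L"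
    and mult: "\<And>t x. t \<in> invs \<Longrightarrow> x \<in> L \<Longrightarrow> t * x \<in> L"
  shows "submodule (coset n ` L) inv_ring (quot_mod n)"
proof
  show "coset n ` L \<subseteq> carrier (add_monoid (quot_mod n))"
    using assms(1) by (auto simp: quot_mod_simps)
  show "\<one>\<^bsub>add_monoid (quot_mod n)\<^esub> \<in> coset n ` L"
    using assms(2) by (auto simp: quot_mod_simps)
  fix x y assume "x \<in> coset n ` L" "y \<in> coset n ` L"
  then show "x \<otimes>\<^bsub>add_monoid (quot_mod n)\<^esub> y \<in> coset n ` L"
    using assms(1,3) by (auto simp: quot_mod_simps subset_iff)
next
  fix x assume "x \<in> coset n ` L"
  then obtain z where z: "z \<in> L" "x = coset n z" by auto
  have "- 1 * z \<in> L" using z by (intro mult invs_uminus) auto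
  then show "inv\<^bsub>add_monoid (quot_mod n)\<^esub> x \<in> coset n ` L"
    using z assms(1) by (auto simp: quot_mod_minus subset_iff)
next
  fix t x assume "t \<in> carrier inv_ring" "x \<in> coset n ` L"
  then show "t \<odot>\<^bsub>quot_mod n\<^esub> x \<in> coset n ` L"
    using assms(1) mult by (auto simp: quot_mod_simps subset_iff)
qed

lemma submodule_quot_modD:
  assumes "submodule N inv_ring (quot_mod n)"
  defines "L \<equiv> {z \<in> invs. coset n z \<in> N}"
  shows "N = coset n ` L" "V.subspace L"
proof -
  interpret submodule N inv_ring "quot_mod n" by fact
  show "N = coset n ` L"
    using subset by (auto simp: L_def quot_mod_simps)
  show "V.subspace L"
  proof (rule V.subspaceI)
    show "0 \<in> L" using one_closed by (simp add: L_def quot_mod_simps)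
    show "x + y \<in> L" if "x \<in> L" "y \<in> L" for x y
      using that m_closed[of "coset n x" "coset n y"] by (auto simp: L_def quot_mod_simps invs_add)
    show "mpoly_scale c x \<in> L" if "x \<in> L" for c x
      using that smult_closed[of "mconst c" "coset n x"]
      by (auto simp: L_def quot_mod_simps invs_mconst mpoly_scale_eq invs_mult)
  qed
qed

text \<open>Submodules pull back to K-subspaces because constants are invariant. The truncations of
  these subspaces increase strictly, and every step supplies one more independent vector of degree
  below \<open>n\<close>.\<close>

lemma chain_length_le:
  assumes sub: "\<And>i. i \<le> l \<Longrightarrow> submodule (N i) inv_ring (quot_mod n)"
    and strict: "\<And>i. i < l \<Longrightarrow> N i \<subset> N (Suc i)"
  shows "l \<le> card (inv_basis_less n)"
proof -
  define L where "L i = {z \<in> invs. coset n z \<in> N i}" for i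
  have L: "N i = coset n ` L i" "V.subspace (L i)" if "i \<le> l" for i
    using submodule_quot_modD[OF sub[OF that]] by (auto simp: L_def)
  have "\<exists>B. finite B \<and> card B = j \<and> V.independent B \<and> B \<subseteq> truncate n ` L j" if "j \<le> l" for j
    using that
  proof (induction j)
    case 0
    show ?case by (rule exI[of _ "{}"]) (simp add: V.independent_empty)
  next
    case (Suc j)
    then obtain B where B: "finite B" "card B = j" "V.independent B" "B \<subseteq> truncate n ` L j" by auto
    have Lj: "L j \<subseteq> L (Suc j)" using strict[of j] Suc.prems by (auto simp: L_def)
    obtain c where c: "c \<in> N (Suc j)" "c \<notin> N j" using strict[of j] Suc.prems by auto
    then obtain z where z: "z \<in> L (Suc j)" "c = coset n z" using L(1)[of "Suc j"] Suc.prems by auto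
    have "V.subspace (truncate n ` L j)"
    proof (rule V.subspaceI)
      have Lj: "V.subspace (L j)" using L(2) Suc.prems by simp
      show "0 \<in> truncate n ` L j"
        by (rule image_eqI[of _ _ 0]) (use V.subspace_0[OF Lj] in \<open>auto intro: poly_mapping_eqI\<close>)
      show "x + y \<in> truncate n ` L j" if "x \<in> truncate n ` L j" "y \<in> truncate n ` L j" for x y
        using that V.subspace_add[OF Lj] by (auto simp: image_iff) (metis mrestrict_add)
      show "mpoly_scale c x \<in> truncate n ` L j" if "x \<in> truncate n ` L j" for c x
        using that V.subspace_scale[OF Lj] by (auto simp: image_iff) (metis truncate_scale)
    qed
    then have span: "V.span B \<subseteq> truncate n ` L j" using B(4) by (intro V.span_minimal)
    have notin: "truncate n z \<notin> V.span B"
    proof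
      assume "truncate n z \<in> V.span B"
      then obtain w where w: "w \<in> L j" "truncate n z = truncate n w" using span by auto
      then have "z - w \<in> cut_ideal n"
        using z by (auto simp: cut_ideal_def L_def intro: invs_diff simp flip: truncate_eq_0_iff) (simp add: truncate_diff)
      then have "coset n z = coset n w" by (simp add: coset_eq_iff)
      then show False using c z w by (auto simp: L_def)
    qed
    then have "truncate n z \<notin> B" using V.span_base by blast
    then show ?case
      using B V.independent_insertI[OF notin B(3)] z Lj
      by (intro exI[of _ "insert (truncate n z) B"]) auto
  qed
  from this[OF order_refl] obtain B where B: "finite B" "card B = l" "V.independent B" "B \<subseteq> truncate n ` L l" by auto
  have "B \<subseteq> V.span (inv_basis_less n)"
    unfolding span_inv_basis_less using B(4) by (auto simp: L_def truncate_invs truncate_deg_less)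
  then show ?thesis
    using V.independent_span_bound[OF finite_inv_basis_less B(3)] B(2) by auto
qed

text \<open>Adjoining the elements of a homogeneous basis one by one, in decreasing degree, to the ideal gives
  a chain of ideals, because invariants of positive degree map each basis element into the span of
  the earlier ones.\<close>

lemma chain_exists:
  obtains N where "\<And>i. i \<le> card (inv_basis_less n) \<Longrightarrow> submodule (N i) inv_ring (quot_mod n)"
    and "\<And>i. i < card (inv_basis_less n) \<Longrightarrow> N i \<subset> N (Suc i)"
proof -
  define deg where "deg b = (THE d. b \<in> inv_basis d)" for b
  have deg: "deg b = d" if "b \<in> inv_basis d" for b d
    unfolding deg_def using that inv_basis_degree_unique by blast
  obtain bs0 where bs0: "set bs0 = inv_basis_less n" "distinct bs0"
    using finite_distinct_list[OF finite_inv_basis_less] by blast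
  \<comment> \<open>Ascending order of \<open>n - deg b\<close> is descending order of degree, since
    all degrees are below \<open>n\<close>.\<close>
  define bs where "bs = sort_key (\<lambda>b. n - deg b) bs0"
  have bs: "set bs = inv_basis_less n" "distinct bs" "sorted (map (\<lambda>b. n - deg b) bs)"
    using bs0 by (auto simp: bs_def)
  have len: "length bs = card (inv_basis_less n)" using bs distinct_card by metis
  define S where "S j = V.span (set (take j bs))" for j
  define L where "L j = {z \<in> invs. truncate n z \<in> S j}" for j
  have bsn: "bs ! i \<in> inv_basis (deg (bs ! i))" "deg (bs ! i) < n" if "i < length bs" for i
  proof -
    have "bs ! i \<in> inv_basis_less n" using bs(1) that nth_mem by blast
    then obtain d where "bs ! i \<in> inv_basis d" "d < n" by (auto simp: inv_basis_less_def)
    then show "bs ! i \<in> inv_basis (deg (bs ! i))" "deg (bs ! i) < n" using deg by auto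
  qed
  have higher: "(\<Union>d\<in>{Suc (deg (bs ! i))..<n}. inv_basis d) \<subseteq> set (take i bs)" if i: "i < length bs" for i
  proof
    fix b assume "b \<in> (\<Union>d\<in>{Suc (deg (bs ! i))..<n}. inv_basis d)"
    then have b: "deg b > deg (bs ! i)" "deg b < n" "b \<in> inv_basis_less n" using deg by (auto simp: inv_basis_less_def)
    then obtain p where p: "p < length bs" "b = bs ! p" using bs(1) by (metis in_set_conv_nth)
    have "p < i"
    proof (rule ccontr)
      assume "\<not> p < i"
      then have "n - deg (bs ! i) \<le> n - deg (bs ! p)"
        using sorted_nth_mono[OF bs(3), of i p] p i by simp
      then show False using b p by simp
    qed
    then show "b \<in> set (take i bs)" using p by (auto simp: in_set_conv_nth)
  qed
  \<comment> \<open>The constant term of \<open>t\<close> only rescales \<open>b\<close>; the rest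
    of \<open>t\<close> raises the degree, and all basis elements of higher degree precede
    \<open>b\<close> in the list.\<close>
  have mult: "truncate n (t * b) \<in> S j" if t: "t \<in> invs" and b: "b \<in> set (take j bs)" for t b j
  proof -
    obtain i where i: "i < j" "i < length bs" "b = bs ! i" using b by (auto simp: in_set_conv_nth)
    define c where "c = Poly_Mapping.lookup t 0"
    have tc: "t - mconst c \<in> deg_ge (Suc 0)" by (simp add: deg_ge_1_iff c_def lookup_minus)
    have bf: "b \<in> invs" "b \<in> forms (deg b)" using bsn[OF i(2)] inv_basis_forms i(3) by blast+
    have "(t - mconst c) * b \<in> deg_ge (Suc 0 + deg b)"
      using bf by (intro deg_ge_mult tc) (auto simp: deg_ge_def forms_iff)
    then have "truncate n ((t - mconst c) * b) \<in> deg_ge (Suc (deg b))"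
      by (auto simp: deg_ge_def keys_mrestrict)
    then have "truncate n ((t - mconst c) * b) \<in> V.span (\<Union>d\<in>{Suc (deg b)..<n}. inv_basis d)"
      using t bf by (intro in_span_inv_basis truncate_deg_less truncate_invs invs_mult invs_diff invs_mconst)
    also have "\<dots> \<subseteq> S j"
      unfolding S_def using higher[OF i(2)] i set_take_subset_set_take[of i j bs] by (intro V.span_mono) auto
    finally have "truncate n ((t - mconst c) * b) \<in> S j" .
    moreover have "truncate n (mpoly_scale c b) \<in> S j"
    proof -
      have "b \<in> deg_less n" using bf bsn[OF i(2)] i(3) by (auto simp: deg_less_def forms_iff)
      then show ?thesis unfolding truncate_scale S_def using b by (simp add: truncate_id V.span_scale V.span_base)
    qed
    moreover have "t * b = (t - mconst c) * b + mpoly_scale c b" by (simp add: mpoly_scale_eq algebra_simps)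
    ultimately show ?thesis unfolding S_def by (simp add: mrestrict_add V.span_add)
  qed
  have multS: "truncate n (t * x) \<in> S j" if t: "t \<in> invs" and x: "x \<in> S j" for t x j
    using x unfolding S_def
  proof (induction rule: V.span_induct_alt)
    case base
    have "truncate n (t * 0) = 0" by (simp add: truncate_eq_0_iff)
    then show ?case by (simp add: V.span_zero)
  next
    case (step c b y)
    have "truncate n (t * (mpoly_scale c b + y)) = mpoly_scale c (truncate n (t * b)) + truncate n (t * y)"
      unfolding mpoly_scale_eq distrib_left mrestrict_add mrestrict_mconst[symmetric]
      by (simp only: mult.left_commute)
    then show ?case using step mult[OF t step(1)] by (simp add: S_def V.span_add V.span_scale)
  qed
  have sub: "submodule (coset n ` L j) inv_ring (quot_mod n)" for j
  proof (rule submodule_quot_modI)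
    have "truncate n 0 = 0" by (simp add: truncate_eq_0_iff)
    then show "0 \<in> L j" by (simp add: L_def S_def V.span_zero)
    show "x + y \<in> L j" if "x \<in> L j" "y \<in> L j" for x y
      using that by (auto simp: L_def S_def mrestrict_add invs_add V.span_add)
    show "t * x \<in> L j" if "t \<in> invs" "x \<in> L j" for t x
      using that multS[of t "truncate n x" j] by (auto simp: L_def truncate_mult invs_mult)
  qed (auto simp: L_def)
  have strict: "coset n ` L j \<subset> coset n ` L (Suc j)" if j: "j < length bs" for j
  proof
    have "S j \<subseteq> S (Suc j)"
      unfolding S_def by (intro V.span_mono set_take_subset_set_take) simp
    then show "coset n ` L j \<subseteq> coset n ` L (Suc j)" by (auto simp: L_def)
    let ?b = "bs ! j"
    have b: "?b \<in> invs" "truncate n ?b = ?b"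
      using bsn[OF j] inv_basis_forms[of ?b] by (auto intro!: truncate_id simp: deg_less_def forms_iff)
    have "?b \<in> set (take (Suc j) bs)" using j by (simp add: take_Suc_conv_app_nth)
    then have "?b \<in> L (Suc j)" using b by (simp add: L_def S_def V.span_base)
    moreover have "coset n ?b \<notin> coset n ` L j"
    proof
      assume "coset n ?b \<in> coset n ` L j"
      then obtain w where w: "w \<in> L j" "?b - w \<in> cut_ideal n" by (auto simp: coset_eq_iff)
      then have "truncate n ?b = truncate n w"
        by (auto simp: cut_ideal_def truncate_diff simp flip: truncate_eq_0_iff)
      then have "?b \<in> V.span (set (take j bs))" using w b by (simp add: L_def S_def)
      also have "set (take j bs) \<subseteq> set bs - {?b}"
        using bs(2) j set_take_subset[of j bs] by (auto simp: in_set_conv_nth nth_eq_iff_index_eq)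
      then have "V.span (set (take j bs)) \<subseteq> V.span (set bs - {?b})" by (rule V.span_mono)
      finally have "V.dependent (set bs)" using j V.dependent_def by (metis nth_mem)
      then show False using independent_inv_basis_less bs(1) by simp
    qed
    ultimately show "coset n ` L j \<noteq> coset n ` L (Suc j)" by blast
  qed
  show ?thesis using that[of "\<lambda>j. coset n ` L j"] sub strict len by simp
qed

lemma module_length_quot_mod:
  "module_length inv_ring (quot_mod n) = enat (card (inv_basis_less n))"
  unfolding module_length_def
proof (rule antisym)
  show "Sup {enat l | l. \<exists>N. (\<forall>i\<le>l. submodule (N i) inv_ring (quot_mod n)) \<and> (\<forall>i<l. N i \<subset> N (Suc i))}
      \<le> enat (card (inv_basis_less n))"
  proof (rule Sup_least)
    fix x assume "x \<in> {enat l | l. \<exists>N. (\<forall>i\<le>l. submodule (N i) inv_ring (quot_mod n)) \<and> (\<forall>i<l. N i \<subset> N (Suc i))}"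
    then obtain l N where "x = enat l" "\<forall>i\<le>l. submodule (N i) inv_ring (quot_mod n)" "\<forall>i<l. N i \<subset> N (Suc i)"
      by auto
    then show "x \<le> enat (card (inv_basis_less n))" using chain_length_le[of l N n] by simp
  qed
  show "enat (card (inv_basis_less n))
      \<le> Sup {enat l | l. \<exists>N. (\<forall>i\<le>l. submodule (N i) inv_ring (quot_mod n)) \<and> (\<forall>i<l. N i \<subset> N (Suc i))}"
  proof (rule chain_exists[of n])
    fix N assume "\<And>i. i \<le> card (inv_basis_less n) \<Longrightarrow> submodule (N i) inv_ring (quot_mod n)"
      and "\<And>i. i < card (inv_basis_less n) \<Longrightarrow> N i \<subset> N (Suc i)"
    then show ?thesis by (intro Sup_upper CollectI exI conjI[OF refl] exI[of _ N]) auto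
  qed
qed

end

section \<open>Asymptotics of the Hilbert function\<close>

text \<open>Independence of sets ignores repetitions. Stating it for an indexed family gives
  injectivity as well, so that dimensions can be counted by indices.\<close>

lemma independent_family:
  fixes v :: "'i \<Rightarrow> ('x::finite, 'k::field) mpoly"
  assumes fin: "finite A"
    and ind: "\<And>c i. (\<Sum>i\<in>A. mpoly_scale (c i) (v i)) = 0 \<Longrightarrow> i \<in> A \<Longrightarrow> c i = 0"
  shows "inj_on v A" and "V.independent (v ` A)"
proof -
  show inj: "inj_on v A"
  proof (rule inj_onI, rule ccontr)
    fix i j assume ij: "i \<in> A" "j \<in> A" "v i = v j" "i \<noteq> j"
    define c :: "'i \<Rightarrow> 'k" where "c l = (if l = i then 1 else if l = j then - 1 else 0)" for l
    have "(\<Sum>l\<in>A. mpoly_scale (c l) (v l)) = (\<Sum>l\<in>{i, j}. mpoly_scale (c l) (v l))"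
      using ij fin by (intro sum.mono_neutral_right) (auto simp: c_def V.scale_eq_0_iff)
    also have "\<dots> = 0" using ij by (simp add: c_def V.scale_minus_left)
    finally show False using ind[of c i] ij by (simp add: c_def)
  qed
  show "V.independent (v ` A)"
  proof (rule V.independent_if_scalars_zero)
    fix f x assume "(\<Sum>x\<in>v ` A. mpoly_scale (f x) x) = 0" and x: "x \<in> v ` A"
    then have "(\<Sum>i\<in>A. mpoly_scale (f (v i)) (v i)) = 0" using inj by (simp add: sum.reindex)
    then show "f x = 0" using ind[of "\<lambda>i. f (v i)"] x by auto
  qed (use fin in simp)
qed

lemma card_independent_family_le:
  fixes v :: "'i \<Rightarrow> ('x::finite, 'k::field) mpoly"
  assumes "finite A" "\<And>c i. (\<Sum>i\<in>A. mpoly_scale (c i) (v i)) = 0 \<Longrightarrow> i \<in> A \<Longrightarrow> c i = 0"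
    and "finite B" "v ` A \<subseteq> V.span B"
  shows "card A \<le> card B"
proof -
  have "inj_on v A" using assms(1) by (rule independent_family) (rule assms(2))
  moreover have "V.independent (v ` A)" using assms(1) by (rule independent_family) (rule assms(2))
  then have "card (v ` A) \<le> card B" using V.independent_span_bound[OF assms(3) _ assms(4)] by blast
  ultimately show ?thesis by (simp add: card_image)
qed

lemma forms_mult:
  fixes f :: "('x::finite, 'k::field) mpoly"
  shows "f \<in> forms d \<Longrightarrow> g \<in> forms e \<Longrightarrow> f * g \<in> forms (d + e)"
  unfolding forms_iff
proof
  fix m assume *: "\<forall>m\<in>Poly_Mapping.keys f. tdeg m = d" "\<forall>m\<in>Poly_Mapping.keys g. tdeg m = e"
    and "m \<in> Poly_Mapping.keys (f * g)"
  then obtain a b where "m = a + b" "a \<in> Poly_Mapping.keys f" "b \<in> Poly_Mapping.keys g"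
    using keys_mult[of f g] by blast
  then show "tdeg m = d + e" using * by (simp add: tdeg_add)
qed

lemma one_in_forms: "1 \<in> forms 0"
  by (auto simp: forms_iff)

lemma mvar_in_forms: "mvar x \<in> forms (Suc 0)"
  by (auto simp: forms_iff mvar_def)

lemma forms_power:
  fixes f :: "('x::finite, 'k::field) mpoly"
  shows "f \<in> forms d \<Longrightarrow> f ^ n \<in> forms (n * d)"
  by (induction n) (auto intro: forms_mult simp: one_in_forms)

lemma forms_prod:
  fixes f :: "'i \<Rightarrow> ('x::finite, 'k::field) mpoly"
  shows "finite A \<Longrightarrow> (\<And>i. i \<in> A \<Longrightarrow> f i \<in> forms d) \<Longrightarrow> (\<Prod>i\<in>A. f i) \<in> forms (card A * d)"
  by (induction A rule: finite_induct) (auto intro: forms_mult simp: one_in_forms)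

lemma mvar_nonzero [simp]: "(mvar x :: ('x, 'k::field) mpoly) \<noteq> 0"
proof -
  have "Poly_Mapping.lookup (mvar x :: ('x, 'k) mpoly) (Poly_Mapping.single x 1) = 1"
    by (simp add: mvar_def)
  then show ?thesis by auto
qed

text \<open>A polynomial in one variable over a domain cannot have more roots than its degree;
  \<open>nat_vars\<close> moves the coefficients into a type where this is available.\<close>

lemma poly_vanishing_on_many:
  fixes a :: "nat \<Rightarrow> ('x::finite, 'k::field) mpoly" and z :: "'i \<Rightarrow> ('x, 'k) mpoly"
  assumes "inj_on z A" and "finite A"
    and 0: "\<And>i. i \<in> A \<Longrightarrow> (\<Sum>j<card A. a j * z i ^ j) = 0" and j: "j < card A"
  shows "a j = 0"
proof -
  define p where "p = (\<Sum>j<card A. Polynomial.monom (nat_vars (a j)) j)"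
  have p: "poly p (nat_vars y) = nat_vars (\<Sum>j<card A. a j * y ^ j)" for y
    by (simp add: p_def poly_sum poly_monom nat_vars.hom_sum nat_vars.hom_mult nat_vars.hom_power)
  have "p = 0"
  proof (rule ccontr)
    assume p0: "p \<noteq> 0"
    have "(nat_vars \<circ> z) ` A \<subseteq> {y. poly p y = 0}" using 0 by (auto simp: p)
    moreover have "inj_on (nat_vars \<circ> z) A" using assms(1) by (auto simp: inj_on_def)
    ultimately have "card A \<le> card {y. poly p y = 0}"
      using poly_roots_finite[OF p0] by (metis card_image card_mono)
    also have "\<dots> \<le> Polynomial.degree p" by (rule card_poly_roots_bound[OF p0])
    also have "\<dots> < card A"
      unfolding p_def using j by (intro degree_lessI) (auto simp: coeff_sum)
    finally show False by simp
  qed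
  moreover have "Polynomial.coeff p j = nat_vars (a j)"
    using j by (simp add: p_def coeff_sum)
  ultimately show ?thesis by simp
qed

text \<open>The transposed Vandermonde system: combining the equations with the coefficients of a
  polynomial that vanishes at all \<open>z h\<close> except \<open>z i\<close> isolates
  \<open>r i\<close>.\<close>

lemma moments_vanish:
  fixes r z :: "'i \<Rightarrow> ('x::finite, 'k::field) mpoly"
  assumes inj: "inj_on z A" and fin: "finite A"
    and 0: "\<And>j. j < card A \<Longrightarrow> (\<Sum>i\<in>A. r i * z i ^ j) = 0" and i: "i \<in> A"
  shows "r i = 0"
proof -
  define p where "p = (\<Prod>h\<in>A - {i}. [:- nat_vars (z h), 1:])"
  have "Polynomial.degree p \<le> (\<Sum>h\<in>A - {i}. 1)"
    unfolding p_def using degree_prod_sum_le[of "A - {i}" "\<lambda>h. [:- nat_vars (z h), 1:]"] fin by (simp add: o_def)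
  also have "\<dots> = card (A - {i})" by simp
  also have "\<dots> < card A" using i fin by (rule card_Diff1_less[rotated])
  finally have deg: "Polynomial.degree p < card A" .
  have "(\<Sum>h\<in>A. nat_vars (r h) * poly p (nat_vars (z h)))
      = (\<Sum>h\<in>A. \<Sum>j\<le>Polynomial.degree p. nat_vars (r h) * (Polynomial.coeff p j * nat_vars (z h) ^ j))"
    by (simp add: poly_altdef sum_distrib_left)
  also have "\<dots> = (\<Sum>j\<le>Polynomial.degree p. Polynomial.coeff p j * nat_vars (\<Sum>h\<in>A. r h * z h ^ j))"
    by (subst sum.swap)
      (simp add: nat_vars.hom_sum nat_vars.hom_mult nat_vars.hom_power sum_distrib_left mult.left_commute)
  also have "\<dots> = 0" using 0 deg by (intro sum.neutral) auto
  finally have "(\<Sum>h\<in>A. nat_vars (r h) * poly p (nat_vars (z h))) = 0" .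
  moreover have "poly p (nat_vars (z h)) = 0" if "h \<in> A - {i}" for h
    using that fin by (auto simp: p_def poly_prod)
  then have "(\<Sum>h\<in>A. nat_vars (r h) * poly p (nat_vars (z h))) = nat_vars (r i) * poly p (nat_vars (z i))"
    using fin i by (subst sum.remove[of A i]) auto
  moreover have "poly p (nat_vars (z i)) \<noteq> 0"
    using fin i inj by (auto simp: p_def poly_prod inj_on_def)
  ultimately show ?thesis by simp
qed

text \<open>Together the two bounds fix the leading term \<open>M^d / d!\<close> of the number of
  monomials without expanding the binomial coefficient.\<close>

lemma fact_binomial_upper: "fact d * (M + d choose d) \<le> (M + d) ^ d"
  and fact_binomial_lower: "(M + 1) ^ d \<le> fact d * (M + d choose d)"
proof (induction d)
  case (Suc d)
  have eq: "fact (Suc d) * (M + Suc d choose Suc d) = (M + Suc d) * (fact d * (M + d choose d))"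
    using Suc_times_binomial_eq[of "M + d" d] by (simp add: algebra_simps)
  { case 1
    have "(M + Suc d) * (fact d * (M + d choose d)) \<le> (M + Suc d) * (M + Suc d) ^ d"
      using Suc(1) power_mono[of "M + d" "M + Suc d" d] by (intro mult_le_mono) auto
    then show ?case unfolding eq by simp
  next
    case 2
    have "(M + 1) * (M + 1) ^ d \<le> (M + Suc d) * (fact d * (M + d choose d))"
      using Suc(2) by (intro mult_le_mono) auto
    then show ?case unfolding eq by simp }
qed auto

context linear_group_action begin

text \<open>A relation with invariant coefficients also holds for all conjugates of
  \<open>f\<close>. These are as many as the group has elements, while the degree is
  smaller.\<close>

lemma inv_sum_eq_0:
  assumes "inj_on (\<lambda>g. \<phi> g f) (carrier G)" and "\<And>j. j < card (carrier G) \<Longrightarrow> a j \<in> invs"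
    and "(\<Sum>j<card (carrier G). a j * f ^ j) = 0" and "j < card (carrier G)"
  shows "a j = 0"
proof (rule poly_vanishing_on_many[OF assms(1) fin _ assms(4)])
  fix g assume g: "g \<in> carrier G"
  have "(\<Sum>j<card (carrier G). a j * \<phi> g f ^ j) = \<phi> g (\<Sum>j<card (carrier G). a j * f ^ j)"
    using assms(2) by (simp add: act_sum[OF g] act_times[OF g] act_power[OF g] act_inv[OF g])
  then show "(\<Sum>j<card (carrier G). a j * \<phi> g f ^ j) = 0" using assms(3) g by (simp add: act_zero)
qed

lemma hilbert_upper:
  assumes inj: "inj_on (\<lambda>g. \<phi> g f) (carrier G)"
    and c: "\<And>j. j < card (carrier G) \<Longrightarrow> f ^ j \<in> deg_less c"
  shows "card (carrier G) * card (inv_basis_less n) \<le> card (monomials_less (n + c) :: ('x, 'k) mpoly set)"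
proof -
  let ?N = "card (carrier G)" and ?B = "inv_basis_less n"
  have "card ({..<?N} \<times> ?B) \<le> card (monomials_less (n + c) :: ('x, 'k) mpoly set)"
  proof (rule card_independent_family_le[where v = "\<lambda>(j, b). b * f ^ j"])
    fix k :: "nat \<times> ('x, 'k) mpoly \<Rightarrow> 'k" and i
    assume 0: "(\<Sum>i\<in>{..<?N} \<times> ?B. mpoly_scale (k i) (case i of (j, b) \<Rightarrow> b * f ^ j)) = 0"
      and i: "i \<in> {..<?N} \<times> ?B"
    obtain j b where jb: "i = (j, b)" "j < ?N" "b \<in> ?B" using i by auto
    have B: "b \<in> invs" if "b \<in> ?B" for b using that inv_basis_forms by (auto simp: inv_basis_less_def)
    have "(\<Sum>j<?N. (\<Sum>b\<in>?B. mpoly_scale (k (j, b)) b) * f ^ j)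
        = (\<Sum>j<?N. \<Sum>b\<in>?B. mpoly_scale (k (j, b)) (b * f ^ j))"
      by (simp add: sum_distrib_right mpoly_scale_eq mult.assoc)
    also have "\<dots> = (\<Sum>i\<in>{..<?N} \<times> ?B. mpoly_scale (k i) (case i of (j, b) \<Rightarrow> b * f ^ j))"
      by (subst sum.cartesian_product) (auto intro: sum.cong)
    finally have "(\<Sum>j<?N. (\<Sum>b\<in>?B. mpoly_scale (k (j, b)) b) * f ^ j) = 0" using 0 by simp
    then have "(\<Sum>b\<in>?B. mpoly_scale (k (j, b)) b) = 0"
      by (intro inv_sum_eq_0[OF inj _ _ jb(2), where a = "\<lambda>j. \<Sum>b\<in>?B. mpoly_scale (k (j, b)) b"])
        (auto simp: mpoly_scale_eq intro!: invs_sum invs_mult invs_mconst intro: B)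
    then show "k i = 0"
      using V.independentD[OF independent_inv_basis_less finite_inv_basis_less subset_refl _ jb(3), of "\<lambda>b. k (j, b)"] jb(1)
      by simp
  next
    have "b * f ^ j \<in> deg_less (n + c)" if "b \<in> ?B" "j < ?N" for b j
      using that V.span_base[of b ?B] by (intro deg_less_mult c) (auto simp: span_inv_basis_less)
    then show "(\<lambda>(j, b). b * f ^ j) ` ({..<?N} \<times> ?B) \<subseteq> V.span (monomials_less (n + c))"
      by (auto simp: span_monomials_less)
  qed (auto simp: finite_inv_basis_less finite_monomials_less)
  then show ?thesis by (simp add: card_cartesian_product)
qed

lemma hilbert_lower:
  assumes inj: "inj_on (\<lambda>g. \<phi> g f) (carrier G)"
    and c: "\<And>j. j < card (carrier G) \<Longrightarrow> f ^ j \<in> deg_less c"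
  shows "card (monomials_less n :: ('x, 'k) mpoly set) \<le> card (carrier G) * card (inv_basis_less (n + c))"
proof -
  let ?N = "card (carrier G)" and ?B = "inv_basis_less (n + c)"
  define tr where "tr r = (\<Sum>g\<in>carrier G. \<phi> g r)" for r
  \<comment> \<open>\<open>L\<close> packs the traces of all \<open>f ^ j * r\<close> into one
    polynomial with invariant coefficients. Independence of the powers of \<open>f\<close> recovers
    the traces, and the traces recover \<open>r\<close>, so \<open>L\<close> is injective.\<close>
  define L where "L r = (\<Sum>j<?N. tr (f ^ j * r) * f ^ j)" for r
  have tr_add: "tr (a + b) = tr a + tr b" for a b by (simp add: tr_def act_add sum.distrib)
  have tr_scale: "tr (mpoly_scale k a) = mpoly_scale k (tr a)" for k a
    by (simp add: tr_def mpoly_scale_eq act_times act_mconst sum_distrib_left)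
  have tr0: "tr 0 = 0" by (simp add: tr_def act_zero)
  have L_add: "L (a + b) = L a + L b" for a b
    by (simp add: L_def distrib_left tr_add distrib_right sum.distrib)
  have L_scale: "L (mpoly_scale k a) = mpoly_scale k (L a)" for k a
  proof -
    have "f ^ j * mpoly_scale k a = mpoly_scale k (f ^ j * a)" for j
      by (simp add: mpoly_scale_eq mult.left_commute)
    then have "L (mpoly_scale k a) = (\<Sum>j<?N. mpoly_scale k (tr (f ^ j * a)) * f ^ j)"
      by (simp add: L_def tr_scale)
    then show ?thesis by (simp add: L_def mpoly_scale_eq sum_distrib_left mult.assoc)
  qed
  have L0: "L 0 = 0" by (simp add: L_def tr0)
  have L_sum: "L (\<Sum>i\<in>A. mpoly_scale (k i) (v i)) = (\<Sum>i\<in>A. mpoly_scale (k i) (L (v i)))" for A and k :: "'i \<Rightarrow> 'k" and v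
    by (induction A rule: infinite_finite_induct) (auto simp: L0 L_add L_scale)
  have L_inj: "r = 0" if "L r = 0" for r
  proof -
    have "tr (f ^ j * r) = 0" if "j < ?N" for j
      using inv_sum_eq_0[OF inj, of "\<lambda>j. tr (f ^ j * r)"] \<open>L r = 0\<close> that by (simp add: L_def tr_def trace_invs)
    then have "(\<Sum>g\<in>carrier G. \<phi> g r * \<phi> g f ^ j) = 0" if "j < ?N" for j
      using that by (simp add: tr_def act_times act_power mult.commute)
    then have "\<phi> \<one> r = 0" using moments_vanish[OF inj fin, of "\<lambda>g. \<phi> g r" \<one>] by simp
    then show ?thesis by (simp add: act_one)
  qed
  let ?T = "(\<lambda>(j, b). b * f ^ j) ` ({..<?N} \<times> ?B)"
  have "card (monomials_less n :: ('x, 'k) mpoly set) \<le> card ?T"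
  proof (rule card_independent_family_le[where v = L])
    fix k :: "('x, 'k) mpoly \<Rightarrow> 'k" and i :: "('x, 'k) mpoly"
    assume "(\<Sum>i\<in>monomials_less n. mpoly_scale (k i) (L i)) = 0" and i: "i \<in> monomials_less n"
    then have "L (\<Sum>i\<in>monomials_less n. mpoly_scale (k i) i) = 0" by (simp only: L_sum)
    then have "(\<Sum>i\<in>monomials_less n. mpoly_scale (k i) i) = 0" by (rule L_inj)
    then show "k i = 0"
      using V.independentD[OF independent_monomials_less finite_monomials_less subset_refl _ i] by blast
  next
    show "L ` monomials_less n \<subseteq> V.span ?T"
    proof
      fix y assume "y \<in> L ` monomials_less n"
      then obtain r where r: "r \<in> deg_less n" "y = L r"
        using V.span_base[of _ "monomials_less n"] by (auto simp: span_monomials_less)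
      have "a * f ^ j \<in> V.span ?T" if "a \<in> V.span ?B" "j < ?N" for a j
        using that(1)
      proof (induction rule: V.span_induct_alt)
        case (step k b y)
        have "b * f ^ j \<in> V.span ?T" using step(1) that(2) by (intro V.span_base) auto
        moreover have "(mpoly_scale k b + y) * f ^ j = mpoly_scale k (b * f ^ j) + y * f ^ j"
          by (simp add: mpoly_scale_eq algebra_simps)
        ultimately show ?case using step by (simp add: V.span_add V.span_scale)
      qed (simp add: V.span_zero)
      moreover have "tr (f ^ j * r) \<in> V.span ?B" if "j < ?N" for j
      proof -
        have "f ^ j * r \<in> deg_less (n + c)" using deg_less_mult[OF r(1) c[OF that]] by (simp add: mult.commute)
        then have "tr (f ^ j * r) \<in> deg_less (n + c)"
          unfolding tr_def by (intro deg_less_sum deg_less_act)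
        then show ?thesis by (simp add: span_inv_basis_less tr_def trace_invs)
      qed
      ultimately show "y \<in> V.span ?T" unfolding r(2) L_def by (intro V.span_sum) auto
    qed
  qed (auto simp: finite_inv_basis_less finite_monomials_less)
  also have "card ?T \<le> card ({..<?N} \<times> ?B)" by (intro card_image_le) (simp add: finite_inv_basis_less)
  finally show ?thesis by (simp add: card_cartesian_product)
qed

lemma hilbert_limit:
  assumes inj: "inj_on (\<lambda>g. \<phi> g f) (carrier G)"
  defines "d \<equiv> card (UNIV :: 'x set)"
  shows "(\<lambda>n. real (card (inv_basis_less n)) / (real n ^ d / fact d)) \<longlonglongrightarrow> 1 / real (card (carrier G))"
proof -
  let ?N = "card (carrier G)"
  obtain c where c: "\<And>j. j < ?N \<Longrightarrow> f ^ j \<in> deg_less c"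
    using ex_deg_less_finite[of "{..<?N}" "\<lambda>j. f ^ j"] by auto
  have N: "real ?N > 0" using fin by (auto simp: card_gt_0_iff)
  have upper: "real ?N * real (card (inv_basis_less n)) * fact d \<le> real (n + c + d) ^ d" if "n > 0" for n
  proof -
    have "real ?N * real (card (inv_basis_less n)) \<le> real (card (monomials_less (n + c) :: ('x, 'k) mpoly set))"
      using hilbert_upper[OF inj c, of n] by (metis of_nat_le_iff of_nat_mult)
    also have "\<dots> = real (n + c - 1 + d choose d)" using that by (simp add: card_monomials_less d_def)
    finally have "fact d * (real ?N * real (card (inv_basis_less n))) \<le> fact d * real (n + c - 1 + d choose d)"
      by simp
    also have "\<dots> = real (fact d * (n + c - 1 + d choose d))" by simp
    also have "\<dots> \<le> real ((n + c - 1 + d) ^ d)" using fact_binomial_upper of_nat_le_iff by blast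
    also have "\<dots> \<le> real (n + c + d) ^ d" by (simp add: power_mono)
    finally show ?thesis by (simp add: mult_ac)
  qed
  \<comment> \<open>The lower bound is taken at \<open>n - c\<close>, so that both bounds concern
    the same value \<open>inv_basis_less n\<close>.\<close>
  have lower: "(real n - real c) ^ d \<le> real ?N * real (card (inv_basis_less n)) * fact d" if "n > c" for n
  proof -
    have "(real n - real c) ^ d = real ((n - c - 1 + 1) ^ d)" using that by (simp add: of_nat_diff)
    also have "\<dots> \<le> real (fact d * (n - c - 1 + d choose d))" using fact_binomial_lower of_nat_le_iff by blast
    also have "\<dots> = fact d * real (card (monomials_less (n - c) :: ('x, 'k) mpoly set))"
      using that by (simp add: card_monomials_less d_def)
    also have "\<dots> \<le> fact d * (real ?N * real (card (inv_basis_less n)))"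
      using hilbert_lower[OF inj c, of "n - c"] that by (simp flip: of_nat_mult)
    finally show ?thesis by (simp add: mult_ac)
  qed
  have lim1: "(\<lambda>n. (1 - real c / real n) ^ d / real ?N) \<longlonglongrightarrow> (1 - 0) ^ d / real ?N"
    by (intro tendsto_intros lim_const_over_n) (use N in simp)
  have lim2: "(\<lambda>n. (1 + real (c + d) / real n) ^ d / real ?N) \<longlonglongrightarrow> (1 + 0) ^ d / real ?N"
    by (intro tendsto_intros lim_const_over_n) (use N in simp)
  have ev1: "\<forall>\<^sub>F n in sequentially.
      (1 - real c / real n) ^ d / real ?N \<le> real (card (inv_basis_less n)) / (real n ^ d / fact d)"
    using eventually_gt_at_top[of c]
  proof eventually_elim
    case (elim n)
    have "1 - real c / real n = (real n - real c) / real n" using elim by (simp add: field_simps)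
    then have "(1 - real c / real n) ^ d / real ?N = (real n - real c) ^ d / (real n ^ d * real ?N)"
      by (simp add: power_divide)
    also have "\<dots> \<le> real ?N * real (card (inv_basis_less n)) * fact d / (real n ^ d * real ?N)"
      using elim by (intro divide_right_mono lower) auto
    finally show ?case using N by (simp add: field_simps)
  qed
  have ev2: "\<forall>\<^sub>F n in sequentially.
      real (card (inv_basis_less n)) / (real n ^ d / fact d) \<le> (1 + real (c + d) / real n) ^ d / real ?N"
    using eventually_gt_at_top[of 0]
  proof eventually_elim
    case (elim n)
    have eq: "1 + real (c + d) / real n = real (n + c + d) / real n" using elim by (simp add: field_simps)
    have "real (card (inv_basis_less n)) / (real n ^ d / fact d)
        = real ?N * real (card (inv_basis_less n)) * fact d / (real n ^ d * real ?N)"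
      using N by (simp add: field_simps)
    also have "\<dots> \<le> real (n + c + d) ^ d / (real n ^ d * real ?N)"
      using elim by (intro divide_right_mono upper) auto
    finally show ?case unfolding eq by (simp add: power_divide)
  qed
  have one: "(1 - 0) ^ d / real ?N = 1 / real ?N" "(1 + 0) ^ d / real ?N = 1 / real ?N" by simp_all
  show ?thesis by (rule tendsto_sandwich[OF ev1 ev2 lim1[unfolded one] lim2[unfolded one]])
qed

end

context small_group_action begin

text \<open>An element acting trivially on the variables fixes all of R, whereas every nonidentity
  element moves some polynomial.\<close>

lemma faithful:
  assumes "g \<in> carrier G" "h \<in> carrier G" "\<And>x. \<phi> g (mvar x) = \<phi> h (mvar x)"
  shows "g = h"
proof (rule ccontr)
  assume "g \<noteq> h"
  let ?k = "inv g \<otimes> h"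
  have k: "?k \<in> carrier G" using assms by simp
  have gk: "g \<otimes> ?k = h" using assms by (simp add: m_assoc[symmetric])
  have "?k \<noteq> \<one>" using gk \<open>g \<noteq> h\<close> assms by auto
  then obtain v where v: "\<phi> ?k v \<noteq> v" using moved[OF k] by blast
  have "\<phi> g v = \<phi> h v"
    by (rule type_ring_hom_ext[OF act_hom act_hom]) (use assms in \<open>auto simp: act_mconst\<close>)
  then have "\<phi> g (\<phi> ?k v) = \<phi> g v" using act_mult[OF assms(1) k, of v] by (simp add: gk)
  then have "\<phi> ?k v = v" by (metis act_mult act_one assms(1) inv_closed l_inv)
  then show False using v by simp
qed

text \<open>Multiplying the variables by distinct powers of an invariant form puts their images into distinct
  degrees, which also works over a finite field, where a linear form with trivial stabiliser may not exist.\<close>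

lemma separating_element: "\<exists>f. inj_on (\<lambda>g. \<phi> g f) (carrier G)"
proof -
  define N where "N = card (carrier G)"
  \<comment> \<open>The norm of a variable is a nonzero invariant form whose degree is the group
    order, hence positive.\<close>
  define s :: "('c, 'd) mpoly" where "s = (\<Prod>g\<in>carrier G. \<phi> g (mvar undefined))"
  have s: "s \<in> invs" "s \<in> forms (N * Suc 0)" "s \<noteq> 0"
    using fin norm_invs forms_prod[OF fin, of "\<lambda>g. \<phi> g (mvar undefined)" "Suc 0"]
    by (auto simp: s_def N_def act_forms mvar_in_forms mpoly_prod_eq_0_iff act_eq_0_iff)
  have N: "N > 0" using fin by (auto simp: N_def card_gt_0_iff)
  define e :: "'c \<Rightarrow> nat" where "e = to_nat_on UNIV"
  have e: "e x = e y \<longleftrightarrow> x = y" for x y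
    using inj_on_to_nat_on[OF countable_finite[OF finite[of "UNIV :: 'c set"]]] by (auto simp: e_def dest: injD)
  define f where "f = (\<Sum>x\<in>UNIV. mvar x * s ^ e x)"
  have "g = h" if g: "g \<in> carrier G" and h: "h \<in> carrier G" and eq: "\<phi> g f = \<phi> h f" for g h
  proof (rule faithful[OF g h])
    fix x
    have comp: "hcomp (Suc 0 + e x * N) (\<phi> g f) = \<phi> g (mvar x) * s ^ e x" if g: "g \<in> carrier G" for g
    proof -
      have "\<phi> g f = (\<Sum>y\<in>UNIV. \<phi> g (mvar y) * s ^ e y)"
        by (simp add: f_def act_sum[OF g] act_times[OF g] act_power[OF g] act_inv[OF g s(1)])
      moreover have "\<phi> g (mvar y) * s ^ e y \<in> forms (Suc 0 + e y * N)" for y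
        using forms_power[OF s(2), of "e y"] by (intro forms_mult act_forms[OF g] mvar_in_forms) simp
      then have "hcomp (Suc 0 + e x * N) (\<phi> g (mvar y) * s ^ e y)
          = (if Suc 0 + e x * N = Suc 0 + e y * N then \<phi> g (mvar y) * s ^ e y else 0)" for y
        by (rule hcomp_of_form)
      ultimately have "hcomp (Suc 0 + e x * N) (\<phi> g f)
          = (\<Sum>y\<in>UNIV. if Suc 0 + e x * N = Suc 0 + e y * N then \<phi> g (mvar y) * s ^ e y else 0)"
        by (simp only: mrestrict_sum)
      then show ?thesis using N by (simp add: e)
    qed
    have "s ^ e x * \<phi> g (mvar x) = s ^ e x * \<phi> h (mvar x)"
      using comp[OF g] comp[OF h] eq by (simp add: mult.commute)
    then show "\<phi> g (mvar x) = \<phi> h (mvar x)" using mpoly_mult_left_cancel[of "s ^ e x"] s(3) by simp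
  qed
  then show ?thesis by (auto simp: inj_on_def)
qed

end

section \<open>The Krull dimension of the ring of invariants\<close>

lemma deg_less_power:
  fixes f :: "('x::finite, 'k::field) mpoly"
  assumes "f \<in> deg_less e" shows "f ^ a \<in> deg_less (Suc (a * e))"
proof (induction a)
  case (Suc a)
  show ?case using deg_less_mult[OF assms Suc] by simp
qed (simp add: deg_less_def)

lemma deg_less_prod:
  fixes f :: "'i \<Rightarrow> ('x::finite, 'k::field) mpoly"
  shows "finite A \<Longrightarrow> (\<And>i. i \<in> A \<Longrightarrow> f i \<in> deg_less e) \<Longrightarrow> (\<Prod>i\<in>A. f i) \<in> deg_less (Suc (card A * e))"
proof (induction A rule: finite_induct)
  case (insert i A)
  then show ?case using deg_less_mult[of "f i" e "\<Prod>i\<in>A. f i" "Suc (card A * e)"] by simp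
qed (simp add: deg_less_def)

text \<open>There are \<open>B^k\<close> products with all exponents below \<open>B\<close>, but
  they lie in a space whose dimension grows like \<open>B^d\<close> for \<open>d\<close> variables,
  and \<open>d < k\<close>.\<close>

lemma algebraic_dependence:
  fixes y :: "nat \<Rightarrow> ('x::finite, 'k::field) mpoly"
  assumes k: "card (UNIV :: 'x set) < k"
  obtains A and c :: "(nat \<Rightarrow> nat) \<Rightarrow> 'k"
  where "finite A" "A \<subseteq> extensional {..<k}" "\<exists>\<alpha>\<in>A. c \<alpha> \<noteq> 0"
    and "(\<Sum>\<alpha>\<in>A. mpoly_scale (c \<alpha>) (\<Prod>i<k. y i ^ \<alpha> i)) = 0"
proof -
  let ?d = "card (UNIV :: 'x set)"
  obtain e0 where e0: "\<forall>i\<in>{..<k}. y i \<in> deg_less e0" using ex_deg_less_finite[of "{..<k}" y] by auto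
  define e where "e = Suc e0"
  have e: "y i \<in> deg_less e" if "i < k" for i using e0 that deg_less_mono[of "y i" e0 e] by (simp add: e_def)
  \<comment> \<open>Just large enough that the factor \<open>(k * e + d)^d\<close> in the dimension
    bound is below \<open>B\<close>.\<close>
  define B where "B = Suc ((k * e + ?d) ^ ?d)"
  \<comment> \<open>Exponent functions are fixed outside \<open>{..<k}\<close>, so different members
    of \<open>A\<close> differ at an index that occurs in the product.\<close>
  define A where "A = PiE {..<k} (\<lambda>_. {..<B})"
  define M where "M = Suc (k * (B * e))"
  have "card (monomials_less M :: ('x, 'k) mpoly set) = (k * (B * e) + ?d) choose ?d"
    by (subst card_monomials_less) (simp_all add: M_def)
  also have "\<dots> \<le> fact ?d * ((k * (B * e) + ?d) choose ?d)" by (simp add: fact_ge_1)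
  also have "\<dots> \<le> (k * (B * e) + ?d) ^ ?d" by (rule fact_binomial_upper)
  also have "\<dots> \<le> (B * (k * e + ?d)) ^ ?d"
    by (rule power_mono) (simp_all add: B_def algebra_simps)
  also have "\<dots> = B ^ ?d * (k * e + ?d) ^ ?d" by (rule power_mult_distrib)
  also have "\<dots> < B ^ ?d * B" by (simp add: B_def)
  also have "\<dots> = B ^ Suc ?d" by simp
  also have "\<dots> \<le> B ^ k" using k by (intro power_increasing) (auto simp: B_def)
  also have "\<dots> = card A" by (simp add: A_def card_PiE)
  finally have less: "card (monomials_less M :: ('x, 'k) mpoly set) < card A" .
  have A: "finite A" by (simp add: A_def finite_PiE)
  have "\<not> (\<forall>c i. (\<Sum>\<alpha>\<in>A. mpoly_scale (c \<alpha>) (\<Prod>i<k. y i ^ \<alpha> i)) = 0 \<longrightarrow> i \<in> A \<longrightarrow> c i = 0)"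
  proof
    assume *: "\<forall>c i. (\<Sum>\<alpha>\<in>A. mpoly_scale (c \<alpha>) (\<Prod>i<k. y i ^ \<alpha> i)) = 0 \<longrightarrow> i \<in> A \<longrightarrow> c i = 0"
    have "card A \<le> card (monomials_less M :: ('x, 'k) mpoly set)"
    proof (rule card_independent_family_le[OF A, where v = "\<lambda>\<alpha>. \<Prod>i<k. y i ^ \<alpha> i"])
      show "(\<lambda>\<alpha>. \<Prod>i<k. y i ^ \<alpha> i) ` A \<subseteq> V.span (monomials_less M)"
      proof (clarsimp simp: span_monomials_less)
        fix \<alpha> assume \<alpha>: "\<alpha> \<in> A"
        have "(\<Prod>i\<in>{..<k}. y i ^ \<alpha> i) \<in> deg_less (Suc (card {..<k} * (B * e)))"
        proof (rule deg_less_prod)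
          fix i assume i: "i \<in> {..<k}"
          then have "Suc (\<alpha> i) \<le> B" using \<alpha> by (auto simp: A_def Suc_le_eq)
          then have "Suc (\<alpha> i) * e \<le> B * e" by (rule mult_le_mono1)
          then have "Suc (\<alpha> i * e) \<le> B * e" by (simp add: e_def)
          then show "y i ^ \<alpha> i \<in> deg_less (B * e)"
            using deg_less_mono[OF deg_less_power[OF e]] i by simp
        qed simp
        then show "(\<Prod>i<k. y i ^ \<alpha> i) \<in> deg_less M" by (simp add: M_def)
      qed
    qed (use * in \<open>auto simp: finite_monomials_less\<close>)
    then show False using less by simp
  qed
  moreover have "A \<subseteq> extensional {..<k}" by (auto simp: A_def PiE_def)
  ultimately show ?thesis using that[OF A] by blast
qed

context linear_group_action begin

lemma primeideal_inv_ringD: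
  assumes "primeideal P inv_ring"
  shows "P \<subseteq> invs" "0 \<in> P" "1 \<notin> P"
    and "\<And>a b. a \<in> P \<Longrightarrow> b \<in> P \<Longrightarrow> a + b \<in> P" "\<And>a. a \<in> P \<Longrightarrow> - a \<in> P"
    and "\<And>t a. t \<in> invs \<Longrightarrow> a \<in> P \<Longrightarrow> t * a \<in> P"
    and "\<And>a b. a \<in> invs \<Longrightarrow> b \<in> invs \<Longrightarrow> a * b \<in> P \<Longrightarrow> a \<in> P \<or> b \<in> P"
proof -
  interpret P: primeideal P inv_ring by fact
  show sub: "P \<subseteq> invs" using P.Icarr by auto
  show "0 \<in> P" using P.zero_closed by simp
  show "1 \<notin> P" using P.one_imp_carrier P.I_notcarr by auto
  show "a + b \<in> P" if "a \<in> P" "b \<in> P" for a b using P.a_closed that by simp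
  show mult: "t * a \<in> P" if "t \<in> invs" "a \<in> P" for t a using P.I_l_closed that by simp
  show "- a \<in> P" if "a \<in> P" for a using mult[of "- 1" a] that by (simp add: invs_uminus)
  show "a \<in> P \<or> b \<in> P" if "a \<in> invs" "b \<in> invs" "a * b \<in> P" for a b using P.I_prime that by simp
qed

text \<open>If \<open>y j\<close> lies in \<open>P (j + 1)\<close> but not in \<open>P j\<close>, then a polynomial relation between the \<open>y j\<close>
  is impossible: divide by the least power of \<open>y j\<close> and pass to \<open>P (j + 1)\<close>.\<close>

lemma no_relation_along_chain:
  assumes P: "\<And>i. i \<le> k \<Longrightarrow> primeideal (P i) inv_ring" and sub: "\<And>i. i < k \<Longrightarrow> P i \<subseteq> P (Suc i)"
    and y: "\<And>i. i < k \<Longrightarrow> y i \<in> P (Suc i) \<and> y i \<notin> P i"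
  shows "j \<le> k \<Longrightarrow> finite A \<Longrightarrow> A \<noteq> {} \<Longrightarrow> \<forall>\<alpha>\<in>A. c \<alpha> \<noteq> 0 \<Longrightarrow>
      \<forall>\<alpha>\<in>A. \<forall>\<beta>\<in>A. (\<forall>i\<in>{j..<k}. \<alpha> i = \<beta> i) \<longrightarrow> \<alpha> = \<beta> \<Longrightarrow>
      (\<Sum>\<alpha>\<in>A. mconst (c \<alpha>) * (\<Prod>i\<in>{j..<k}. y i ^ \<alpha> i)) \<notin> P j"
proof (induction j arbitrary: A rule: inc_induct)
  case base
  then obtain \<alpha> where "\<alpha> \<in> A" by auto
  then have A: "A = {\<alpha>}" using base by auto
  show ?case
  proof
    assume "(\<Sum>\<alpha>\<in>A. mconst (c \<alpha>) * (\<Prod>i\<in>{k..<k}. y i ^ \<alpha> i)) \<in> P k"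
    then have "mconst (c \<alpha>) \<in> P k" by (simp add: A)
    then have "mconst (inverse (c \<alpha>)) * mconst (c \<alpha>) \<in> P k"
      using primeideal_inv_ringD(6)[OF P[OF order_refl]] invs_mconst by blast
    then show False
      using primeideal_inv_ringD(3)[OF P[OF order_refl]] base \<open>\<alpha> \<in> A\<close>
      by (simp flip: mconst.hom_mult)
  qed
next
  case (step j)
  note Pj = primeideal_inv_ringD[OF P[OF less_imp_le[OF step.hyps(2)]]]
  have "Suc j \<le> k" using step.hyps(2) by simp
  note PS = primeideal_inv_ringD[OF P[OF this]]
  define m where "m = Min ((\<lambda>\<alpha>. \<alpha> j) ` A)"
  have m: "m \<le> \<alpha> j" if "\<alpha> \<in> A" for \<alpha> using that step.prems(1) by (simp add: m_def)
  have "m \<in> (\<lambda>\<alpha>. \<alpha> j) ` A" unfolding m_def using step.prems by (intro Min_in) auto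
  then obtain \<alpha>0 where \<alpha>0: "\<alpha>0 \<in> A" "\<alpha>0 j = m" by auto
  have yi: "y i \<in> invs" if "i < k" for i using y[OF that] primeideal_inv_ringD(1)[OF P[of "Suc i"]] that by auto
  have yprod: "(\<Prod>i\<in>{l..<k}. y i ^ \<alpha> i) \<in> invs" for l \<alpha>
    using yi by (auto simp: invs_def act_prod act_power)
  let ?t = "\<lambda>\<alpha>. mconst (c \<alpha>) * (\<Prod>i\<in>{Suc j..<k}. y i ^ \<alpha> i)"
  have t: "?t \<alpha> \<in> invs" for \<alpha> by (intro invs_mult invs_mconst yprod)
  show ?case
  proof
    assume rel: "(\<Sum>\<alpha>\<in>A. mconst (c \<alpha>) * (\<Prod>i\<in>{j..<k}. y i ^ \<alpha> i)) \<in> P j"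
    let ?S = "\<Sum>\<alpha>\<in>A. ?t \<alpha> * y j ^ (\<alpha> j - m)"
    have "mconst (c \<alpha>) * (\<Prod>i\<in>{j..<k}. y i ^ \<alpha> i) = y j ^ m * (?t \<alpha> * y j ^ (\<alpha> j - m))" if "\<alpha> \<in> A" for \<alpha>
    proof -
      have "y j ^ \<alpha> j = y j ^ m * y j ^ (\<alpha> j - m)" using m[OF that] by (simp flip: power_add)
      moreover have "(\<Prod>i\<in>{j..<k}. y i ^ \<alpha> i) = y j ^ \<alpha> j * (\<Prod>i\<in>{Suc j..<k}. y i ^ \<alpha> i)"
        using step.hyps(2) by (rule prod.atLeast_Suc_lessThan)
      ultimately show ?thesis by (simp only: mult_ac)
    qed
    then have "(\<Sum>\<alpha>\<in>A. mconst (c \<alpha>) * (\<Prod>i\<in>{j..<k}. y i ^ \<alpha> i)) = y j ^ m * ?S"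
      by (simp add: sum_distrib_left)
    then have "y j ^ m * ?S \<in> P j" using rel by simp
    moreover have S: "?S \<in> invs" using step.hyps(2) by (intro invs_sum invs_mult[OF t] invs_power yi)
    moreover have "y j ^ n \<notin> P j" for n
    proof (induction n)
      case (Suc n)
      then show ?case
        using Pj(7)[of "y j" "y j ^ n"] y[OF step.hyps(2)] yi[OF step.hyps(2)] invs_power[of "y j" n] by auto
    qed (simp add: Pj(3))
    ultimately have "?S \<in> P j"
      using Pj(7)[of "y j ^ m" ?S] yi[OF step.hyps(2)] invs_power by blast
    then have S': "?S \<in> P (Suc j)" using sub[OF step.hyps(2)] by blast
    \<comment> \<open>Terms outside \<open>?A\<close> keep a positive power of \<open>y j\<close>
      and vanish modulo \<open>P (Suc j)\<close>. Inside \<open>?A\<close> the exponent at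
      \<open>j\<close> is constant, so its members are still distinguished by the later
      exponents.\<close>
    let ?A = "{\<alpha>\<in>A. \<alpha> j = m}"
    have "?S = (\<Sum>\<alpha>\<in>?A. ?t \<alpha> * y j ^ (\<alpha> j - m)) + (\<Sum>\<alpha>\<in>A - ?A. ?t \<alpha> * y j ^ (\<alpha> j - m))"
      using step.prems(1) by (subst sum.subset_diff[of ?A]) auto
    moreover have "(\<Sum>\<alpha>\<in>?A. ?t \<alpha> * y j ^ (\<alpha> j - m)) = (\<Sum>\<alpha>\<in>?A. ?t \<alpha>)"
      by (rule sum.cong) auto
    moreover have rest: "(\<Sum>\<alpha>\<in>D. ?t \<alpha> * y j ^ (\<alpha> j - m)) \<in> P (Suc j)" if "D \<subseteq> A - ?A" for D
    proof -
      have "?t \<alpha> * y j ^ (\<alpha> j - m) \<in> P (Suc j)" if "\<alpha> \<in> A - ?A" for \<alpha>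
      proof -
        have "\<alpha> j - m = Suc (\<alpha> j - m - 1)" using m[of \<alpha>] that by auto
        then have "y j ^ (\<alpha> j - m) = y j ^ Suc (\<alpha> j - m - 1)" by (rule arg_cong)
        then have "?t \<alpha> * y j ^ (\<alpha> j - m) = (?t \<alpha> * y j ^ (\<alpha> j - m - 1)) * y j"
          by (simp only: power_Suc2 mult.assoc)
        moreover have "(?t \<alpha> * y j ^ (\<alpha> j - m - 1)) * y j \<in> P (Suc j)"
          using y[OF step.hyps(2)] yi[OF step.hyps(2)] by (intro PS(6) invs_mult[OF t] invs_power) auto
        ultimately show ?thesis by simp
      qed
      then show ?thesis using that
        by (induction D rule: infinite_finite_induct) (auto simp: PS(2) intro!: PS(4))
    qed
    ultimately have "(\<Sum>\<alpha>\<in>?A. ?t \<alpha>) = ?S + - (\<Sum>\<alpha>\<in>A - ?A. ?t \<alpha> * y j ^ (\<alpha> j - m))"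
      by simp
    also have "\<dots> \<in> P (Suc j)" by (rule PS(4)[OF S' PS(5)[OF rest[OF subset_refl]]])
    finally have "(\<Sum>\<alpha>\<in>?A. ?t \<alpha>) \<in> P (Suc j)" .
    moreover have "(\<Sum>\<alpha>\<in>?A. ?t \<alpha>) \<notin> P (Suc j)"
    proof (rule step.IH)
      show "\<forall>\<alpha>\<in>?A. \<forall>\<beta>\<in>?A. (\<forall>i\<in>{Suc j..<k}. \<alpha> i = \<beta> i) \<longrightarrow> \<alpha> = \<beta>"
      proof (intro ballI impI)
        fix \<alpha> \<beta> assume ab: "\<alpha> \<in> ?A" "\<beta> \<in> ?A" "\<forall>i\<in>{Suc j..<k}. \<alpha> i = \<beta> i"
        then have "\<forall>i\<in>{j..<k}. \<alpha> i = \<beta> i"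
          by (metis (mono_tags, lifting) Suc_leI atLeastLessThan_iff le_neq_implies_less mem_Collect_eq)
        then show "\<alpha> = \<beta>" using ab step.prems(4) by blast
      qed
    qed (use step.prems \<alpha>0 in auto)
    ultimately show False by contradiction
  qed
qed

text \<open>One element from each gap of an overlong chain gives more polynomials than variables.
  They satisfy a relation; its value 0 lies in \<open>P 0\<close>, against
  \<open>no_relation_along_chain\<close>.\<close>

lemma prime_chain_le:
  assumes P: "\<And>i. i \<le> n \<Longrightarrow> primeideal (P i) inv_ring" and strict: "\<And>i. i < n \<Longrightarrow> P i \<subset> P (Suc i)"
  shows "n \<le> card (UNIV :: 'x set)"
proof (rule ccontr)
  assume n: "\<not> n \<le> card (UNIV :: 'x set)"
  have "\<forall>i\<in>{..<n}. \<exists>y. y \<in> P (Suc i) \<and> y \<notin> P i" using strict by blast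
  then obtain y where y: "\<forall>i\<in>{..<n}. y i \<in> P (Suc i) \<and> y i \<notin> P i" by (auto simp: bchoice_iff)
  obtain A and c :: "(nat \<Rightarrow> nat) \<Rightarrow> 'k" where A: "finite A" "A \<subseteq> extensional {..<n}" "\<exists>\<alpha>\<in>A. c \<alpha> \<noteq> 0"
    and rel: "(\<Sum>\<alpha>\<in>A. mpoly_scale (c \<alpha>) (\<Prod>i<n. y i ^ \<alpha> i)) = 0"
    by (rule algebraic_dependence[of n y]) (use n in simp, rule that)
  let ?A = "{\<alpha>\<in>A. c \<alpha> \<noteq> 0}"
  have "(\<Sum>\<alpha>\<in>?A. mconst (c \<alpha>) * (\<Prod>i\<in>{0..<n}. y i ^ \<alpha> i)) = (\<Sum>\<alpha>\<in>A. mpoly_scale (c \<alpha>) (\<Prod>i<n. y i ^ \<alpha> i))"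
    using A(1) by (intro sum.mono_neutral_cong_left) (auto simp: mpoly_scale_eq lessThan_atLeast0)
  then have "(\<Sum>\<alpha>\<in>?A. mconst (c \<alpha>) * (\<Prod>i\<in>{0..<n}. y i ^ \<alpha> i)) \<in> P 0"
    using rel primeideal_inv_ringD(2)[OF P[of 0]] by simp
  moreover have "(\<Sum>\<alpha>\<in>?A. mconst (c \<alpha>) * (\<Prod>i\<in>{0..<n}. y i ^ \<alpha> i)) \<notin> P 0"
  proof (rule no_relation_along_chain)
    show "\<forall>\<alpha>\<in>?A. \<forall>\<beta>\<in>?A. (\<forall>i\<in>{0..<n}. \<alpha> i = \<beta> i) \<longrightarrow> \<alpha> = \<beta>"
      using A(2) by (auto intro!: extensionalityI[of _ "{..<n}"])
  qed (use P strict y A in auto)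
  ultimately show False by contradiction
qed

text \<open>The elementary symmetric functions of the orbit of \<open>a\<close>, up to sign.\<close>

definition orbit_coeff :: "('x, 'k) mpoly \<Rightarrow> nat \<Rightarrow> ('x, 'k) mpoly" where
  "orbit_coeff a j = (\<Sum>S | S \<subseteq> carrier G \<and> card (carrier G - S) = j. \<Prod>g\<in>S. - \<phi> g a)"

text \<open>Left translation by \<open>h\<close> permutes the subsets of the group whose complement
  has size \<open>j\<close>.\<close>

lemma orbit_coeff_invs: "orbit_coeff a j \<in> invs"
proof -
  have "\<phi> h (orbit_coeff a j) = orbit_coeff a j" if h: "h \<in> carrier G" for h
  proof -
    let ?S = "{S. S \<subseteq> carrier G \<and> card (carrier G - S) = j}"
    have inj: "inj_on (\<lambda>g. k \<otimes> g) S" if "k \<in> carrier G" "S \<subseteq> carrier G" for k S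
      using that by (meson inj_onI l_cancel subset_iff)
    have im: "(\<lambda>g. k \<otimes> g) ` S \<in> ?S" if "k \<in> carrier G" "S \<in> ?S" for k S
    proof -
      have S: "S \<subseteq> carrier G" "finite S" using that fin finite_subset by auto
      have "card ((\<lambda>g. k \<otimes> g) ` S) = card S" using inj[OF that(1) S(1)] by (rule card_image)
      moreover have "(\<lambda>g. k \<otimes> g) ` S \<subseteq> carrier G" using that S by auto
      ultimately show ?thesis using that fin S by (auto simp: card_Diff_subset finite_subset)
    qed
    have "\<phi> h (orbit_coeff a j) = (\<Sum>S\<in>?S. \<Prod>g\<in>S. - \<phi> h (\<phi> g a))"
      unfolding orbit_coeff_def act_sum[OF h] act_prod[OF h]
      by (intro sum.cong prod.cong refl) (simp add: act_uminus[OF h])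
    also have "\<dots> = (\<Sum>S\<in>?S. \<Prod>g\<in>(\<lambda>g. h \<otimes> g) ` S. - \<phi> g a)"
    proof (rule sum.cong[OF refl])
      fix S assume "S \<in> ?S"
      then have S: "S \<subseteq> carrier G" by auto
      show "(\<Prod>g\<in>S. - \<phi> h (\<phi> g a)) = (\<Prod>g\<in>(\<lambda>g. h \<otimes> g) ` S. - \<phi> g a)"
        using S h by (subst prod.reindex[OF inj[OF h S]]) (auto intro!: prod.cong simp: act_mult)
    qed
    also have "\<dots> = (\<Sum>S\<in>?S. \<Prod>g\<in>S. - \<phi> g a)"
    proof (rule sum.reindex_bij_witness[of _ "\<lambda>S. (\<lambda>g. inv h \<otimes> g) ` S" "\<lambda>S. (\<lambda>g. h \<otimes> g) ` S"])
      show "(\<lambda>g. inv h \<otimes> g) ` (\<lambda>g. h \<otimes> g) ` S = S" if "S \<in> ?S" for S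
        using that h by (force simp: image_image m_assoc[symmetric] subset_iff)
      show "(\<lambda>g. h \<otimes> g) ` (\<lambda>g. inv h \<otimes> g) ` S = S" if "S \<in> ?S" for S
        using that h by (force simp: image_image m_assoc[symmetric] subset_iff)
    qed (use im h in auto)
    finally show ?thesis by (simp add: orbit_coeff_def)
  qed
  then show ?thesis by (simp add: invs_def)
qed

text \<open>The product of all \<open>a - \<phi> g a\<close> has a zero factor at the identity;
  expanding it over subsets, grouped by the size of the complement, produces the
  coefficients.\<close>

lemma orbit_polynomial_root: "(\<Sum>j\<le>card (carrier G). orbit_coeff a j * a ^ j) = 0"
proof -
  let ?C = "carrier G"
  have "(\<Prod>g\<in>?C. - \<phi> g a + a) = (\<Sum>S\<in>Pow ?C. (\<Prod>g\<in>S. - \<phi> g a) * (\<Prod>g\<in>?C - S. a))"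
    using fin by (rule prod_add)
  also have "\<dots> = (\<Sum>S\<in>Pow ?C. (\<Prod>g\<in>S. - \<phi> g a) * a ^ card (?C - S))" by simp
  also have "\<dots> = (\<Sum>j\<le>card ?C. \<Sum>S\<in>{S\<in>Pow ?C. card (?C - S) = j}. (\<Prod>g\<in>S. - \<phi> g a) * a ^ card (?C - S))"
    using fin by (intro sum.group[symmetric]) (auto intro: card_mono)
  also have "\<dots> = (\<Sum>j\<le>card ?C. orbit_coeff a j * a ^ j)"
    by (intro sum.cong refl) (auto simp: orbit_coeff_def sum_distrib_right intro!: sum.cong)
  finally have eq: "(\<Prod>g\<in>?C. - \<phi> g a + a) = (\<Sum>j\<le>card ?C. orbit_coeff a j * a ^ j)" .
  have "(\<Prod>g\<in>?C. - \<phi> g a + a) = 0"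
    by (subst mpoly_prod_eq_0_iff[OF fin]) (auto intro!: bexI[of _ \<one>] simp: act_one)
  then show ?thesis using eq by simp
qed

lemma orbit_coeff_top: "orbit_coeff a (card (carrier G)) = 1"
proof -
  have "{S. S \<subseteq> carrier G \<and> card (carrier G - S) = card (carrier G)} = {{}}"
  proof -
    have "S = {}" if "S \<subseteq> carrier G" "card (carrier G - S) = card (carrier G)" for S
    proof -
      have "carrier G - S = carrier G" using that fin by (intro card_subset_eq) auto
      then show ?thesis using that by blast
    qed
    then show ?thesis by auto
  qed
  then show ?thesis by (simp add: orbit_coeff_def)
qed

text \<open>The chain consists of the contractions of the ideals generated by \<open>i\<close> of
  the variables. Strictness is the incomparability argument for integral extensions, carried out
  with the orbit polynomial of one variable.\<close>

lemma prime_chain_exists: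
  obtains P where "\<And>i. i \<le> card (UNIV :: 'x set) \<Longrightarrow> primeideal (P i) inv_ring"
    and "\<And>i. i < card (UNIV :: 'x set) \<Longrightarrow> P i \<subset> P (Suc i)"
proof -
  let ?d = "card (UNIV :: 'x set)"
  obtain idx :: "'x \<Rightarrow> nat" where idx: "bij_betw idx UNIV {0..<?d}" using ex_bij_betw_finite_nat[of "UNIV :: 'x set"] by auto
  define \<rho> :: "nat \<Rightarrow> ('x, 'k) mpoly \<Rightarrow> ('x, 'k) mpoly"
    where "\<rho> i = eval_mpoly mconst (\<lambda>x. if idx x < i then 0 else mvar x)" for i
  have hom: "type_ring_hom (\<rho> i)" for i
    unfolding \<rho>_def by (rule type_ring_hom_eval_mpoly[OF type_ring_hom_mconst])
  have \<rho>c: "\<rho> i (mconst c) = mconst c" and \<rho>v: "\<rho> i (mvar x) = (if idx x < i then 0 else mvar x)" for i c x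
    by (simp_all add: \<rho>_def type_ring_hom_mconst)
  interpret \<rho>: type_ring_hom "\<rho> i" for i by (rule hom)
  have \<rho>\<rho>: "\<rho> (Suc i) (\<rho> i f) = \<rho> (Suc i) f" for i f
    by (rule type_ring_hom_ext[OF type_ring_hom_comp[OF hom hom] hom]) (auto simp: \<rho>c \<rho>v)
  define P where "P i = {f\<in>invs. \<rho> i f = 0}" for i
  have prime: "primeideal (P i) inv_ring" for i
  proof (rule primeidealI)
    show "ideal (P i) inv_ring"
      by (rule invs_ideal) (auto simp: P_def \<rho>.hom_add \<rho>.hom_mult intro: invs_add invs_mult)
    have "1 \<notin> P i" by (simp add: P_def)
    then show "carrier inv_ring \<noteq> P i" using invs_one by (metis inv_ring_simps(1))
  qed (auto simp: P_def \<rho>.hom_mult cring_inv_ring)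
  have strict: "P i \<subset> P (Suc i)" if i: "i < ?d" for i
  proof
    show "P i \<subseteq> P (Suc i)" using \<rho>\<rho>[of i] by (auto simp: P_def) (metis \<rho>.hom_zero)
    obtain x where x: "idx x = i" using idx i unfolding bij_betw_def by (metis atLeast0LessThan imageE lessThan_iff)
    define a :: "('x, 'k) mpoly" where "a = mvar x"
    have a: "\<rho> i a = a" "\<rho> (Suc i) a = 0" "a \<noteq> 0" by (simp_all add: a_def \<rho>v x)
    let ?N = "card (carrier G)" and ?c = "orbit_coeff a"
    \<comment> \<open>The lowest coefficient that survives \<rho> at \<open>i\<close>. Dividing the
      relation by \<open>a ^ j\<close> and then setting \<open>a\<close> to 0 shows that the next
      \<rho> kills it, so it lies in the next prime and not in this one.\<close>
    define j where "j = (LEAST j. \<rho> i (?c j) \<noteq> 0)"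
    have top: "\<rho> i (?c ?N) \<noteq> 0" by (simp add: orbit_coeff_top)
    have j: "\<rho> i (?c j) \<noteq> 0" unfolding j_def by (rule LeastI[of _ ?N]) (rule top)
    have jN: "j \<le> ?N" unfolding j_def by (rule Least_le) (rule top)
    have below: "\<rho> i (?c l) = 0" if "l < j" for l using that not_less_Least unfolding j_def by blast
    have "0 = \<rho> i (\<Sum>l\<le>?N. ?c l * a ^ l)" by (simp add: orbit_polynomial_root)
    also have "\<dots> = (\<Sum>l\<le>?N. \<rho> i (?c l) * a ^ l)" by (simp add: \<rho>.hom_sum \<rho>.hom_mult \<rho>.hom_power a)
    also have "\<dots> = (\<Sum>l\<in>{j..?N}. \<rho> i (?c l) * a ^ l)"
      using below by (intro sum.mono_neutral_right) auto
    also have "\<dots> = (\<Sum>l\<in>{j..?N}. a ^ j * (\<rho> i (?c l) * a ^ (l - j)))"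
    proof (rule sum.cong[OF refl])
      fix l assume "l \<in> {j..?N}"
      then have "a ^ l = a ^ j * a ^ (l - j)" by (simp flip: power_add)
      then show "\<rho> i (?c l) * a ^ l = a ^ j * (\<rho> i (?c l) * a ^ (l - j))" by (simp only: mult_ac)
    qed
    also have "\<dots> = a ^ j * (\<Sum>l\<in>{j..?N}. \<rho> i (?c l) * a ^ (l - j))" by (simp add: sum_distrib_left)
    finally have "a ^ j * (\<Sum>l\<in>{j..?N}. \<rho> i (?c l) * a ^ (l - j)) = 0" by (rule sym)
    then have "(\<Sum>l\<in>{j..?N}. \<rho> i (?c l) * a ^ (l - j)) = 0"
      using a(3) by (simp only: mpoly_mult_eq_0_iff mpoly_power_eq_0_iff) simp
    then have "0 = \<rho> (Suc i) (\<Sum>l\<in>{j..?N}. \<rho> i (?c l) * a ^ (l - j))" by simp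
    also have "\<dots> = (\<Sum>l\<in>{j..?N}. \<rho> (Suc i) (?c l) * 0 ^ (l - j))"
      by (simp add: \<rho>.hom_sum \<rho>.hom_mult \<rho>.hom_power a \<rho>\<rho>)
    also have "\<dots> = (\<Sum>l\<in>{j..?N}. if l = j then \<rho> (Suc i) (?c j) else 0)"
      by (rule sum.cong) auto
    also have "\<dots> = \<rho> (Suc i) (?c j)" using jN by simp
    finally have "?c j \<in> P (Suc i)" "?c j \<notin> P i" using j by (auto simp: P_def orbit_coeff_invs)
    then show "P i \<noteq> P (Suc i)" by blast
  qed
  show ?thesis using that[of P] prime strict by blast
qed

lemma krull_dim_inv_ring: "krull_dim inv_ring = enat (card (UNIV :: 'x set))"
  unfolding krull_dim_def
proof (rule antisym)
  show "Sup {enat n | n. \<exists>P. (\<forall>i\<le>n. primeideal (P i) inv_ring) \<and> (\<forall>i<n. P i \<subset> P (Suc i))}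
      \<le> enat (card (UNIV :: 'x set))"
  proof (rule Sup_least)
    fix l assume "l \<in> {enat n | n. \<exists>P. (\<forall>i\<le>n. primeideal (P i) inv_ring) \<and> (\<forall>i<n. P i \<subset> P (Suc i))}"
    then obtain n P where "l = enat n" "\<forall>i\<le>n. primeideal (P i) inv_ring" "\<forall>i<n. P i \<subset> P (Suc i)" by auto
    then show "l \<le> enat (card (UNIV :: 'x set))" using prime_chain_le[of n P] by simp
  qed
  show "enat (card (UNIV :: 'x set))
      \<le> Sup {enat n | n. \<exists>P. (\<forall>i\<le>n. primeideal (P i) inv_ring) \<and> (\<forall>i<n. P i \<subset> P (Suc i))}"
  proof (rule prime_chain_exists)
    fix P assume "\<And>i. i \<le> card (UNIV :: 'x set) \<Longrightarrow> primeideal (P i) inv_ring"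
      and "\<And>i. i < card (UNIV :: 'x set) \<Longrightarrow> P i \<subset> P (Suc i)"
    then show ?thesis by (intro Sup_upper CollectI exI conjI[OF refl] exI[of _ P]) auto
  qed
qed

end

section \<open>The differential signature\<close>

lemma (in small_group_action) diff_signature_inv_ring:
  "diff_signature (ring_of_type_algebra :: 'd ring) inv_ring (invariant_forms G \<phi>)
     = ereal (1 / real (card (carrier G)))"
proof -
  let ?d = "card (UNIV :: 'c set)"
  let ?a = "\<lambda>n. ereal_of_enat (module_length inv_ring (quotient_module inv_ring
      (diff_power (ring_of_type_algebra :: 'd ring) inv_ring (homogeneous_maximal_ideal inv_ring (invariant_forms G \<phi>)) n)))
    / ereal (real n ^ ?d / fact ?d)"
  obtain f where f: "inj_on (\<lambda>g. \<phi> g f) (carrier G)" using separating_element by blast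
  have "(\<lambda>n. ereal (real (card (inv_basis_less n)) / (real n ^ ?d / fact ?d))) \<longlonglongrightarrow> ereal (1 / real (card (carrier G)))"
    using hilbert_limit[OF f] by (simp only: tendsto_ereal)
  \<comment> \<open>Restricting to \<open>n > 0\<close> excludes the junk value of the differential
    power at 0.\<close>
  moreover have "\<forall>\<^sub>F n in sequentially. ereal (real (card (inv_basis_less n)) / (real n ^ ?d / fact ?d)) = ?a n"
    using eventually_gt_at_top[of 0]
  proof eventually_elim
    case (elim n)
    then show ?case
      using module_length_quot_mod[of n] by (simp add: diff_power_inv_ring flip: cut_ideal_def)
  qed
  ultimately have "?a \<longlonglongrightarrow> ereal (1 / real (card (carrier G)))"
    by (rule Lim_transform_eventually)
  then have "limsup ?a = ereal (1 / real (card (carrier G)))"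
    by (intro lim_imp_Limsup) simp
  then show ?thesis by (simp add: diff_signature_def krull_dim_inv_ring Let_def)
qed

section \<open>Linear forms, hyperplanes and pseudoreflections\<close>

lemma sum_scaled_mvar_eq_0:
  fixes c :: "'x::finite \<Rightarrow> 'k::field"
  assumes "(\<Sum>x\<in>UNIV. mpoly_scale (c x) (mvar x)) = 0" shows "c z = 0"
proof -
  have "Poly_Mapping.single x (1 :: nat) = Poly_Mapping.single z 1 \<longleftrightarrow> x = z" for x
    by (metis lookup_single_eq lookup_single_not_eq one_neq_zero)
  then have "Poly_Mapping.lookup (\<Sum>x\<in>UNIV. mpoly_scale (c x) (mvar x)) (Poly_Mapping.single z 1) = c z"
    by (simp add: lookup_sum mpoly_scale_def mvar_def mult_single lookup_single when_def)
  then show ?thesis using assms by simp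
qed

lemma forms_1_basis:
  shows "V.independent (range mvar :: ('x::finite, 'k::field) mpoly set)"
    and "V.span (range mvar :: ('x, 'k) mpoly set) = forms (Suc 0)"
    and "inj (mvar :: 'x \<Rightarrow> ('x, 'k) mpoly)"
proof -
  show "V.independent (range mvar :: ('x, 'k) mpoly set)"
    by (rule independent_family(2)) (auto intro: sum_scaled_mvar_eq_0)
  show "inj (mvar :: 'x \<Rightarrow> ('x, 'k) mpoly)"
    by (rule independent_family(1)) (auto intro: sum_scaled_mvar_eq_0)
  show "V.span (range mvar :: ('x, 'k) mpoly set) = forms (Suc 0)"
  proof (rule V.span_subspace)
    show "forms (Suc 0) \<subseteq> V.span (range mvar :: ('x, 'k) mpoly set)"
    proof
      fix l :: "('x, 'k) mpoly" assume l: "l \<in> forms (Suc 0)"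
      have "(\<Sum>x\<in>UNIV. mpoly_scale (Poly_Mapping.lookup l (Poly_Mapping.single x 1)) (mvar x)) \<in> V.span (range mvar)"
        by (intro V.span_sum V.span_scale V.span_base) auto
      then show "l \<in> V.span (range mvar)" using linear_form_eq[OF l] by (simp add: mpoly_scale_eq)
    qed
  qed (auto simp: mvar_in_forms subspace_forms)
qed

text \<open>The span is the kernel of the linear functional with value 1 at \<open>z\<close> and
  \<open>k x\<close> at the other variables \<open>x\<close>.\<close>

lemma hyperplane_exists:
  fixes k :: "'x::finite \<Rightarrow> 'k::field" and z :: 'x
  defines "S \<equiv> (\<lambda>x. mvar x - mpoly_scale (k x) (mvar z)) ` (UNIV - {z})"
  shows "hyperplane_of_linear_forms (V.span S)"
proof -
  let ?v = "\<lambda>x. mvar x - mpoly_scale (k x) (mvar z)"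
  have ind: "c y = 0" if 0: "(\<Sum>x\<in>UNIV - {z}. mpoly_scale (c x) (?v x)) = 0" and y: "y \<in> UNIV - {z}" for c y
  proof -
    define t where "t = - (\<Sum>x\<in>UNIV - {z}. c x * k x)"
    define b where "b x = (if x = z then t else c x)" for x
    have "(\<Sum>x\<in>UNIV. mpoly_scale (b x) (mvar x)) = mpoly_scale t (mvar z) + (\<Sum>x\<in>UNIV - {z}. mpoly_scale (c x) (mvar x))"
      by (subst sum.remove[of _ z]) (auto simp: b_def intro!: sum.cong)
    also have "mpoly_scale t (mvar z) = - (\<Sum>x\<in>UNIV - {z}. mpoly_scale (c x * k x) (mvar z))"
      by (simp add: t_def V.scale_minus_left V.scale_sum_left)
    also have "\<dots> + (\<Sum>x\<in>UNIV - {z}. mpoly_scale (c x) (mvar x)) = (\<Sum>x\<in>UNIV - {z}. mpoly_scale (c x) (?v x))"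
      by (simp add: V.scale_right_diff_distrib sum_subtractf)
    finally have "(\<Sum>x\<in>UNIV. mpoly_scale (b x) (mvar x)) = 0" using 0 by simp
    then have "b y = 0" by (rule sum_scaled_mvar_eq_0)
    then show ?thesis using y by (simp add: b_def)
  qed
  have fam: "inj_on ?v (UNIV - {z})" "V.independent (?v ` (UNIV - {z}))"
    by (rule independent_family(1) independent_family(2), simp, erule ind, assumption)+
  have "V.dim (V.span S) = card (UNIV - {z})"
    unfolding S_def V.dim_span_eq_card_independent[OF fam(2)] by (rule card_image[OF fam(1)])
  moreover have "V.dim (forms (Suc 0) :: ('x, 'k) mpoly set) = card (UNIV :: 'x set)"
    using V.dim_span_eq_card_independent[OF forms_1_basis(1)] card_image[OF forms_1_basis(3)]
    by (metis forms_1_basis(2))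
  moreover have "card (UNIV - {z}) + 1 = card (UNIV :: 'x set)"
    by (simp add: card_Diff_singleton card_gt_0_iff)
  moreover have "V.span S \<subseteq> forms (Suc 0)"
    by (intro V.span_minimal subspace_forms)
      (auto simp: S_def intro!: V.subspace_diff[OF subspace_forms] V.subspace_scale[OF subspace_forms] mvar_in_forms)
  ultimately show ?thesis by (simp add: hyperplane_of_linear_forms_def)
qed

text \<open>If all differences \<open>\<phi> g w - w\<close> were multiples of one form,
  \<open>g - 1\<close> would have rank one on linear forms and \<open>g\<close> would fix a
  hyperplane. The quotients \<open>c x / c z\<close> are chosen so that the multiples cancel in
  \<open>x - (c x / c z) z\<close>.\<close>

lemma (in linear_group_action) small_group_actionI:
  assumes no_reflections: "\<And>g H. g \<in> carrier G \<Longrightarrow> g \<noteq> \<one> \<Longrightarrow> hyperplane_of_linear_forms H \<Longrightarrow> \<not> (\<forall>h\<in>H. \<phi> g h = h)"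
  shows "small_group_action G \<phi>"
proof
  fix g assume g: "g \<in> carrier G" "g \<noteq> \<one>"
  have not_fixed: False if fixed: "\<And>x. x \<noteq> z \<Longrightarrow> \<phi> g (mvar x - mpoly_scale (k x) (mvar z)) = mvar x - mpoly_scale (k x) (mvar z)"
    for z and k :: "'x \<Rightarrow> 'k"
  proof -
    let ?S = "(\<lambda>x. mvar x - mpoly_scale (k x) (mvar z)) ` (UNIV - {z})"
    have "V.subspace {f. \<phi> g f = f}"
      by (rule V.subspaceI) (auto simp: act_zero act_add act_times act_mconst mpoly_scale_eq g)
    then have "V.span ?S \<subseteq> {f. \<phi> g f = f}" using fixed by (intro V.span_minimal) auto
    then show False using no_reflections[OF g hyperplane_exists[of k z]] by auto
  qed
  \<comment> \<open>If \<open>g\<close> fixed all variables, it would fix in particular the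
    hyperplane spanned by all but one of them.\<close>
  have "\<not> (\<forall>x. \<phi> g (mvar x) = mvar x)"
    using not_fixed[of undefined "\<lambda>_. 0"] by auto
  then obtain v where v: "v \<in> forms (Suc 0)" "\<phi> g v \<noteq> v" using mvar_in_forms by blast
  let ?l = "\<phi> g v - v"
  have "\<exists>w\<in>forms (Suc 0). \<forall>c. \<phi> g w - w \<noteq> mconst c * ?l"
  proof (rule ccontr)
    assume "\<not> ?thesis"
    then have "\<forall>x. \<exists>c. \<phi> g (mvar x) - mvar x = mconst c * ?l" using mvar_in_forms by blast
    then obtain c where c: "\<And>x. \<phi> g (mvar x) - mvar x = mconst (c x) * ?l" by metis
    obtain z where z: "\<phi> g (mvar z) \<noteq> mvar z" using \<open>\<not> (\<forall>x. \<phi> g (mvar x) = mvar x)\<close> by blast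
    then have "c z \<noteq> 0" using c[of z] by auto
    have eq: "\<phi> g (mvar x) = mvar x + mconst (c x) * ?l" for x using c[of x] by (simp add: algebra_simps)
    have "\<phi> g (mvar x - mpoly_scale (c x / c z) (mvar z)) = mvar x - mpoly_scale (c x / c z) (mvar z)" for x
    proof -
      have "mconst (c x / c z) * (mconst (c z) * ?l) = mconst (c x) * ?l"
        using \<open>c z \<noteq> 0\<close> by (simp add: mult.assoc[symmetric] flip: mconst.hom_mult)
      then show ?thesis
        by (simp only: mpoly_scale_eq act_diff[OF g(1)] act_times[OF g(1)] act_mconst[OF g(1)] eq distrib_left) simp
    qed
    then show False by (rule not_fixed)
  qed
  then show "\<exists>v w. v \<in> forms (Suc 0) \<and> w \<in> forms (Suc 0) \<and> \<phi> g v \<noteq> v \<and> (\<forall>c. \<phi> g w - w \<noteq> mconst c * (\<phi> g v - v))"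
    using v by blast
qed

lemma linear_group_actionI:
  fixes G :: "('g, 'b) monoid_scheme" and \<phi> :: "'g \<Rightarrow> ('x::finite, 'k::field) mpoly \<Rightarrow> ('x, 'k) mpoly"
  assumes "group G" "finite (carrier G)" "of_nat (Coset.order G) \<noteq> (0 :: 'k)" "linear_action G \<phi>"
  shows "linear_group_action G \<phi>"
proof -
  interpret group G by fact
  interpret act: group_action G UNIV \<phi> using assms(4) by (simp add: linear_action_def)
  have hom: "\<phi> g \<in> ring_hom mpoly_algebra mpoly_algebra"
    and lin: "\<phi> g \<in> linear_endos (ring_of_type_algebra :: 'k ring) mpoly_algebra"
    and forms: "\<phi> g ` forms d \<subseteq> forms d" if "g \<in> carrier G" for g d
    using assms(4) that by (auto simp: linear_action_def)
  show ?thesis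
  proof (intro linear_group_action.intro linear_group_action_axioms.intro)
    show "type_ring_hom (\<phi> g)" if "g \<in> carrier G" for g
      using hom[OF that] by (auto simp: ring_hom_def mpoly_algebra_def type_ring_hom_def)
    then have one: "\<phi> g 1 = 1" if "g \<in> carrier G" for g using that type_ring_hom.hom_one by blast
    show "\<phi> g (mconst c) = mconst c" if "g \<in> carrier G" for g c
    proof -
      have "\<phi> g (mpoly_scale c 1) = mpoly_scale c (\<phi> g 1)"
        using lin[OF that] by (simp add: linear_endos_def mpoly_algebra_def ring_of_type_algebra_def)
      then show ?thesis by (simp add: mpoly_scale_eq one[OF that])
    qed
    show "\<phi> \<one>\<^bsub>G\<^esub> f = f" for f using act.id_eq_one by (metis UNIV_I restrict_apply')
  qed (use assms forms in \<open>auto simp: Coset.order_def act.composition_rule\<close>)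
qed

theorem theorem7p1:
  fixes G :: "('g, 'b) monoid_scheme"
    and \<phi> :: "'g \<Rightarrow> ('x::finite, 'k::field) mpoly \<Rightarrow> ('x, 'k) mpoly"
  assumes "group G" and "finite (carrier G)"
    and "of_nat (Coset.order G) \<noteq> (0 :: 'k)"
    and "linear_action G \<phi>"
    and "\<And>g H. g \<in> carrier G \<Longrightarrow> g \<noteq> \<one>\<^bsub>G\<^esub> \<Longrightarrow> hyperplane_of_linear_forms H \<Longrightarrow>
           \<not> (\<forall>h\<in>H. \<phi> g h = h)"
  shows "diff_signature (ring_of_type_algebra :: 'k ring) (invariant_ring G \<phi>) (invariant_forms G \<phi>)
           = ereal (1 / real (Coset.order G))"
proof -
  interpret linear_group_action G \<phi>
    by (rule linear_group_actionI) (fact assms)+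
  interpret small_group_action G \<phi>
    by (rule small_group_actionI) (rule assms(5))
  show ?thesis
    using diff_signature_inv_ring by (simp add: Coset.order_def)
qed

end
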